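(* Assume the cocycle $\sigma$ has the exponential moment property and is centered, and that the strong approximation property holds. Fix $\alpha>0$, $\beta>0$ and $B\ge1$. Then there exists a constant $c>0$ such that for every $t\in\mathbb R$ and $n\ge1$, and every sequence $\mathfrak f=(f_n)_{n\ge0}$ of measurable functions on $\Omega\times\mathbb X$ with $C_\alpha(\mathfrak f)\le B$ and $D_{\alpha,\beta}(\mathfrak f)\le B$, \[\int_{\mathbb X}\mathbb P\big(\tau^{\mathfrak f}_{x,t}>n\big)\nu(dx)\le c\,\frac{1+\max\{t,0\}}{\sqrt n}.\]
   Context: $\mathbb G$ is a second countable locally compact group, $\mu$ a Borel probability measure on $\mathbb G$; $\Omega=\mathbb G^{\mathbb N^*}$ with $\mathbb P=\mu^{\otimes\mathbb N^*}$, coordinates $\omega=(g_1,g_2,\dots)$. $\mathbb X$ is a second countable locally compact space with a continuous $\mathbb G$-action, $\nu$ a $\mu$-stationary Borel probability measure on $\mathbb X$. $\sigma:\mathbb G\times\mathbb X\to\mathbb R$ is a continuous cocycle ($\sigma(g_2g_1,x)=\sigma(g_2,g_1x)+\sigma(g_1,x)$) with exponential moment $\int e^{\alpha'\sup_x|\sigma(g,x)|}\mu(dg)<\infty$ for some $\alpha'>0$, and centered: $\int\sigma(g,x)\mu(dg)=0$ for all $x$. $S^x_n=\sigma(g_n\cdots g_1,x)$. Strong approximation property: on a (possibly enlarged) probability space there exist a standard Wiener process $(B_t)$ and $\mathbf v>0$ such that for each $\epsilon\in(0,\frac14)$ there is $c_\epsilon$ with $\mathbb P(\sup_{0\le s\le1}|S^x_{[ns]}-\mathbf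 vB_{ns}|>n^{1/2-\epsilon})\le c_\epsilon n^{-\epsilon}$ for all $x,n$. $T(\omega,x)=((g_{i+1})_{i\ge1},g_1x)$. For measurable $f_n:\Omega\times\mathbb X\to\mathbb R$: $C_\alpha(\mathfrak f)=\sup_n\int\int e^{\alpha|f_n|}d\mathbb P\,d\nu$; $\mathscr A_p=\sigma(g_1,\dots,g_p)$; $D_{\alpha,\beta}(\mathfrak f)=\sup_n\sup_pe^{\beta p}\big(\int_{\mathbb X}\int_\Omega e^{\alpha|f_n(\omega,x)-\mathbb E(f_n(\cdot,x)|\mathscr A_p)(\omega)|}\mathbb P(d\omega)\nu(dx)-1\big)$. $\tau^{\mathfrak f}_{x,t}=\min\{k\ge1:t+S^x_k+f_k(T^k(\omega,x))-f_0(\omega,x)<0\}$. *)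

theory Defs
  imports "HOL-Probability.Probability"
begin

definition lc_group :: "('g::{second_countable_topology,t2_space} \<Rightarrow> 'g \<Rightarrow> 'g) \<Rightarrow> 'g \<Rightarrow> ('g \<Rightarrow> 'g) \<Rightarrow> bool" where
  "lc_group gm ge gi \<longleftrightarrow>
     (\<forall>a b c. gm (gm a b) c = gm a (gm b c)) \<and>
     (\<forall>a. gm ge a = a \<and> gm a ge = a) \<and>
     (\<forall>a. gm (gi a) a = ge \<and> gm a (gi a) = ge) \<and>
     continuous_on UNIV (\<lambda>(a, b). gm a b) \<and> continuous_on UNIV gi \<and>
     locally_compact_space (euclidean :: 'g topology)"

definition cont_action :: "('g::topological_space \<Rightarrow> 'g \<Rightarrow> 'g) \<Rightarrow> 'g \<Rightarrow> ('g \<Rightarrow> 'x::topological_space \<Rightarrow> 'x) \<Rightarrow> bool" where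
  "cont_action gm ge act \<longleftrightarrow>
     (\<forall>x. act ge x = x) \<and> (\<forall>a b x. act (gm a b) x = act a (act b x)) \<and>
     continuous_on UNIV (\<lambda>(a, x). act a x)"

text \<open>The probability space Omega = G^{N*} with P = mu^{N*}; coordinate i of omega is g_{i+1}.\<close>
definition PP :: "'g measure \<Rightarrow> (nat \<Rightarrow> 'g) measure" where
  "PP \<mu> = PiM UNIV (\<lambda>_. \<mu>)"

text \<open>Product g_n ... g_1 (with g_{i+1} = omega i).\<close>
fun gprod :: "('g \<Rightarrow> 'g \<Rightarrow> 'g) \<Rightarrow> 'g \<Rightarrow> (nat \<Rightarrow> 'g) \<Rightarrow> nat \<Rightarrow> 'g" where
  "gprod gm ge \<omega> 0 = ge"
| "gprod gm ge \<omega> (Suc n) = gm (\<omega> n) (gprod gm ge \<omega> n)"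

definition Swalk :: "('g \<Rightarrow> 'g \<Rightarrow> 'g) \<Rightarrow> 'g \<Rightarrow> ('g \<Rightarrow> 'x \<Rightarrow> real) \<Rightarrow> 'x \<Rightarrow> nat \<Rightarrow> (nat \<Rightarrow> 'g) \<Rightarrow> real" where
  "Swalk gm ge \<sigma> x n \<omega> = \<sigma> (gprod gm ge \<omega> n) x"

definition Tmap :: "('g \<Rightarrow> 'x \<Rightarrow> 'x) \<Rightarrow> (nat \<Rightarrow> 'g) \<times> 'x \<Rightarrow> (nat \<Rightarrow> 'g) \<times> 'x" where
  "Tmap act = (\<lambda>(\<omega>, x). (\<lambda>i. \<omega> (Suc i), act (\<omega> 0) x))"

definition Alg :: "'g measure \<Rightarrow> nat \<Rightarrow> (nat \<Rightarrow> 'g) measure" where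
  "Alg \<mu> p = vimage_algebra (space (PP \<mu>)) (\<lambda>\<omega>. restrict \<omega> {..<p}) (PiM {..<p} (\<lambda>_. \<mu>))"

definition Calpha :: "'g measure \<Rightarrow> 'x measure \<Rightarrow> real \<Rightarrow> (nat \<Rightarrow> (nat \<Rightarrow> 'g) \<Rightarrow> 'x \<Rightarrow> real) \<Rightarrow> ennreal" where
  "Calpha \<mu> \<nu> \<alpha> f = (SUP n. \<integral>\<^sup>+ x. \<integral>\<^sup>+ \<omega>. ennreal (exp (\<alpha> * \<bar>f n \<omega> x\<bar>)) \<partial>PP \<mu> \<partial>\<nu>)"

text \<open>D_{alpha,beta}(f) as an extended nonnegative real (negative values of the inner
quantity, which cannot occur, are truncated at 0, irrelevant for a bound by B >= 1).\<close>
definition Dalphabeta :: "'g measure \<Rightarrow> 'x measure \<Rightarrow> real \<Rightarrow> real \<Rightarrow> (nat \<Rightarrow> (nat \<Rightarrow> 'g) \<Rightarrow> 'x \<Rightarrow> real) \<Rightarrow> ennreal" where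
  "Dalphabeta \<mu> \<nu> \<alpha> \<beta> f = (SUP n. SUP p. ennreal (exp (\<beta> * real p)) *
     ((\<integral>\<^sup>+ x. \<integral>\<^sup>+ \<omega>. ennreal (exp (\<alpha> * \<bar>f n \<omega> x - real_cond_exp (PP \<mu>) (Alg \<mu> p) (\<lambda>\<omega>'. f n \<omega>' x) \<omega>\<bar>)) \<partial>PP \<mu> \<partial>\<nu>) - 1))"

definition tau :: "('g \<Rightarrow> 'g \<Rightarrow> 'g) \<Rightarrow> 'g \<Rightarrow> ('g \<Rightarrow> 'x \<Rightarrow> 'x) \<Rightarrow> ('g \<Rightarrow> 'x \<Rightarrow> real) \<Rightarrow>
    (nat \<Rightarrow> (nat \<Rightarrow> 'g) \<Rightarrow> 'x \<Rightarrow> real) \<Rightarrow> 'x \<Rightarrow> real \<Rightarrow> (nat \<Rightarrow> 'g) \<Rightarrow> enat" where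
  "tau gm ge act \<sigma> f x t \<omega> =
     (let P = (\<lambda>k. 1 \<le> k \<and> t + Swalk gm ge \<sigma> x k \<omega> + case_prod (f k) ((Tmap act ^^ k) (\<omega>, x)) - f 0 \<omega> x < 0)
      in if \<exists>k. P k then enat (LEAST k. P k) else \<infinity>)"

definition std_wiener :: "'q measure \<Rightarrow> (real \<Rightarrow> 'q \<Rightarrow> real) \<Rightarrow> bool" where
  "std_wiener Q W \<longleftrightarrow>
     prob_space Q \<and>
     (\<forall>t. W t \<in> borel_measurable Q) \<and>
     (\<forall>q\<in>space Q. W 0 q = 0) \<and>
     (\<forall>q\<in>space Q. continuous_on {0..} (\<lambda>t. W t q)) \<and>
     (\<forall>s t. 0 \<le> s \<longrightarrow> s < t \<longrightarrow>
        distributed Q lborel (\<lambda>q. W t q - W s q) (\<lambda>y. ennreal (normal_density 0 (sqrt (t - s)) y))) \<and>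
     (\<forall>(ts :: nat \<Rightarrow> real) k. 0 \<le> ts 0 \<longrightarrow> strict_mono ts \<longrightarrow>
        prob_space.indep_vars Q (\<lambda>_. borel) (\<lambda>i q. W (ts (Suc i)) q - W (ts i) q) {..<k})"

text \<open>Strong approximation property: on an enlargement Q of (Omega, P) (a probability space
with a measurable map pi onto Omega whose image measure is P) there are a standard Wiener
process W and v > 0 with the stated uniform bounds.\<close>
definition strong_approx :: "('g \<Rightarrow> 'g \<Rightarrow> 'g) \<Rightarrow> 'g \<Rightarrow> ('g \<Rightarrow> 'x \<Rightarrow> real) \<Rightarrow> 'g measure \<Rightarrow>
    'q measure \<Rightarrow> ('q \<Rightarrow> nat \<Rightarrow> 'g) \<Rightarrow> bool" where
  "strong_approx gm ge \<sigma> \<mu> Q \<pi> \<longleftrightarrow>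
     prob_space Q \<and> \<pi> \<in> measurable Q (PP \<mu>) \<and> distr Q (PP \<mu>) \<pi> = PP \<mu> \<and>
     (\<exists>W v. std_wiener Q W \<and> v > 0 \<and>
        (\<forall>\<epsilon>. 0 < \<epsilon> \<and> \<epsilon> < 1/4 \<longrightarrow> (\<exists>c. \<forall>x. \<forall>n::nat. 1 \<le> n \<longrightarrow>
           measure Q {q \<in> space Q. \<exists>s\<in>{0..1}.
              \<bar>Swalk gm ge \<sigma> x (nat \<lfloor>real n * s\<rfloor>) (\<pi> q) - v * W (real n * s) q\<bar> > real n powr (1/2 - \<epsilon>)}
           \<le> c * real n powr (- \<epsilon>))))"

end

theory Submission
  imports Defs
begin

text \<open>
  Since the cocycle is centered, the walk is a martingale. It is killed below the slowly
  falling barrier \<open>- t - h k\<close> with \<open>h k = A ln (1 + k)\<close>. Up to rare large increments the overshoot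
  at the killing time \<open>k\<close> is at most \<open>h k\<close>, so the mean height of the surviving walk at time \<open>n\<close> is at most
  \<open>t + const + 2 (\<Sum>k<n. (h (k + 1) - h k) P(survive k))\<close>. By the strong approximation, from any height
  the walk climbs by \<open>sqrt N\<close> within \<open>N\<close> steps with probability at least \<open>\<delta>\<close>; together with Markov's inequality
  at finitely many times between \<open>n\<close> and \<open>4 n\<close> this turns the bound on the mean height into a bound on the
  survival probability of order \<open>(mean height) / sqrt n\<close>. Starting from \<open>P(survive k) \<le> 1\<close> this gives
  decay like \<open>n powr (- 1 / 4)\<close>, and inserting that into the sum gives the rate \<open>(1 + t) / sqrt n\<close>.

  For the perturbed walk, the barrier absorbs the typical size of \<open>f k\<close>. If \<open>f k\<close> exceeds \<open>L + h k\<close>,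
  this event is split up according to the number \<open>p\<close> of further steps that determine it. Its probability
  decays exponentially in \<open>L\<close>, \<open>h k\<close> and \<open>p\<close>, and the walk after time \<open>k + p\<close> is independent of it and still
  has to survive, which contributes the factor \<open>1 / sqrt n\<close>.
\<close>

section \<open>The random walk of a cocycle\<close>

text \<open>The barrier falls because increments are unbounded. A fixed allowance H for the
  overshoot leaves an error of order \<open>exp (- a * H / 2)\<close> at every step; the allowance
  \<open>h k\<close> makes these errors summable. The price is that the probability of being killed
  at time k is weighted with the growing \<open>h k\<close>. Summation by parts moves this weight to
  the increments of h, which are at most \<open>A / (k + 1)\<close>, so any polynomial decay of the
  survival probability suffices to bound the sum. Hence the argument runs twice.

  The second obstacle is that \<open>f k\<close> may depend on the whole future and thus on survival
  itself. A bounded Lipschitz cutoff of \<open>f k\<close> is telescoped into parts that depend on p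
  steps only. Invariance of the product of P and \<nu> under T reduces their means at time k to time
  0; this is where stationarity enters and why the estimate is averaged over x. The restart height
  is unbounded and correlated with the part, so a part of mean \<eta>^2 contributes only a factor
  \<eta>; exponential decay can afford this square root.\<close>

locale cocycle_walk = prob_space \<mu>
  for \<mu> :: "'g::{second_countable_topology,t2_space} measure" +
  fixes act :: "'g \<Rightarrow> 'x::{second_countable_topology,t2_space} \<Rightarrow> 'x"
    and \<sigma> :: "'g \<Rightarrow> 'x \<Rightarrow> real"
  assumes sets_mu[measurable_cong]: "sets \<mu> = sets borel"
    and act_measurable: "(\<lambda>(g, x). act g x) \<in> borel \<Otimes>\<^sub>M borel \<rightarrow>\<^sub>M borel"
    and sigma_measurable: "(\<lambda>(g, x). \<sigma> g x) \<in> borel \<Otimes>\<^sub>M borel \<rightarrow>\<^sub>M borel"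
begin

abbreviation \<Omega> :: "(nat \<Rightarrow> 'g) measure" where "\<Omega> \<equiv> Pi\<^sub>M UNIV (\<lambda>_. \<mu>)"

lemma space_mu[simp]: "space \<mu> = UNIV"
  using sets_eq_imp_space_eq[OF sets_mu] by simp

lemma prob_mu[simp]: "emeasure \<mu> UNIV = 1" "measure \<mu> UNIV = 1"
  using emeasure_space_1 prob_space by simp_all

lemma emeasure_mu: "emeasure \<mu> A = ennreal (measure \<mu> A)"
  by (rule emeasure_eq_measure)

lemma sigma_finite_mu: "sigma_finite_measure \<mu>" ..

sublocale sequence_space \<mu> ..

lemma space_Omega[simp]: "space \<Omega> = UNIV"
  by (auto simp: space_PiM PiE_def)

lemma prob_Omega[simp]: "emeasure \<Omega> UNIV = 1" "measure \<Omega> UNIV = 1"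
  using P.emeasure_space_1 P.prob_space by simp_all

lemma emeasure_Omega: "emeasure \<Omega> A = ennreal (measure \<Omega> A)"
  by (rule P.emeasure_eq_measure)

primrec pos :: "'x \<Rightarrow> (nat \<Rightarrow> 'g) \<Rightarrow> nat \<Rightarrow> 'x" where
  "pos x \<omega> 0 = x"
| "pos x \<omega> (Suc k) = act (\<omega> k) (pos x \<omega> k)"

primrec walk :: "'x \<Rightarrow> (nat \<Rightarrow> 'g) \<Rightarrow> nat \<Rightarrow> real" where
  "walk x \<omega> 0 = 0"
| "walk x \<omega> (Suc k) = walk x \<omega> k + \<sigma> (\<omega> k) (pos x \<omega> k)"

lemma measurable_act[measurable (raw)]:
  assumes "f \<in> N \<rightarrow>\<^sub>M borel" "g \<in> N \<rightarrow>\<^sub>M borel"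
  shows "(\<lambda>z. act (f z) (g z)) \<in> N \<rightarrow>\<^sub>M borel"
  using measurable_compose[OF measurable_Pair[OF assms] act_measurable] by simp

lemma measurable_sigma[measurable (raw)]:
  assumes "f \<in> N \<rightarrow>\<^sub>M borel" "g \<in> N \<rightarrow>\<^sub>M borel"
  shows "(\<lambda>z. \<sigma> (f z) (g z)) \<in> N \<rightarrow>\<^sub>M borel"
  using measurable_compose[OF measurable_Pair[OF assms] sigma_measurable] by simp

lemma measurable_coord[measurable (raw)]:
  assumes "g \<in> N \<rightarrow>\<^sub>M \<Omega>"
  shows "(\<lambda>z. g z k) \<in> N \<rightarrow>\<^sub>M borel"
proof -
  have "(\<lambda>\<omega>. \<omega> k) \<in> \<Omega> \<rightarrow>\<^sub>M \<mu>" by simp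
  from measurable_compose[OF assms this] show ?thesis
    by (simp add: measurable_cong_sets[OF refl sets_mu])
qed

lemma measurable_pos[measurable (raw)]:
  assumes [measurable]: "f \<in> N \<rightarrow>\<^sub>M borel" "g \<in> N \<rightarrow>\<^sub>M \<Omega>"
  shows "(\<lambda>z. pos (f z) (g z) k) \<in> N \<rightarrow>\<^sub>M borel"
  by (induction k) simp_all

lemma measurable_walk[measurable (raw)]:
  assumes [measurable]: "f \<in> N \<rightarrow>\<^sub>M borel" "g \<in> N \<rightarrow>\<^sub>M \<Omega>"
  shows "(\<lambda>z. walk (f z) (g z) k) \<in> N \<rightarrow>\<^sub>M borel"
  by (induction k) simp_all

lemma comb_seq_add': "comb_seq k \<omega> \<omega>' (k + j) = \<omega>' j"
  by (simp add: comb_seq_def)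

lemma pos_comb_less: "j \<le> k \<Longrightarrow> pos x (comb_seq k \<omega> \<omega>') j = pos x \<omega> j"
  by (induction j) (auto simp: comb_seq_less)

lemma walk_comb_less: "j \<le> k \<Longrightarrow> walk x (comb_seq k \<omega> \<omega>') j = walk x \<omega> j"
  by (induction j) (auto simp: comb_seq_less pos_comb_less)

lemma pos_comb_add: "pos x (comb_seq k \<omega> \<omega>') (k + j) = pos (pos x \<omega> k) \<omega>' j"
  by (induction j) (auto simp: comb_seq_add' pos_comb_less)

lemma walk_comb_add:
  "walk x (comb_seq k \<omega> \<omega>') (k + j) = walk x \<omega> k + walk (pos x \<omega> k) \<omega>' j"
  by (induction j) (auto simp: comb_seq_add' walk_comb_less pos_comb_add)

lemma pos_comb_Suc: "pos x (comb_seq k \<omega> \<omega>') (Suc k) = act (\<omega>' 0) (pos x \<omega> k)"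
  using comb_seq_add'[of k \<omega> \<omega>' 0] by (simp add: pos_comb_less)

lemma walk_comb_Suc: "walk x (comb_seq k \<omega> \<omega>') (Suc k) = walk x \<omega> k + \<sigma> (\<omega>' 0) (pos x \<omega> k)"
  using comb_seq_add'[of k \<omega> \<omega>' 0] by (simp add: walk_comb_less pos_comb_less)

text \<open>Following the first k coordinates of one sequence by an independent sequence reproduces
  the product measure. This is the source of every Markov property below.\<close>

lemma nn_integral_comb_seq:
  assumes [measurable]: "h \<in> borel_measurable \<Omega>"
  shows "(\<integral>\<^sup>+\<omega>. h \<omega> \<partial>\<Omega>) = (\<integral>\<^sup>+\<omega>. \<integral>\<^sup>+\<omega>'. h (comb_seq k \<omega> \<omega>') \<partial>\<Omega> \<partial>\<Omega>)"
proof -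
  have "(\<integral>\<^sup>+\<omega>. h \<omega> \<partial>\<Omega>) = (\<integral>\<^sup>+\<omega>. h \<omega> \<partial>distr (\<Omega> \<Otimes>\<^sub>M \<Omega>) \<Omega> (\<lambda>(\<omega>, \<omega>'). comb_seq k \<omega> \<omega>'))"
    by (simp add: PiM_comb_seq)
  also have "\<dots> = (\<integral>\<^sup>+z. h (comb_seq k (fst z) (snd z)) \<partial>(\<Omega> \<Otimes>\<^sub>M \<Omega>))"
    by (subst nn_integral_distr) (auto simp: split_beta')
  also have "\<dots> = (\<integral>\<^sup>+\<omega>. \<integral>\<^sup>+\<omega>'. h (comb_seq k \<omega> \<omega>') \<partial>\<Omega> \<partial>\<Omega>)"
    by (subst P.nn_integral_fst[symmetric]) auto
  finally show ?thesis .
qed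

lemma nn_integral_first:
  assumes h: "h \<in> borel_measurable borel"
  shows "(\<integral>\<^sup>+\<omega>. h (\<omega> 0) \<partial>\<Omega>) = (\<integral>\<^sup>+g. h g \<partial>\<mu>)"
proof -
  have [measurable]: "h \<in> borel_measurable \<mu>"
    using h by (simp add: measurable_cong_sets[OF sets_mu refl])
  have "(\<integral>\<^sup>+g. h g \<partial>\<mu>) = (\<integral>\<^sup>+g. h g \<partial>distr \<Omega> \<mu> (\<lambda>\<omega>. \<omega> 0))"
    by (simp add: PiM_component)
  also have "\<dots> = (\<integral>\<^sup>+\<omega>. h (\<omega> 0) \<partial>\<Omega>)"
    by (subst nn_integral_distr) auto
  finally show ?thesis by simp
qed

text \<open>Dependence on the first k coordinates is stated pointwise through splicing rather than
  through a sigma-algebra, so that the Markov property becomes a substitution without exceptional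
  null sets.\<close>

definition adapted :: "nat \<Rightarrow> ((nat \<Rightarrow> 'g) \<Rightarrow> 'b) \<Rightarrow> bool" where
  "adapted k h \<longleftrightarrow> (\<forall>\<omega> \<omega>'. h (comb_seq k \<omega> \<omega>') = h \<omega>)"

lemma nn_integral_markov:
  fixes E :: "(nat \<Rightarrow> 'g) \<Rightarrow> ennreal"
  assumes [measurable]: "E \<in> borel_measurable \<Omega>" and E: "adapted k E"
    and [measurable]: "G \<in> borel_measurable \<Omega>"
  shows "(\<integral>\<^sup>+\<omega>. E \<omega> * G \<omega> \<partial>\<Omega>) = (\<integral>\<^sup>+\<omega>. E \<omega> * (\<integral>\<^sup>+\<omega>'. G (comb_seq k \<omega> \<omega>') \<partial>\<Omega>) \<partial>\<Omega>)"
proof -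
  have "(\<integral>\<^sup>+\<omega>. E \<omega> * G \<omega> \<partial>\<Omega>) = (\<integral>\<^sup>+\<omega>. \<integral>\<^sup>+\<omega>'. E \<omega> * G (comb_seq k \<omega> \<omega>') \<partial>\<Omega> \<partial>\<Omega>)"
    using E by (subst nn_integral_comb_seq[of _ k]) (auto simp: adapted_def)
  also have "\<dots> = (\<integral>\<^sup>+\<omega>. E \<omega> * (\<integral>\<^sup>+\<omega>'. G (comb_seq k \<omega> \<omega>') \<partial>\<Omega>) \<partial>\<Omega>)"
    by (intro nn_integral_cong nn_integral_cmult) measurable
  finally show ?thesis .
qed

text \<open>The conditional bound is required only where E does not vanish. With E an indicator, the
  event may therefore be assumed while estimating the future.\<close>

lemma nn_integral_markov_le:
  fixes E :: "(nat \<Rightarrow> 'g) \<Rightarrow> ennreal"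
  assumes "E \<in> borel_measurable \<Omega>" "adapted k E" "G \<in> borel_measurable \<Omega>"
    and K: "\<And>\<omega>. E \<omega> \<noteq> 0 \<Longrightarrow> (\<integral>\<^sup>+\<omega>'. G (comb_seq k \<omega> \<omega>') \<partial>\<Omega>) \<le> K \<omega>"
  shows "(\<integral>\<^sup>+\<omega>. E \<omega> * G \<omega> \<partial>\<Omega>) \<le> (\<integral>\<^sup>+\<omega>. E \<omega> * K \<omega> \<partial>\<Omega>)"
  unfolding nn_integral_markov[OF assms(1-3)]
  by (intro nn_integral_mono) (metis K mult_left_mono mult_zero_left order_refl zero_le)

end

section \<open>Decay of a monotone sequence from a block recursion\<close>

text \<open>Strong induction on n: m blocks between times of order n / 4 and n shrink the inherited
  bound by \<open>(1 - \<delta>) ^ m\<close>, which outweighs the worse value of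
  \<open>1 / sqrt\<close> at the earlier time. C depends on \<delta> and N0 only, so it serves all
  starting points and heights at once.\<close>

lemma block_recursion:
  fixes \<delta> :: real and N0 :: nat
  assumes \<delta>: "0 < \<delta>" "\<delta> \<le> 1"
  obtains C where "C \<ge> 1"
    "\<And>(u :: nat \<Rightarrow> real) R n. \<lbrakk>antimono u; \<And>k. u k \<le> 1; mono R; \<And>k. R k \<ge> 1;
       \<And>k N. N0 \<le> N \<Longrightarrow> 1 \<le> N \<Longrightarrow> u (k + N) \<le> R (k + N) / sqrt N + (1 - \<delta>) * u k; 1 \<le> n\<rbrakk>
     \<Longrightarrow> u n \<le> C * R n / sqrt n"
proof -
  \<comment> \<open>Comparing \<open>sqrt (m * l)\<close> with \<open>sqrt n\<close> below costs a
    factor 4; with 1/8 the inherited part keeps the factor 1/2.\<close>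
  obtain m0 where "(1 - \<delta>) ^ m0 < 1 / 8"
    using real_arch_pow_inv[of "1/8" "1 - \<delta>"] \<delta> by auto
  moreover have "(1 - \<delta>) ^ Suc m0 \<le> (1 - \<delta>) ^ m0"
    using \<delta> by (intro power_decreasing) auto
  ultimately obtain m where m: "(1 - \<delta>) ^ m \<le> 1 / 8" "m \<ge> 1"
    by (metis le_add1 less_eq_real_def order_trans plus_1_eq_Suc)
  \<comment> \<open>From n1 on, the block length \<open>3 * l\<close> exceeds N0. Below n1 the bound
    \<open>u n \<le> 1\<close> is enough, which accounts for \<open>sqrt n1\<close> in C; the other
    summand of C pays for the m new terms.\<close>
  define n1 where "n1 = 8 * m * (N0 + 1)"
  define C where "C = 8 * real m * sqrt (8 * real m) + sqrt (real n1)"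
  have m_sq: "1 \<le> sqrt (8 * real m)" using m by simp
  have alg: "x * r * (s / q) + 1 / 8 * (c * r * (4 / q)) = (x * s + c / 2) * (r / q)" for x r s q c :: real
    by (cases "q = 0") (simp_all add: field_simps)
  have C1: "C \<ge> 1"
  proof -
    have "1 * 1 \<le> 8 * real m * sqrt (8 * real m)"
      using m m_sq by (intro mult_mono) auto
    moreover have "0 \<le> sqrt (real n1)" by simp
    ultimately show ?thesis unfolding C_def by linarith
  qed
  have main: "u n \<le> C * R n / sqrt n"
    if u: "antimono u" "\<And>k. u k \<le> 1" and R: "mono R" "\<And>k. R k \<ge> 1"
      and rec: "\<And>k N. N0 \<le> N \<Longrightarrow> 1 \<le> N \<Longrightarrow> u (k + N) \<le> R (k + N) / sqrt N + (1 - \<delta>) * u k"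
      and n: "1 \<le> n" for u R :: "nat \<Rightarrow> real" and n :: nat
  proof -
    have iter: "u (k + j * N) \<le> j * R (k + j * N) / sqrt N + (1 - \<delta>) ^ j * u k"
      if N: "N0 \<le> N" "1 \<le> N" for k j N
    proof (induction j)
      case (Suc j)
      have Rle: "R (k + j * N) \<le> R (k + Suc j * N)"
        by (intro monoD[OF R(1)]) auto
      have R0: "0 \<le> R (k + Suc j * N)" using R(2)[of "k + Suc j * N"] by linarith
      have "u (k + Suc j * N) \<le> R (k + Suc j * N) / sqrt N + (1 - \<delta>) * u (k + j * N)"
        using rec[OF N, of "k + j * N"] by (simp add: algebra_simps)
      also have "(1 - \<delta>) * u (k + j * N)
          \<le> (1 - \<delta>) * (j * R (k + j * N) / sqrt N + (1 - \<delta>) ^ j * u k)"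
        using Suc \<delta> by (intro mult_left_mono) auto
      also have "\<dots> = (1 - \<delta>) * (j * R (k + j * N) / sqrt N) + (1 - \<delta>) ^ Suc j * u k"
        by (simp add: algebra_simps)
      also have "(1 - \<delta>) * (j * R (k + j * N) / sqrt N) \<le> 1 * (j * R (k + Suc j * N) / sqrt N)"
        using \<delta> R0 Rle R(2)[of "k + j * N"]
        by (intro mult_mono divide_right_mono mult_left_mono) auto
      finally show ?case by (simp add: algebra_simps add_divide_distrib)
    qed simp
    show ?thesis using n
    proof (induction n rule: less_induct)
      case (less n)
      have Rn: "R n \<ge> 1" by (rule R(2))
      show ?case
      proof (cases "n < n1")
        case True
        have "u n * sqrt n \<le> 1 * sqrt n1"
          using u(2) True by (intro mult_mono) auto
        also have "\<dots> \<le> C * 1" using m by (simp add: C_def)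
        also have "\<dots> \<le> C * R n" using C1 Rn by (intro mult_left_mono) auto
        finally show ?thesis using less.prems by (simp add: field_simps)
      next
        case False
        \<comment> \<open>Starting at time \<open>m * l\<close>, m blocks of length
          \<open>3 * l\<close> end at \<open>4 * m * l\<close>, which is at most n.\<close>
        define l where "l = n div (4 * m)"
        have l_le: "4 * m * l \<le> n" unfolding l_def by simp
        have l_lt: "n < 4 * m * (l + 1)"
          using m unfolding l_def by (simp add: dividend_less_times_div)
        have l_ge: "2 * (N0 + 1) \<le> l"
        proof -
          have "8 * m * (N0 + 1) div (4 * m) \<le> l"
            unfolding l_def using False by (intro div_le_mono) (simp add: n1_def)
          moreover have "8 * m * (N0 + 1) = (4 * m) * (2 * (N0 + 1))" by simp
          ultimately show ?thesis using m by (metis div_mult_self1_is_m mult_is_0 not_one_le_zero zero_neq_numeral neq0_conv)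
        qed
        have l1: "l \<ge> 1" "m * l \<ge> 1" "m * l < n"
        proof -
          show "l \<ge> 1" and ml: "m * l \<ge> 1" using l_ge m by (auto simp: Suc_le_eq)
          have "4 * (m * l) \<le> n" using l_le by (simp add: mult.assoc)
          then show "m * l < n" using ml by linarith
        qed
        have n8: "n \<le> 8 * m * l"
        proof -
          have "4 * m * (l + 1) \<le> 4 * m * (2 * l)" using l1 by (intro mult_left_mono) auto
          moreover have "4 * m * (2 * l) = 8 * m * l" by simp
          ultimately show ?thesis using l_lt by linarith
        qed
        have sq1: "sqrt n \<le> sqrt (8 * m) * sqrt (3 * l)"
        proof -
          have "n \<le> 8 * m * (3 * l)" using n8 by simp
          then have "real n \<le> real (8 * m * (3 * l))" by (simp only: of_nat_le_iff)
          then show ?thesis by (simp add: real_sqrt_mult[symmetric])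
        qed
        have sq2: "sqrt n \<le> 4 * sqrt (m * l)"
        proof -
          have "n \<le> 16 * (m * l)" using n8 by simp
          then have "real n \<le> real (16 * (m * l))" by (simp only: of_nat_le_iff)
          then have "sqrt n \<le> sqrt (16 * real (m * l))" by simp
          then show ?thesis by (simp add: real_sqrt_mult)
        qed
        have pos: "sqrt n > 0" "sqrt (3 * l) > 0" "sqrt (m * l) > 0"
          using less.prems l1 m by auto
        have "u n \<le> u (m * l + m * (3 * l))"
          using l_le by (intro antimonoD[OF u(1)]) (simp add: algebra_simps)
        also have "\<dots> \<le> m * R (m * l + m * (3 * l)) / sqrt (3 * l) + (1 - \<delta>) ^ m * u (m * l)"
          using iter[of "3 * l" "m * l" m] l_ge by simp
        also have "m * R (m * l + m * (3 * l)) / sqrt (3 * l) \<le> m * R n / sqrt (3 * l)"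
          using l_le by (intro divide_right_mono mult_left_mono monoD[OF R(1)]) (auto simp: algebra_simps)
        also have "\<dots> \<le> m * R n * (sqrt (8 * m) / sqrt n)"
        proof -
          have "1 / sqrt (3 * l) \<le> sqrt (8 * m) / sqrt n"
            using sq1 pos by (simp add: field_simps)
          then have "m * R n * (1 / sqrt (3 * l)) \<le> m * R n * (sqrt (8 * m) / sqrt n)"
            using Rn by (intro mult_left_mono) auto
          then show ?thesis by simp
        qed
        also have "(1 - \<delta>) ^ m * u (m * l) \<le> (1 - \<delta>) ^ m * (C * R (m * l) / sqrt (m * l))"
          using less.IH[OF l1(3) l1(2)] \<delta> by (intro mult_left_mono) auto
        also have "\<dots> \<le> (1 / 8) * (C * R n * (4 / sqrt n))"
        proof (intro mult_mono m(1))
          have "R (m * l) \<le> R n" using l1 by (intro monoD[OF R(1)]) auto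
          moreover have "1 / sqrt (m * l) \<le> 4 / sqrt n"
            using sq2 pos by (simp add: field_simps)
          ultimately have "C * R (m * l) * (1 / sqrt (m * l)) \<le> C * R n * (4 / sqrt n)"
            using C1 Rn R(2)[of "m * l"] by (intro mult_mono) auto
          then show "C * R (m * l) / sqrt (m * l) \<le> C * R n * (4 / sqrt n)" by simp
        qed (use C1 R(2)[of "m * l"] in auto)
        also have "m * R n * (sqrt (8 * m) / sqrt n) + (1 / 8) * (C * R n * (4 / sqrt n))
            = (m * sqrt (8 * m) + C / 2) * (R n / sqrt n)"
          by (rule alg)
        also have "\<dots> \<le> C * (R n / sqrt n)"
        proof (intro mult_right_mono)
          have "0 \<le> real m * sqrt (8 * real m)" by simp
          then show "m * sqrt (8 * m) + C / 2 \<le> C" unfolding C_def by simp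
        qed (use Rn in auto)
        finally show ?thesis by simp
      qed
    qed
  qed
  show thesis
  proof (rule that[OF C1], goal_cases)
    case (1 u R n)
    show ?case by (rule main[OF 1])
  qed
qed

section \<open>Moment and overshoot estimates for the centered walk\<close>

text \<open>The assumption \<open>upward\<close> is the form in which strong approximation enters.
  It is uniform in x, so it applies after a restart at a random position.\<close>

locale centered_walk = cocycle_walk \<mu> act \<sigma>
  for \<mu> :: "'g::{second_countable_topology,t2_space} measure"
    and act :: "'g \<Rightarrow> 'x::{second_countable_topology,t2_space} \<Rightarrow> 'x" and \<sigma> +
  fixes a M \<delta> :: real and N0 :: nat
  assumes a_pos: "0 < a"
    and exp_moment: "\<And>x. (\<integral>\<^sup>+g. ennreal (exp (a * \<bar>\<sigma> g x\<bar>)) \<partial>\<mu>) \<le> ennreal M"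
    and centered: "\<And>x. (\<integral>g. \<sigma> g x \<partial>\<mu>) = 0"
    and \<delta>_pos: "0 < \<delta>"
    and upward: "\<And>x N. N0 \<le> N \<Longrightarrow> \<delta> \<le> measure \<Omega> {\<omega>. walk x \<omega> N > sqrt N}"
begin

lemma measurable_sigma_mu[measurable]: "(\<lambda>g. \<sigma> g x) \<in> borel_measurable \<mu>"
  by (rule measurable_sigma) (simp_all add: measurable_cong_sets[OF sets_mu refl])

lemma integrable_exp: "integrable \<mu> (\<lambda>g. exp (a * \<bar>\<sigma> g x\<bar>))"
  by (rule integrableI_bounded)
    (use exp_moment[of x] in \<open>auto simp: less_top[symmetric] top_unique intro: le_less_trans\<close>)

lemma M_ge_1: "1 \<le> M"
proof -
  have "(\<integral>\<^sup>+g. 1 \<partial>\<mu>) \<le> (\<integral>\<^sup>+g. ennreal (exp (a * \<bar>\<sigma> g undefined\<bar>)) \<partial>\<mu>)"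
    using a_pos by (intro nn_integral_mono) (auto simp flip: ennreal_1)
  also have "\<dots> \<le> ennreal M" by (rule exp_moment)
  finally show ?thesis by simp
qed

lemma integral_exp_le: "(\<integral>g. exp (a * \<bar>\<sigma> g x\<bar>) \<partial>\<mu>) \<le> M"
  using exp_moment[of x] M_ge_1
  by (subst (asm) nn_integral_eq_integral[OF integrable_exp]) auto

lemma integrable_sigma: "integrable \<mu> (\<lambda>g. \<sigma> g x)"
proof (rule Bochner_Integration.integrable_bound[OF integrable_mult_right[OF integrable_exp[of x], of "1 / a"]])
  have "\<bar>s\<bar> \<le> exp (a * \<bar>s\<bar>) / a" for s
  proof -
    have "a * \<bar>s\<bar> \<le> exp (a * \<bar>s\<bar>)"
      using exp_ge_add_one_self[of "a * \<bar>s\<bar>"] by linarith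
    then show ?thesis using a_pos by (simp add: field_simps)
  qed
  then show "AE g in \<mu>. norm (\<sigma> g x) \<le> norm (1 / a * exp (a * \<bar>\<sigma> g x\<bar>))"
    using a_pos by simp
qed simp

lemma square_le_exp: "s\<^sup>2 \<le> 2 / a\<^sup>2 * exp (a * \<bar>s\<bar>)"
proof -
  have "(a * \<bar>s\<bar>)\<^sup>2 / 2 \<le> exp (a * \<bar>s\<bar>)"
    using exp_lower_Taylor_quadratic[of "a * \<bar>s\<bar>"] a_pos
      mult_nonneg_nonneg[of a "\<bar>s\<bar>"] by linarith
  then show ?thesis using a_pos by (simp add: field_simps power_mult_distrib)
qed

lemma integrable_sigma_square: "integrable \<mu> (\<lambda>g. (\<sigma> g x)\<^sup>2)"
  by (rule Bochner_Integration.integrable_bound[OF integrable_mult_right[OF integrable_exp[of x], of "2 / a\<^sup>2"]])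
    (use square_le_exp in auto)

lemma integral_sigma_square_le: "(\<integral>g. (\<sigma> g x)\<^sup>2 \<partial>\<mu>) \<le> 2 * M / a\<^sup>2"
proof -
  have "(\<integral>g. (\<sigma> g x)\<^sup>2 \<partial>\<mu>) \<le> (\<integral>g. 2 / a\<^sup>2 * exp (a * \<bar>\<sigma> g x\<bar>) \<partial>\<mu>)"
    by (intro integral_mono integrable_sigma_square integrable_mult_right integrable_exp square_le_exp)
  also have "\<dots> \<le> 2 / a\<^sup>2 * M"
    by (simp only: integral_mult_right_zero) (intro mult_left_mono integral_exp_le, simp)
  finally show ?thesis by simp
qed

lemma second_moment_step:
  "(\<integral>\<^sup>+g. ennreal ((s + \<sigma> g x)\<^sup>2) \<partial>\<mu>) \<le> ennreal (s\<^sup>2 + 2 * M / a\<^sup>2)"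
proof -
  have sq: "(s + \<sigma> g x)\<^sup>2 = s\<^sup>2 + 2 * s * \<sigma> g x + (\<sigma> g x)\<^sup>2" for g
    by (simp add: power2_sum)
  have nn: "0 \<le> s\<^sup>2 + 2 * s * \<sigma> g x + (\<sigma> g x)\<^sup>2" for g
    by (simp flip: sq)
  have "(\<integral>\<^sup>+g. ennreal ((s + \<sigma> g x)\<^sup>2) \<partial>\<mu>) = ennreal (\<integral>g. s\<^sup>2 + 2 * s * \<sigma> g x + (\<sigma> g x)\<^sup>2 \<partial>\<mu>)"
    unfolding sq
    using integrable_sigma[of x] integrable_sigma_square[of x]
    by (intro nn_integral_eq_integral AE_I2 nn) simp
  also have "(\<integral>g. s\<^sup>2 + 2 * s * \<sigma> g x + (\<sigma> g x)\<^sup>2 \<partial>\<mu>) = s\<^sup>2 + (\<integral>g. (\<sigma> g x)\<^sup>2 \<partial>\<mu>)"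
    using integrable_sigma[of x] integrable_sigma_square[of x]
    by (simp add: centered)
  also have "ennreal \<dots> \<le> ennreal (s\<^sup>2 + 2 * M / a\<^sup>2)"
    by (intro ennreal_leI add_left_mono integral_sigma_square_le)
  finally show ?thesis .
qed

text \<open>Centering makes the increments orthogonal, so the second moment grows linearly. It
  controls the random height at which the walk is restarted.\<close>

lemma second_moment: "(\<integral>\<^sup>+\<omega>. ennreal ((walk x \<omega> n)\<^sup>2) \<partial>\<Omega>) \<le> ennreal (2 * M / a\<^sup>2 * n)"
proof (induction n)
  case (Suc n)
  have "(\<integral>\<^sup>+\<omega>. ennreal ((walk x \<omega> (Suc n))\<^sup>2) \<partial>\<Omega>)
      = (\<integral>\<^sup>+\<omega>. \<integral>\<^sup>+\<omega>'. ennreal ((walk x (comb_seq n \<omega> \<omega>') (n + 1))\<^sup>2) \<partial>\<Omega> \<partial>\<Omega>)"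
    by (subst nn_integral_comb_seq[of _ n]) (auto simp del: walk.simps)
  also have "\<dots> \<le> (\<integral>\<^sup>+\<omega>. ennreal ((walk x \<omega> n)\<^sup>2) + ennreal (2 * M / a\<^sup>2) \<partial>\<Omega>)"
  proof (intro nn_integral_mono)
    fix \<omega>
    have "(\<integral>\<^sup>+\<omega>'. ennreal ((walk x (comb_seq n \<omega> \<omega>') (n + 1))\<^sup>2) \<partial>\<Omega>)
        = (\<integral>\<^sup>+g. ennreal ((walk x \<omega> n + \<sigma> g (pos x \<omega> n))\<^sup>2) \<partial>\<mu>)"
      unfolding walk_comb_add by (subst nn_integral_first[symmetric]) (auto)
    also have "\<dots> \<le> ennreal ((walk x \<omega> n)\<^sup>2 + 2 * M / a\<^sup>2)" by (rule second_moment_step)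
    finally show "(\<integral>\<^sup>+\<omega>'. ennreal ((walk x (comb_seq n \<omega> \<omega>') (n + 1))\<^sup>2) \<partial>\<Omega>)
      \<le> ennreal ((walk x \<omega> n)\<^sup>2) + ennreal (2 * M / a\<^sup>2)"
      using M_ge_1 by (simp add: ennreal_plus[symmetric] del: ennreal_plus)
  qed
  also have "\<dots> = (\<integral>\<^sup>+\<omega>. ennreal ((walk x \<omega> n)\<^sup>2) \<partial>\<Omega>) + ennreal (2 * M / a\<^sup>2)"
    by (subst nn_integral_add) auto
  also have "\<dots> \<le> ennreal (2 * M / a\<^sup>2 * n) + ennreal (2 * M / a\<^sup>2)"
    by (intro add_right_mono Suc)
  also have "\<dots> = ennreal (2 * M / a\<^sup>2 * Suc n)"
    using M_ge_1 by (subst ennreal_plus[symmetric]) (auto simp: algebra_simps add_divide_distrib)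
  finally show ?case .
qed simp

text \<open>Where \<open>z + \<sigma> g x < 0\<close>, the overshoot is at most \<open>H\<close> unless the increment itself exceeds \<open>H\<close>.\<close>
lemma overshoot_step:
  assumes z: "0 \<le> z" and H: "0 \<le> H"
  shows "(\<integral>\<^sup>+g. ennreal (z + \<sigma> g x) \<partial>\<mu>)
    \<le> ennreal z + ennreal H * emeasure \<mu> {g. z + \<sigma> g x < 0} + ennreal (2 / a * M * exp (- (a * H / 2)))"
proof -
  let ?A = "{g. z + \<sigma> g x < 0}"
  let ?T = "\<lambda>s. 2 / a * exp (- (a * H / 2)) * exp (a * \<bar>s\<bar>)"
  have A[measurable]: "?A \<in> sets \<mu>"
  proof -
    have "{g \<in> space \<mu>. z + \<sigma> g x < 0} \<in> sets \<mu>" by measurable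
    then show ?thesis by simp
  qed
  \<comment> \<open>Half of the exponent dominates the linear factor; the other half yields
    \<open>exp (- (a * H / 2))\<close> because \<open>H < \<bar>s\<bar>\<close>.\<close>
  have tail: "\<bar>s\<bar> \<le> ?T s" if "H < \<bar>s\<bar>" for s
  proof -
    have "\<bar>s\<bar> \<le> 2 / a * exp (a * \<bar>s\<bar> / 2)"
      using exp_ge_add_one_self[of "a * \<bar>s\<bar> / 2"] a_pos by (simp add: field_simps)
    also have "\<dots> \<le> 2 / a * exp (- (a * H / 2) + a * \<bar>s\<bar>)"
      using that a_pos by (intro mult_left_mono) (auto simp: field_simps)
    also have "\<dots> = ?T s" by (subst exp_add) (simp add: mult.assoc)
    finally show ?thesis .
  qed
  have T0: "?T s \<ge> 0" for s using a_pos by simp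
  \<comment> \<open>The positive part exceeds \<open>z + \<sigma> g x\<close> by the overshoot, and
    \<open>0 \<le> z\<close> bounds the overshoot by the size of the increment. The linear term then
    integrates to z by centering.\<close>
  have pw: "max 0 (z + \<sigma> g x) \<le> z + \<sigma> g x + H * indicator ?A g + ?T (\<sigma> g x)" for g
    using tail[of "\<sigma> g x"] T0[of "\<sigma> g x"] H z
    by (cases "H < \<bar>\<sigma> g x\<bar>"; cases "z + \<sigma> g x < 0"; simp; linarith)
  note int = integrable_sigma[of x] integrable_exp[of x]
  have intA: "integrable \<mu> (\<lambda>g. indicator ?A g :: real)"
    using A by (intro integrable_real_indicator) (auto simp: less_top[symmetric])
  have "(\<integral>\<^sup>+g. ennreal (z + \<sigma> g x) \<partial>\<mu>) \<le> (\<integral>\<^sup>+g. ennreal (z + \<sigma> g x + H * indicator ?A g + ?T (\<sigma> g x)) \<partial>\<mu>)"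
    by (intro nn_integral_mono ennreal_leI order_trans[OF _ pw]) auto
  also have "\<dots> = ennreal (\<integral>g. z + \<sigma> g x + H * indicator ?A g + ?T (\<sigma> g x) \<partial>\<mu>)"
    using int intA order_trans[OF _ pw] by (intro nn_integral_eq_integral) auto
  also have "(\<integral>g. z + \<sigma> g x + H * indicator ?A g + ?T (\<sigma> g x) \<partial>\<mu>)
      = z + H * measure \<mu> ?A + 2 / a * exp (- (a * H / 2)) * (\<integral>g. exp (a * \<bar>\<sigma> g x\<bar>) \<partial>\<mu>)"
    using int intA A by (simp add: centered)
  also have "ennreal \<dots> \<le> ennreal (z + H * measure \<mu> ?A + 2 / a * exp (- (a * H / 2)) * M)"
    using a_pos by (intro ennreal_leI add_left_mono mult_left_mono integral_exp_le) auto
  also have "\<dots> = ennreal z + ennreal H * emeasure \<mu> ?A + ennreal (2 / a * M * exp (- (a * H / 2)))"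
    using z H a_pos M_ge_1 by (simp add: emeasure_mu ennreal_mult ac_simps)
  finally show ?thesis .
qed

end

section \<open>Survival above a logarithmic barrier\<close>

locale log_boundary = centered_walk \<mu> act \<sigma> a M \<delta> N0
  for \<mu> :: "'g::{second_countable_topology,t2_space} measure"
    and act :: "'g \<Rightarrow> 'x::{second_countable_topology,t2_space} \<Rightarrow> 'x" and \<sigma> a M \<delta> N0 +
  fixes A :: real
  assumes A_ge: "4 / a \<le> A"
begin

definition h :: "nat \<Rightarrow> real" where "h k = A * ln (1 + real k)"

text \<open>Time 0 carries no condition, in agreement with \<open>tau\<close>. Nonnegative height at
  time 0 therefore has to come from \<open>0 \<le> t\<close>, as in
  \<open>surv_height\<close>.\<close>

definition surv :: "'x \<Rightarrow> real \<Rightarrow> nat \<Rightarrow> (nat \<Rightarrow> 'g) \<Rightarrow> bool" where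
  "surv x t n \<omega> \<longleftrightarrow> (\<forall>k\<in>{1..n}. 0 \<le> t + walk x \<omega> k + h k)"

definition u :: "'x \<Rightarrow> real \<Rightarrow> nat \<Rightarrow> real" where
  "u x t n = measure \<Omega> {\<omega>. surv x t n \<omega>}"

text \<open>A bound for the mean height of the surviving walk. The factor 2 counts the lowering of
  the barrier once directly and once through the summed overshoots; the final 1 ensures
  \<open>1 \<le> R x t n\<close>, as \<open>block_recursion\<close> demands.\<close>

definition R :: "'x \<Rightarrow> real \<Rightarrow> nat \<Rightarrow> real" where
  "R x t n = t + 2 * (\<Sum>k<n. (h (Suc k) - h k) * u x t k) + (2 / a * M + 1)"

lemma A_pos: "0 < A"
  using A_ge a_pos by (meson divide_pos_pos less_le_trans zero_less_numeral)

lemma h_0[simp]: "h 0 = 0" by (simp add: h_def)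

lemma h_mono: "j \<le> k \<Longrightarrow> h j \<le> h k"
  using A_pos by (simp add: h_def)

lemma h_nonneg: "0 \<le> h k"
  using h_mono[of 0 k] by simp

text \<open>Subadditivity allows the barrier to be restarted at time 0 after j steps, at the price
  of the additional height \<open>h j\<close>.\<close>

lemma h_add_le: "h (j + k) \<le> h j + h k"
proof -
  have "1 + real (j + k) \<le> (1 + real j) * (1 + real k)" by (simp add: algebra_simps)
  then have "ln (1 + real (j + k)) \<le> ln ((1 + real j) * (1 + real k))" by simp
  also have "\<dots> = ln (1 + real j) + ln (1 + real k)" by (simp add: ln_mult)
  finally show ?thesis using A_pos by (simp add: h_def flip: distrib_left)
qed

lemma h_step_le: "h (Suc k) - h k \<le> A / (real k + 1)"
proof -
  have "ln (1 + real (Suc k)) - ln (1 + real k) = ln ((1 + real (Suc k)) / (1 + real k))"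
    by (simp add: ln_div)
  also have "\<dots> \<le> (1 + real (Suc k)) / (1 + real k) - 1"
    by (intro ln_le_minus_one) simp
  also have "\<dots> = 1 / (real k + 1)" by (simp add: field_simps)
  finally have "A * (ln (1 + real (Suc k)) - ln (1 + real k)) \<le> A * (1 / (real k + 1))"
    using A_pos by (intro mult_left_mono) auto
  then show ?thesis by (simp add: h_def algebra_simps)
qed

lemma measurable_surv[measurable (raw)]:
  assumes [measurable]: "f \<in> N \<rightarrow>\<^sub>M borel" "g \<in> N \<rightarrow>\<^sub>M \<Omega>"
  shows "Measurable.pred N (\<lambda>z. surv (f z) t n (g z))"
  unfolding surv_def by measurable

lemma sets_surv[measurable]: "{\<omega>. surv x t n \<omega>} \<in> sets \<Omega>"
proof -
  have "{\<omega> \<in> space \<Omega>. surv x t n \<omega>} \<in> sets \<Omega>" by measurable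
  then show ?thesis by simp
qed

lemma surv_comb: "n \<le> k \<Longrightarrow> surv x t n (comb_seq k \<omega> \<omega>') = surv x t n \<omega>"
  by (simp add: surv_def walk_comb_less)

lemma surv_mono: "surv x t n \<omega> \<Longrightarrow> t \<le> t' \<Longrightarrow> n' \<le> n \<Longrightarrow> surv x t' n' \<omega>"
  unfolding surv_def by (meson add_right_mono atLeastAtMost_iff order_trans)

lemma surv_height: "surv x t n \<omega> \<Longrightarrow> 0 \<le> t \<Longrightarrow> 0 \<le> t + walk x \<omega> n + h n"
  by (cases "n = 0") (auto simp: surv_def)

lemma u_nonneg: "0 \<le> u x t n" and u_le_1: "u x t n \<le> 1"
  by (simp_all add: u_def)

lemma u_antimono: "antimono (u x t)"
  unfolding u_def by (intro antimonoI P.finite_measure_mono) (auto intro: surv_mono)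

lemma nn_integral_surv: "(\<integral>\<^sup>+\<omega>. indicator {\<omega>. surv x t n \<omega>} \<omega> \<partial>\<Omega>) = ennreal (u x t n)"
  by (simp add: u_def emeasure_Omega)

lemma R_mono: "mono (R x t)"
  unfolding R_def
  by (intro monoI add_mono mult_left_mono sum_mono2 order_refl) (auto simp: h_mono u_nonneg)

lemma R_ge: "0 \<le> t \<Longrightarrow> 1 \<le> R x t n"
  unfolding R_def using a_pos M_ge_1
  by (auto intro!: add_nonneg_nonneg sum_nonneg mult_nonneg_nonneg simp: h_mono u_nonneg)

lemma adapted_surv: "adapted n (\<lambda>\<omega>. indicator {\<omega>. surv x t n \<omega>} \<omega> :: 'b::zero_neq_one)"
  by (simp add: adapted_def indicator_def surv_comb)

text \<open>Conditionally on n steps this is \<open>overshoot_step\<close> with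
  \<open>H = h (Suc n)\<close>. The three added terms are the lowering of the barrier, the allowed
  overshoot on the event of being killed at time \<open>n + 1\<close>, and the rare large
  increments.\<close>

lemma energy_step:
  assumes t: "0 \<le> t"
  shows "(\<integral>\<^sup>+\<omega>. indicator {\<omega>. surv x t (Suc n) \<omega>} \<omega> * ennreal (t + walk x \<omega> (Suc n) + h (Suc n)) \<partial>\<Omega>)
    \<le> (\<integral>\<^sup>+\<omega>. indicator {\<omega>. surv x t n \<omega>} \<omega> * ennreal (t + walk x \<omega> n + h n) \<partial>\<Omega>)
      + ennreal ((h (Suc n) - h n) * u x t n + h (Suc n) * (u x t n - u x t (Suc n))
          + 2 / a * M * exp (- (a * h (Suc n) / 2)))"
proof -
  let ?I = "\<lambda>\<omega>. indicator {\<omega>. surv x t n \<omega>} \<omega> :: ennreal"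
  let ?z = "\<lambda>\<omega>. t + walk x \<omega> n + h (Suc n)"
  let ?e = "2 / a * M * exp (- (a * h (Suc n) / 2))"
  let ?neg = "\<lambda>\<omega>. indicator {\<omega>. t + walk x \<omega> (Suc n) + h (Suc n) < 0} \<omega> :: ennreal"
  have e0: "0 \<le> ?e" using a_pos M_ge_1 by simp
  have [measurable]: "{\<omega>. t + walk x \<omega> (Suc n) + h (Suc n) < 0} \<in> sets \<Omega>"
  proof -
    have "{\<omega> \<in> space \<Omega>. t + walk x \<omega> (Suc n) + h (Suc n) < 0} \<in> sets \<Omega>" by measurable
    then show ?thesis by simp
  qed
  have z_comb: "t + walk x (comb_seq n \<omega> \<omega>') (Suc n) + h (Suc n) = ?z \<omega> + \<sigma> (\<omega>' 0) (pos x \<omega> n)" for \<omega> \<omega>'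
    unfolding walk_comb_Suc by simp
  have z0: "0 \<le> ?z \<omega>" if "surv x t n \<omega>" for \<omega>
    using surv_height[OF that t] h_mono[of n "Suc n"] by simp
  \<comment> \<open>The conditional probability of crossing the barrier at time
    \<open>n + 1\<close>. The integral form shows measurability; the fact \<open>N\<close> gives the
    form that occurs in \<open>overshoot_step\<close>.\<close>
  define N where "N \<omega> = (\<integral>\<^sup>+\<omega>'. ?neg (comb_seq n \<omega> \<omega>') \<partial>\<Omega>)" for \<omega>
  have [measurable]: "N \<in> borel_measurable \<Omega>" unfolding N_def by measurable
  have N: "N \<omega> = emeasure \<mu> {g. ?z \<omega> + \<sigma> g (pos x \<omega> n) < 0}" for \<omega>
  proof -
    have "N \<omega> = (\<integral>\<^sup>+\<omega>'. indicator {g. ?z \<omega> + \<sigma> g (pos x \<omega> n) < 0} (\<omega>' 0) \<partial>\<Omega>)"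
      unfolding N_def indicator_def mem_Collect_eq z_comb ..
    also have "\<dots> = (\<integral>\<^sup>+g. indicator {g. ?z \<omega> + \<sigma> g (pos x \<omega> n) < 0} g \<partial>\<mu>)"
      by (rule nn_integral_first) measurable
    also have "\<dots> = emeasure \<mu> {g. ?z \<omega> + \<sigma> g (pos x \<omega> n) < 0}"
    proof (rule nn_integral_indicator)
      have "{g \<in> space \<mu>. ?z \<omega> + \<sigma> g (pos x \<omega> n) < 0} \<in> sets \<mu>" by measurable
      then show "{g. ?z \<omega> + \<sigma> g (pos x \<omega> n) < 0} \<in> sets \<mu>" by simp
    qed
    finally show ?thesis .
  qed
  have measurable_lemmas:
    "(\<lambda>\<omega>. ?I \<omega> * ennreal (?z \<omega>)) \<in> borel_measurable \<Omega>" "?I \<in> borel_measurable \<Omega>"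
    "(\<lambda>\<omega>. ?I \<omega> * N \<omega>) \<in> borel_measurable \<Omega>"
    "(\<lambda>\<omega>. ennreal (h (Suc n)) * (?I \<omega> * N \<omega>)) \<in> borel_measurable \<Omega>"
    "(\<lambda>\<omega>. ?I \<omega> * ennreal (?z \<omega>) + ennreal (h (Suc n)) * (?I \<omega> * N \<omega>)) \<in> borel_measurable \<Omega>"
    "(\<lambda>\<omega>. ?I \<omega> * ennreal (t + walk x \<omega> n + h n)) \<in> borel_measurable \<Omega>"
    "(\<lambda>\<omega>. c * ?I \<omega>) \<in> borel_measurable \<Omega>" for c
    by measurable
  have "(\<integral>\<^sup>+\<omega>. indicator {\<omega>. surv x t (Suc n) \<omega>} \<omega> * ennreal (t + walk x \<omega> (Suc n) + h (Suc n)) \<partial>\<Omega>)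
     \<le> (\<integral>\<^sup>+\<omega>. ?I \<omega> * ennreal (t + walk x \<omega> (Suc n) + h (Suc n)) \<partial>\<Omega>)"
    by (intro nn_integral_mono mult_right_mono) (auto simp: indicator_def intro: surv_mono)
  also have "\<dots> \<le> (\<integral>\<^sup>+\<omega>. ?I \<omega> * (ennreal (?z \<omega>) + ennreal (h (Suc n)) * N \<omega> + ennreal ?e) \<partial>\<Omega>)"
  proof (rule nn_integral_markov_le[OF _ adapted_surv])
    fix \<omega> assume "?I \<omega> \<noteq> 0"
    then have sv: "surv x t n \<omega>" by (simp add: indicator_def split: if_splits)
    have "(\<integral>\<^sup>+\<omega>'. ennreal (t + walk x (comb_seq n \<omega> \<omega>') (Suc n) + h (Suc n)) \<partial>\<Omega>)
      = (\<integral>\<^sup>+g. ennreal (?z \<omega> + \<sigma> g (pos x \<omega> n)) \<partial>\<mu>)"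
      unfolding z_comb by (rule nn_integral_first) measurable
    also have "\<dots> \<le> ennreal (?z \<omega>) + ennreal (h (Suc n)) * N \<omega> + ennreal ?e"
      unfolding N by (rule overshoot_step[OF z0[OF sv] h_nonneg])
    finally show "(\<integral>\<^sup>+\<omega>'. ennreal (t + walk x (comb_seq n \<omega> \<omega>') (Suc n) + h (Suc n)) \<partial>\<Omega>)
      \<le> ennreal (?z \<omega>) + ennreal (h (Suc n)) * N \<omega> + ennreal ?e" .
  qed measurable
  also have "\<dots> = (\<integral>\<^sup>+\<omega>. ?I \<omega> * ennreal (?z \<omega>) + ennreal (h (Suc n)) * (?I \<omega> * N \<omega>) + ennreal ?e * ?I \<omega> \<partial>\<Omega>)"
    by (intro nn_integral_cong) (simp only: distrib_left mult_ac)
  also have "\<dots> = (\<integral>\<^sup>+\<omega>. ?I \<omega> * ennreal (?z \<omega>) \<partial>\<Omega>)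
      + ennreal (h (Suc n)) * (\<integral>\<^sup>+\<omega>. ?I \<omega> * N \<omega> \<partial>\<Omega>)
      + ennreal ?e * (\<integral>\<^sup>+\<omega>. ?I \<omega> \<partial>\<Omega>)"
    by (simp only: nn_integral_add nn_integral_cmult measurable_lemmas)
  \<comment> \<open>Reading the Markov property backwards turns the conditional crossing probability
    into the loss of survival probability in this step.\<close>
  also have "(\<integral>\<^sup>+\<omega>. ?I \<omega> * N \<omega> \<partial>\<Omega>) = (\<integral>\<^sup>+\<omega>. ?I \<omega> * ?neg \<omega> \<partial>\<Omega>)"
    unfolding N_def by (rule nn_integral_markov[OF _ adapted_surv, symmetric]) measurable
  also have "\<dots> = (\<integral>\<^sup>+\<omega>. indicator ({\<omega>. surv x t n \<omega>} - {\<omega>. surv x t (Suc n) \<omega>}) \<omega> \<partial>\<Omega>)"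
    by (intro nn_integral_cong)
      (auto simp: indicator_def surv_def atLeastAtMostSuc_conv not_le simp del: walk.simps)
  also have "\<dots> = emeasure \<Omega> ({\<omega>. surv x t n \<omega>} - {\<omega>. surv x t (Suc n) \<omega>})"
    by (rule nn_integral_indicator) measurable
  also have "\<dots> = ennreal (u x t n - u x t (Suc n))"
    unfolding u_def emeasure_Omega
    by (subst P.finite_measure_Diff) (auto intro: surv_mono)
  also have "(\<integral>\<^sup>+\<omega>. ?I \<omega> \<partial>\<Omega>) = ennreal (u x t n)"
    by (rule nn_integral_surv)
  also have "(\<integral>\<^sup>+\<omega>. ?I \<omega> * ennreal (?z \<omega>) \<partial>\<Omega>)
      = (\<integral>\<^sup>+\<omega>. ?I \<omega> * ennreal (t + walk x \<omega> n + h n) + ennreal (h (Suc n) - h n) * ?I \<omega> \<partial>\<Omega>)"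
  proof (intro nn_integral_cong)
    fix \<omega>
    show "?I \<omega> * ennreal (?z \<omega>) = ?I \<omega> * ennreal (t + walk x \<omega> n + h n) + ennreal (h (Suc n) - h n) * ?I \<omega>"
    proof (cases "surv x t n \<omega>")
      case True
      from surv_height[OF this t] h_mono[of n "Suc n"] show ?thesis
        using True by (simp flip: ennreal_plus)
    qed simp
  qed
  also have "\<dots> = (\<integral>\<^sup>+\<omega>. ?I \<omega> * ennreal (t + walk x \<omega> n + h n) \<partial>\<Omega>)
      + ennreal (h (Suc n) - h n) * (\<integral>\<^sup>+\<omega>. ?I \<omega> \<partial>\<Omega>)"
    by (simp only: nn_integral_add nn_integral_cmult measurable_lemmas)
  also have "(\<integral>\<^sup>+\<omega>. ?I \<omega> \<partial>\<Omega>) = ennreal (u x t n)"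
    by (rule nn_integral_surv)
  finally have le: "(\<integral>\<^sup>+\<omega>. indicator {\<omega>. surv x t (Suc n) \<omega>} \<omega> * ennreal (t + walk x \<omega> (Suc n) + h (Suc n)) \<partial>\<Omega>)
    \<le> (\<integral>\<^sup>+\<omega>. ?I \<omega> * ennreal (t + walk x \<omega> n + h n) \<partial>\<Omega>)
      + ennreal (h (Suc n) - h n) * ennreal (u x t n)
      + ennreal (h (Suc n)) * ennreal (u x t n - u x t (Suc n)) + ennreal ?e * ennreal (u x t n)" .
  have "ennreal ?e * ennreal (u x t n) \<le> ennreal ?e * 1"
    using u_le_1[of x t n] by (intro mult_left_mono) (auto simp flip: ennreal_1)
  then have "ennreal (h (Suc n) - h n) * ennreal (u x t n)
      + (ennreal (h (Suc n)) * ennreal (u x t n - u x t (Suc n)) + ennreal ?e * ennreal (u x t n))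
    \<le> ennreal (h (Suc n) - h n) * ennreal (u x t n)
      + (ennreal (h (Suc n)) * ennreal (u x t n - u x t (Suc n)) + ennreal ?e)"
    by (intro add_left_mono) simp
  also have "\<dots> = ennreal ((h (Suc n) - h n) * u x t n + h (Suc n) * (u x t n - u x t (Suc n)) + ?e)"
    using h_mono[of n "Suc n"] h_nonneg[of "Suc n"] u_nonneg[of x t n] antimonoD[OF u_antimono, of n "Suc n" x t] e0
    by (simp add: ennreal_mult)
  finally have "ennreal (h (Suc n) - h n) * ennreal (u x t n)
      + (ennreal (h (Suc n)) * ennreal (u x t n - u x t (Suc n)) + ennreal ?e * ennreal (u x t n))
      \<le> ennreal ((h (Suc n) - h n) * u x t n + h (Suc n) * (u x t n - u x t (Suc n)) + ?e)" .
  from order_trans[OF le[unfolded add.assoc] add_left_mono[OF this]] show ?thesis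
    unfolding add.assoc .
qed

text \<open>The bound \<open>4 / a \<le> A\<close> gives the decay \<open>1 / (k + 2)^2\<close>;
  comparison with a telescoping difference keeps the total over all k below 1.\<close>

lemma exp_h_le: "exp (- (a * h (Suc k) / 2)) \<le> 1 / (real k + 1) - 1 / (real (Suc k) + 1)"
proof -
  have "2 * ln (real k + 2) \<le> a * A / 2 * ln (real k + 2)"
    using A_ge a_pos by (intro mult_right_mono) (auto simp: field_simps)
  then have "exp (- (a * h (Suc k) / 2)) \<le> exp (- (2 * ln (real k + 2)))"
    by (simp add: h_def algebra_simps)
  also have "\<dots> = 1 / (real k + 2)\<^sup>2"
    by (simp add: exp_minus exp_double field_simps)
  also have "\<dots> \<le> 1 / ((real k + 1) * (real k + 2))"
    by (intro divide_left_mono) (auto simp: power2_eq_square)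
  also have "\<dots> = 1 / (real k + 1) - 1 / (real (Suc k) + 1)"
    by (simp add: field_simps)
  finally show ?thesis .
qed

lemma energy:
  assumes t: "0 \<le> t"
  shows "(\<integral>\<^sup>+\<omega>. indicator {\<omega>. surv x t n \<omega>} \<omega> * ennreal (t + walk x \<omega> n + h n) \<partial>\<Omega>) \<le> ennreal (R x t n)"
proof -
  let ?c = "2 / a * M"
  let ?d = "\<lambda>k. (h (Suc k) - h k) * u x t k + h (Suc k) * (u x t k - u x t (Suc k))
    + ?c * exp (- (a * h (Suc k) / 2))"
  have c0: "0 \<le> ?c" using a_pos M_ge_1 by simp
  have d0: "0 \<le> ?d k" for k
    using h_mono[of k "Suc k"] h_nonneg[of "Suc k"] u_nonneg[of x t k] a_pos M_ge_1
      antimonoD[OF u_antimono, of k "Suc k" x t]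
    by (intro add_nonneg_nonneg mult_nonneg_nonneg) auto
  have "(\<integral>\<^sup>+\<omega>. indicator {\<omega>. surv x t n \<omega>} \<omega> * ennreal (t + walk x \<omega> n + h n) \<partial>\<Omega>)
    \<le> ennreal (t + (\<Sum>k<n. ?d k))"
  proof (induction n)
    case 0
    then show ?case by (simp add: surv_def)
  next
    case (Suc n)
    have "(\<integral>\<^sup>+\<omega>. indicator {\<omega>. surv x t (Suc n) \<omega>} \<omega> * ennreal (t + walk x \<omega> (Suc n) + h (Suc n)) \<partial>\<Omega>)
      \<le> ennreal (t + (\<Sum>k<n. ?d k)) + ennreal (?d n)"
      by (rule order_trans[OF energy_step[OF t] add_right_mono[OF Suc]])
    also have "\<dots> = ennreal (t + (\<Sum>k<Suc n. ?d k))"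
    proof -
      have "0 \<le> t + (\<Sum>k<n. ?d k)" by (intro add_nonneg_nonneg t sum_nonneg d0)
      then have "ennreal (t + (\<Sum>k<n. ?d k)) + ennreal (?d n) = ennreal (t + (\<Sum>k<n. ?d k) + ?d n)"
        using d0 by (rule ennreal_plus[symmetric])
      then show ?thesis by (simp only: sum.lessThan_Suc add.assoc)
    qed
    finally show ?case .
  qed
  also have "t + (\<Sum>k<n. ?d k) \<le> R x t n"
  proof -
    \<comment> \<open>Summation by parts replaces the growing weights \<open>h (Suc k)\<close> by
      the increments of h. The boundary term has the favourable sign and is dropped.\<close>
    have parts: "(\<Sum>k<n. h (Suc k) * (u x t k - u x t (Suc k)))
        = (\<Sum>k<n. (h (Suc k) - h k) * u x t k) - h n * u x t n"
      by (induction n) (auto simp: algebra_simps)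
    have "(\<Sum>k<n. ?c * exp (- (a * h (Suc k) / 2)))
        \<le> (\<Sum>k<n. ?c * (1 / (real k + 1) - 1 / (real (Suc k) + 1)))"
      by (intro sum_mono mult_left_mono exp_h_le c0)
    also have "\<dots> = ?c * (1 - 1 / (real n + 1))"
      by (subst sum_distrib_left[symmetric], subst sum_lessThan_telescope') simp
    also have "\<dots> \<le> ?c * 1" by (intro mult_left_mono c0) simp
    finally show ?thesis
      using mult_nonneg_nonneg[OF h_nonneg u_nonneg, of n x t n]
      unfolding R_def sum.distrib parts by linarith
  qed
  finally show ?thesis by (simp add: ennreal_leI)
qed

lemma delta_le_1: "\<delta> \<le> 1"
  using upward[OF order_refl, of undefined] P.prob_le_1 order_trans by blast

text \<open>At time n a surviving walk has nonnegative height and the barrier only falls, so a climb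
  of more than \<open>sqrt N\<close> puts it above \<open>sqrt N\<close> at time
  \<open>n + N\<close>. Being that high is limited by \<open>energy\<close> and Markov's inequality;
  failing to climb has conditional probability at most \<open>1 - \<delta>\<close>.\<close>

lemma survival_recursion:
  assumes t: "0 \<le> t" and N: "N0 \<le> N" "1 \<le> N"
  shows "u x t (n + N) \<le> R x t (n + N) / sqrt N + (1 - \<delta>) * u x t n"
proof -
  let ?hi = "{\<omega> \<in> space \<Omega>. surv x t (n + N) \<omega> \<and> sqrt N < t + walk x \<omega> (n + N) + h (n + N)}"
  let ?lo = "{\<omega> \<in> space \<Omega>. walk x \<omega> (n + N) - walk x \<omega> n \<le> sqrt N}"
  have [measurable]: "?hi \<in> sets \<Omega>" "?lo \<in> sets \<Omega>" by measurable
  have R0: "0 \<le> R x t (n + N)" using R_ge[OF t, of x "n + N"] by linarith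
  have up0: "{\<omega>. walk y \<omega> N > sqrt N} \<in> sets \<Omega>" for y
  proof -
    have "{\<omega> \<in> space \<Omega>. walk y \<omega> N > sqrt N} \<in> sets \<Omega>" by measurable
    then show ?thesis by simp
  qed
  have hi: "measure \<Omega> ?hi \<le> R x t (n + N) / sqrt N"
  proof -
    have "ennreal (sqrt N * measure \<Omega> ?hi) = ennreal (sqrt N) * emeasure \<Omega> ?hi"
      by (simp only: emeasure_Omega) (simp add: ennreal_mult)
    also have "\<dots> = (\<integral>\<^sup>+\<omega>. ennreal (sqrt N) * indicator ?hi \<omega> \<partial>\<Omega>)"
      by (rule nn_integral_cmult_indicator[symmetric]) measurable
    also have "\<dots> \<le> (\<integral>\<^sup>+\<omega>. indicator {\<omega>. surv x t (n + N) \<omega>} \<omega> * ennreal (t + walk x \<omega> (n + N) + h (n + N)) \<partial>\<Omega>)"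
      by (intro nn_integral_mono) (auto simp: indicator_def intro!: ennreal_leI)
    also have "\<dots> \<le> ennreal (R x t (n + N))" by (rule energy[OF t])
    finally show ?thesis using R0 N by (simp add: field_simps)
  qed
  have lo: "measure \<Omega> ({\<omega>. surv x t n \<omega>} \<inter> ?lo) \<le> (1 - \<delta>) * u x t n"
  proof -
    have "ennreal (measure \<Omega> ({\<omega>. surv x t n \<omega>} \<inter> ?lo))
        = (\<integral>\<^sup>+\<omega>. indicator {\<omega>. surv x t n \<omega>} \<omega> * indicator ?lo \<omega> \<partial>\<Omega>)"
      by (simp flip: emeasure_Omega indicator_inter_arith)
    also have "\<dots> \<le> (\<integral>\<^sup>+\<omega>. indicator {\<omega>. surv x t n \<omega>} \<omega> * ennreal (1 - \<delta>) \<partial>\<Omega>)"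
    proof (rule nn_integral_markov_le[OF _ adapted_surv])
      fix \<omega>
      let ?y = "pos x \<omega> n"
      have "(\<integral>\<^sup>+\<omega>'. indicator ?lo (comb_seq n \<omega> \<omega>') \<partial>\<Omega>)
          = (\<integral>\<^sup>+\<omega>'. indicator (space \<Omega> - {\<omega>. walk ?y \<omega> N > sqrt N}) \<omega>' \<partial>\<Omega>)"
        by (intro nn_integral_cong)
          (auto simp: indicator_def walk_comb_add walk_comb_less not_less simp del: walk.simps)
      also have "\<dots> = ennreal (1 - measure \<Omega> {\<omega>. walk ?y \<omega> N > sqrt N})"
        using up0[of ?y] by (subst nn_integral_indicator) (auto simp: emeasure_Omega P.prob_compl simp del: space_Omega)
      also have "\<dots> \<le> ennreal (1 - \<delta>)"
        using upward[OF N(1), of ?y] by (intro ennreal_leI) simp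
      finally show "(\<integral>\<^sup>+\<omega>'. indicator ?lo (comb_seq n \<omega> \<omega>') \<partial>\<Omega>) \<le> ennreal (1 - \<delta>)" .
    qed measurable
    also have "\<dots> = ennreal ((1 - \<delta>) * u x t n)"
      using delta_le_1 by (subst nn_integral_multc) (auto simp: u_def emeasure_Omega ennreal_mult mult.commute)
    finally show ?thesis using delta_le_1 u_nonneg by (simp add: ennreal_le_iff)
  qed
  have "u x t (n + N) \<le> measure \<Omega> (?hi \<union> ({\<omega>. surv x t n \<omega>} \<inter> ?lo))"
    unfolding u_def
  proof (intro P.finite_measure_mono subsetI)
    fix \<omega> assume "\<omega> \<in> {\<omega>. surv x t (n + N) \<omega>}"
    then have s: "surv x t (n + N) \<omega>" and sn: "surv x t n \<omega>" by (auto intro: surv_mono)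
    show "\<omega> \<in> ?hi \<union> ({\<omega>. surv x t n \<omega>} \<inter> ?lo)"
      using s sn surv_height[OF sn t] h_mono[of n "n + N"] by auto
  qed measurable
  also have "\<dots> \<le> measure \<Omega> ?hi + measure \<Omega> ({\<omega>. surv x t n \<omega>} \<inter> ?lo)"
    by (intro measure_Un_le) measurable
  finally show ?thesis using hi lo by linarith
qed

text \<open>Any exponent below 1/2 would serve: it has to leave some polynomial decay after division
  by \<open>sqrt n\<close> in the first pass.\<close>

lemma ln_le_quarter_powr: "ln (1 + real n) \<le> 4 * (1 + real n) powr (1 / 4)"
  using ln_powr_bound[of "1 + real n" "1 / 4"] by simp

text \<open>Uniformity in x and linearity in \<open>1 + t\<close> are both essential, since the
  bound is later applied at a random position and a random height.\<close>

lemma survival_bound: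
  obtains C where "C \<ge> 1" "\<And>x t n. 0 \<le> t \<Longrightarrow> 1 \<le> n \<Longrightarrow> u x t n \<le> C * (1 + t) / sqrt n"
proof -
  let ?D = "2 / a * M + 1"
  have D: "1 \<le> ?D" using a_pos M_ge_1 by simp
  \<comment> \<open>The constant is fixed before x, t and n, because \<open>block_recursion\<close>
    makes it independent of the sequences.\<close>
  obtain C where C1: "C \<ge> 1"
    and C: "\<And>x t n. 0 \<le> t \<Longrightarrow> 1 \<le> n \<Longrightarrow> u x t n \<le> C * R x t n / sqrt n"
  proof -
    obtain C where C: "C \<ge> 1"
      "\<And>(v :: nat \<Rightarrow> real) R n. \<lbrakk>antimono v; \<And>k. v k \<le> 1; mono R; \<And>k. R k \<ge> 1;
         \<And>k N. N0 \<le> N \<Longrightarrow> 1 \<le> N \<Longrightarrow> v (k + N) \<le> R (k + N) / sqrt N + (1 - \<delta>) * v k; 1 \<le> n\<rbrakk>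
       \<Longrightarrow> v n \<le> C * R n / sqrt n"
      by (rule block_recursion[OF \<delta>_pos delta_le_1, of N0]) blast
    show thesis
      by (rule that[OF C(1)], rule C(2))
        (use u_antimono u_le_1 R_mono R_ge survival_recursion in auto)
  qed
  define C2 where "C2 = 2 * C * (?D + 8 * A)"
  have C2: "1 \<le> C2"
  proof -
    have "1 * 1 \<le> (2 * C) * (?D + 8 * A)"
      using C1 D A_pos by (intro mult_mono) auto
    then show ?thesis by (simp add: C2_def)
  qed
  \<comment> \<open>Inserting only \<open>u x t k \<le> 1\<close> makes R of order
    \<open>h n\<close>, hence at most of order \<open>n powr (1 / 4)\<close>.\<close>
  have first: "u x t n \<le> C2 * (1 + t) * (1 + real n) powr (- 1 / 4)" if t: "0 \<le> t" for x t n
  proof (cases "n = 0")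
    case True
    have "1 * 1 \<le> C2 * (1 + t)" using C2 t by (intro mult_mono) auto
    then show ?thesis using u_le_1[of x t n] True by simp
  next
    case False
    let ?q = "(1 + real n) powr (1 / 4)"
    have q1: "1 \<le> ?q" by (simp add: ge_one_powr_ge_zero)
    have "(\<Sum>k<n. (h (Suc k) - h k) * u x t k) \<le> (\<Sum>k<n. (h (Suc k) - h k) * 1)"
      using u_le_1 h_mono by (intro sum_mono mult_left_mono) auto
    also have "\<dots> = h n" using sum_lessThan_telescope[of h n] by simp
    also have "\<dots> \<le> 4 * A * ?q"
      using mult_left_mono[OF ln_le_quarter_powr[of n], of A] A_pos by (simp add: h_def)
    finally have "R x t n \<le> t + 8 * A * ?q + ?D" by (simp add: R_def)
    also have "\<dots> \<le> t * ((?D + 8 * A) * ?q) + 8 * A * ?q + ?D * ?q"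
    proof (intro add_mono order_refl)
      have "1 * 1 \<le> (?D + 8 * A) * ?q" using q1 D A_pos by (intro mult_mono) auto
      then have "t * 1 \<le> t * ((?D + 8 * A) * ?q)" using t by (intro mult_left_mono) auto
      then show "t \<le> t * ((?D + 8 * A) * ?q)" by simp
      have "?D * 1 \<le> ?D * ?q" using q1 D by (intro mult_left_mono) auto
      then show "?D \<le> ?D * ?q" by simp
    qed
    also have "\<dots> = (1 + t) * (?D + 8 * A) * ?q"
    proof -
      have "t * ((d + 8 * A) * q) + 8 * A * q + d * q = (1 + t) * (d + 8 * A) * q" for d q
        by (simp add: algebra_simps)
      then show ?thesis .
    qed
    finally have Rle: "R x t n \<le> (1 + t) * (?D + 8 * A) * ?q" .
    have sq: "1 / sqrt n \<le> 2 / sqrt (1 + real n)"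
    proof -
      have "sqrt (1 + real n) \<le> sqrt (4 * real n)" using False by (intro real_sqrt_le_mono) auto
      then show ?thesis using False by (simp add: real_sqrt_mult field_simps)
    qed
    have "u x t n \<le> C * R x t n * (1 / sqrt n)" using C[OF t, of n x] False by simp
    also have "\<dots> \<le> C * ((1 + t) * (?D + 8 * A) * ?q) * (2 / sqrt (1 + real n))"
      using Rle sq C1 R_ge[OF t, of x n] t a_pos M_ge_1 A_pos by (intro mult_mono mult_nonneg_nonneg) auto
    also have "\<dots> = C2 * (1 + t) * (?q / sqrt (1 + real n))"
      by (simp add: C2_def)
    also have "?q / sqrt (1 + real n) = (1 + real n) powr (- 1 / 4)"
      by (simp add: powr_half_sqrt[symmetric] powr_diff[symmetric])
    finally show ?thesis .
  qed
  \<comment> \<open>The exponent is -1 from the increments of h plus -1/4 from the first pass;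
    convergence makes R bounded in n.\<close>
  have summ: "summable (\<lambda>k. (1 + real k) powr (- 5 / 4))"
    using summable_real_powr_iff[of "- 5 / 4"] summable_Suc_iff[of "\<lambda>k. real k powr (- 5 / 4)"]
    by (simp add: add.commute)
  define Z where "Z = (\<Sum>k. (1 + real k) powr (- 5 / 4))"
  have Z0: "0 \<le> Z" unfolding Z_def by (intro suminf_nonneg summ) auto
  define C3 where "C3 = C * (?D + 2 * A * C2 * Z)"
  have "u x t n \<le> C3 * (1 + t) / sqrt n" if t: "0 \<le> t" and n: "1 \<le> n" for x t n
  proof -
    have "(\<Sum>k<n. (h (Suc k) - h k) * u x t k)
        \<le> (\<Sum>k<n. A / (real k + 1) * (C2 * (1 + t) * (1 + real k) powr (- 1 / 4)))"
      using h_step_le first[OF t] A_pos u_nonneg by (intro sum_mono mult_mono) auto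
    also have "\<dots> = A * C2 * (1 + t) * (\<Sum>k<n. (1 + real k) powr (- 5 / 4))"
      unfolding sum_distrib_left
    proof (intro sum.cong refl)
      fix k
      have "(1 + real k) powr (- 5 / 4) = (1 + real k) powr (- 1 + - 1 / 4)" by simp
      also have "\<dots> = 1 / (1 + real k) * (1 + real k) powr (- 1 / 4)"
        by (subst powr_add) (simp add: powr_minus_divide)
      finally show "A / (real k + 1) * (C2 * (1 + t) * (1 + real k) powr (- 1 / 4))
          = A * C2 * (1 + t) * (1 + real k) powr (- 5 / 4)"
        by (simp add: add.commute)
    qed
    also have "\<dots> \<le> A * C2 * (1 + t) * Z"
      unfolding Z_def using A_pos C2 t
      by (intro mult_left_mono sum_le_suminf summ) auto
    finally have "R x t n \<le> t + 2 * (A * C2 * (1 + t) * Z) + ?D" by (simp add: R_def)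
    also have "\<dots> \<le> t * ?D + 2 * (A * C2 * (1 + t) * Z) + ?D"
      using mult_left_mono[OF D t] by simp
    also have "\<dots> = (1 + t) * (?D + 2 * A * C2 * Z)"
    proof -
      have "t * d + 2 * (A * C2 * (1 + t) * Z) + d = (1 + t) * (d + 2 * A * C2 * Z)" for d
        by (simp add: algebra_simps)
      then show ?thesis .
    qed
    finally have "C * R x t n \<le> C * ((1 + t) * (?D + 2 * A * C2 * Z))"
      using C1 by (intro mult_left_mono) auto
    then have "C * R x t n / sqrt n \<le> C3 * (1 + t) / sqrt n"
      by (intro divide_right_mono) (auto simp: C3_def mult_ac)
    with C[OF t n, of x] show ?thesis by linarith
  qed
  moreover have "1 \<le> C3"
  proof -
    have "1 * 1 \<le> C * (?D + 2 * A * C2 * Z)"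
      using C1 D A_pos C2 Z0 by (intro mult_mono) (auto intro: add_increasing2)
    then show ?thesis by (simp add: C3_def)
  qed
  ultimately show thesis using that by blast
qed

end

section \<open>Stationary perturbations\<close>

context cocycle_walk
begin

definition shift :: "nat \<Rightarrow> (nat \<Rightarrow> 'g) \<Rightarrow> nat \<Rightarrow> 'g" where
  "shift k \<omega> = (\<lambda>i. \<omega> (k + i))"

lemma measurable_shift[measurable]: "shift k \<in> \<Omega> \<rightarrow>\<^sub>M \<Omega>"
  unfolding shift_def by (intro measurable_PiM_single') (auto simp: PiE_def)

lemma shift_comb: "shift k (comb_seq k \<omega> \<omega>') = \<omega>'"
  by (simp add: shift_def comb_seq_add')

lemma shift_comb_add: "shift k (comb_seq (k + p) \<omega> \<omega>') = comb_seq p (shift k \<omega>) \<omega>'"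
  by (auto simp: shift_def comb_seq_def)

lemma funpow_Tmap: "(Tmap act ^^ k) (\<omega>, x) = (shift k \<omega>, pos x \<omega> k)"
  by (induction k) (auto simp: Tmap_def shift_def)

end

locale stationary_walk = log_boundary \<mu> act \<sigma> a M \<delta> N0 A + nu: prob_space \<nu>
  for \<mu> :: "'g::{second_countable_topology,t2_space} measure"
    and act :: "'g \<Rightarrow> 'x::{second_countable_topology,t2_space} \<Rightarrow> 'x"
    and \<sigma> a M \<delta> N0 A and \<nu> :: "'x measure" +
  assumes sets_nu[measurable_cong]: "sets \<nu> = sets borel"
    and stationary: "\<And>A. A \<in> sets borel \<Longrightarrow> emeasure \<nu> A = (\<integral>\<^sup>+g. emeasure \<nu> (act g -` A) \<partial>\<mu>)"
begin

lemma space_nu[simp]: "space \<nu> = UNIV"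
  using sets_eq_imp_space_eq[OF sets_nu] by simp

text \<open>The action maps the product of \<mu> and \<nu> to \<nu>; this extends stationarity from
  sets to functions.\<close>

lemma nn_integral_stationary:
  assumes [measurable]: "\<Phi> \<in> borel_measurable borel"
  shows "(\<integral>\<^sup>+x. \<integral>\<^sup>+g. \<Phi> (act g x) \<partial>\<mu> \<partial>\<nu>) = (\<integral>\<^sup>+x. \<Phi> x \<partial>\<nu>)"
proof -
  interpret mn: pair_sigma_finite \<mu> \<nu>
    using sigma_finite_mu nu.sigma_finite_measure_axioms by (rule pair_sigma_finite.intro)
  have [measurable]: "(\<lambda>(g, x). act g x) \<in> \<mu> \<Otimes>\<^sub>M \<nu> \<rightarrow>\<^sub>M borel"
    by measurable
  have "distr (\<mu> \<Otimes>\<^sub>M \<nu>) \<nu> (\<lambda>(g, x). act g x) = \<nu>"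
  proof (rule measure_eqI)
    fix A assume "A \<in> sets (distr (\<mu> \<Otimes>\<^sub>M \<nu>) \<nu> (\<lambda>(g, x). act g x))"
    then have [measurable]: "A \<in> sets borel" by (simp add: sets_nu)
    have "emeasure (distr (\<mu> \<Otimes>\<^sub>M \<nu>) \<nu> (\<lambda>(g, x). act g x)) A
        = emeasure (\<mu> \<Otimes>\<^sub>M \<nu>) ((\<lambda>(g, x). act g x) -` A \<inter> space (\<mu> \<Otimes>\<^sub>M \<nu>))"
      by (rule emeasure_distr) measurable
    also have "\<dots> = (\<integral>\<^sup>+g. emeasure \<nu> (Pair g -` ((\<lambda>(g, x). act g x) -` A \<inter> space (\<mu> \<Otimes>\<^sub>M \<nu>))) \<partial>\<mu>)"
      by (rule nu.emeasure_pair_measure_alt) measurable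
    also have "\<dots> = (\<integral>\<^sup>+g. emeasure \<nu> (act g -` A) \<partial>\<mu>)"
      by (intro nn_integral_cong arg_cong[where f = "emeasure \<nu>"]) (auto simp: space_pair_measure)
    also have "\<dots> = emeasure \<nu> A" by (rule stationary[symmetric]) measurable
    finally show "emeasure (distr (\<mu> \<Otimes>\<^sub>M \<nu>) \<nu> (\<lambda>(g, x). act g x)) A = emeasure \<nu> A" .
  qed simp
  then have "(\<integral>\<^sup>+x. \<Phi> x \<partial>\<nu>) = (\<integral>\<^sup>+x. \<Phi> x \<partial>distr (\<mu> \<Otimes>\<^sub>M \<nu>) \<nu> (\<lambda>(g, x). act g x))"
    by simp
  also have "\<dots> = (\<integral>\<^sup>+z. \<Phi> (act (fst z) (snd z)) \<partial>(\<mu> \<Otimes>\<^sub>M \<nu>))"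
    by (subst nn_integral_distr) (auto simp: split_beta')
  also have "\<dots> = (\<integral>\<^sup>+x. \<integral>\<^sup>+g. \<Phi> (act g x) \<partial>\<mu> \<partial>\<nu>)"
    by (subst mn.nn_integral_snd[symmetric]) auto
  finally show ?thesis by simp
qed

lemma nn_integral_pos:
  assumes [measurable]: "\<Phi> \<in> borel_measurable borel"
  shows "(\<integral>\<^sup>+x. \<integral>\<^sup>+\<omega>. \<Phi> (pos x \<omega> k) \<partial>\<Omega> \<partial>\<nu>) = (\<integral>\<^sup>+x. \<Phi> x \<partial>\<nu>)"
  using assms
proof (induction k arbitrary: \<Phi>)
  case 0
  then show ?case by simp
next
  case (Suc k)
  note [measurable] = Suc.prems
  have [measurable]: "(\<lambda>y. \<integral>\<^sup>+g. \<Phi> (act g y) \<partial>\<mu>) \<in> borel_measurable borel"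
    by measurable
  have "(\<integral>\<^sup>+\<omega>. \<Phi> (pos x \<omega> (Suc k)) \<partial>\<Omega>) = (\<integral>\<^sup>+\<omega>. \<integral>\<^sup>+g. \<Phi> (act g (pos x \<omega> k)) \<partial>\<mu> \<partial>\<Omega>)" for x
  proof -
    have "(\<integral>\<^sup>+\<omega>. \<Phi> (pos x \<omega> (Suc k)) \<partial>\<Omega>)
        = (\<integral>\<^sup>+\<omega>. \<integral>\<^sup>+\<omega>'. \<Phi> (act (\<omega>' 0) (pos x \<omega> k)) \<partial>\<Omega> \<partial>\<Omega>)"
      by (subst nn_integral_comb_seq[of _ k], measurable) (simp only: pos_comb_Suc)
    also have "\<dots> = (\<integral>\<^sup>+\<omega>. \<integral>\<^sup>+g. \<Phi> (act g (pos x \<omega> k)) \<partial>\<mu> \<partial>\<Omega>)"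
      by (intro nn_integral_cong nn_integral_first) measurable
    finally show ?thesis .
  qed
  then show ?case
    using Suc.IH[of "\<lambda>y. \<integral>\<^sup>+g. \<Phi> (act g y) \<partial>\<mu>"] nn_integral_stationary[OF Suc.prems] by simp
qed

text \<open>Given k steps, \<open>shift k \<omega>\<close> is a fresh sequence independent of
  \<open>pos x \<omega> k\<close>, whose law is \<nu> again once x is averaged. Thus the hypotheses
  on f, stated without shift, are available along the orbit at every time k.\<close>

lemma nn_integral_invariant:
  assumes [measurable]: "(\<lambda>(\<omega>, x). \<phi> \<omega> x) \<in> borel_measurable (\<Omega> \<Otimes>\<^sub>M \<nu>)"
  shows "(\<integral>\<^sup>+x. \<integral>\<^sup>+\<omega>. \<phi> (shift k \<omega>) (pos x \<omega> k) \<partial>\<Omega> \<partial>\<nu>) = (\<integral>\<^sup>+x. \<integral>\<^sup>+\<omega>. \<phi> \<omega> x \<partial>\<Omega> \<partial>\<nu>)"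
proof -
  have meas[measurable]: "(\<lambda>z. \<phi> (f z) (g z)) \<in> borel_measurable N"
    if [measurable]: "f \<in> N \<rightarrow>\<^sub>M \<Omega>" "g \<in> N \<rightarrow>\<^sub>M borel" for f g N
  proof -
    have "(\<lambda>z. (f z, g z)) \<in> N \<rightarrow>\<^sub>M \<Omega> \<Otimes>\<^sub>M \<nu>" by measurable
    from measurable_compose[OF this assms] show ?thesis by simp
  qed
  have "(\<integral>\<^sup>+\<omega>. \<phi> (shift k \<omega>) (pos x \<omega> k) \<partial>\<Omega>) = (\<integral>\<^sup>+\<omega>. \<integral>\<^sup>+\<omega>'. \<phi> \<omega>' (pos x \<omega> k) \<partial>\<Omega> \<partial>\<Omega>)" for x
    by (subst nn_integral_comb_seq[of _ k], measurable) (simp add: shift_comb pos_comb_less)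
  moreover have "(\<lambda>y. \<integral>\<^sup>+\<omega>'. \<phi> \<omega>' y \<partial>\<Omega>) \<in> borel_measurable borel"
    by (rule P.borel_measurable_nn_integral) measurable
  ultimately show ?thesis using nn_integral_pos[of "\<lambda>y. \<integral>\<^sup>+\<omega>'. \<phi> \<omega>' y \<partial>\<Omega>" k] by simp
qed

section \<open>Survival after a weight determined in the near future\<close>

text \<open>A substitute for the Cauchy-Schwarz inequality: heights up to \<open>1 / \<eta>\<close>
  are bounded by that level, larger ones by \<eta> times their square. If E has mean of order
  \<eta>^2, the contribution of the walk is of order \<eta>, up to the factor q.\<close>

lemma weighted_second_moment:
  assumes [measurable]: "E \<in> borel_measurable \<Omega>" and E: "\<And>\<omega>. 0 \<le> E \<omega>" "\<And>\<omega>. E \<omega> \<le> 1"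
    and w: "0 \<le> w" and \<eta>: "0 < \<eta>"
  shows "(\<integral>\<^sup>+\<omega>. ennreal (E \<omega>) * ennreal (w + \<bar>walk x \<omega> q\<bar>) \<partial>\<Omega>)
    \<le> ennreal (w + 1 / \<eta>) * (\<integral>\<^sup>+\<omega>. ennreal (E \<omega>) \<partial>\<Omega>) + ennreal (\<eta> * (2 * M / a\<^sup>2) * q)"
proof -
  have "(\<integral>\<^sup>+\<omega>. ennreal (E \<omega>) * ennreal (w + \<bar>walk x \<omega> q\<bar>) \<partial>\<Omega>)
    \<le> (\<integral>\<^sup>+\<omega>. ennreal (w + 1 / \<eta>) * ennreal (E \<omega>) + ennreal \<eta> * ennreal ((walk x \<omega> q)\<^sup>2) \<partial>\<Omega>)"
  proof (intro nn_integral_mono)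
    fix \<omega>
    let ?s = "\<bar>walk x \<omega> q\<bar>"
    have "E \<omega> * ?s \<le> E \<omega> / \<eta> + \<eta> * ?s\<^sup>2"
    proof (cases "?s \<le> 1 / \<eta>")
      case True
      then have "E \<omega> * ?s \<le> E \<omega> * (1 / \<eta>)" using E by (intro mult_left_mono) auto
      then show ?thesis using \<eta> by (simp add: add_increasing2)
    next
      case False
      then have "1 \<le> \<eta> * ?s" using \<eta> by (simp add: field_simps)
      then have "1 * ?s \<le> \<eta> * ?s * ?s" by (intro mult_right_mono) auto
      moreover have "E \<omega> * ?s \<le> 1 * ?s" using E by (intro mult_right_mono) auto
      moreover have "0 \<le> E \<omega> / \<eta>" using E \<eta> by simp
      ultimately show ?thesis by (simp add: power2_eq_square mult.assoc)
    qed
    then have "E \<omega> * (w + ?s) \<le> (w + 1 / \<eta>) * E \<omega> + \<eta> * (walk x \<omega> q)\<^sup>2"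
      by (simp add: algebra_simps)
    then have "ennreal (E \<omega> * (w + ?s)) \<le> ennreal ((w + 1 / \<eta>) * E \<omega> + \<eta> * (walk x \<omega> q)\<^sup>2)"
      by (rule ennreal_leI)
    then show "ennreal (E \<omega>) * ennreal (w + ?s)
        \<le> ennreal (w + 1 / \<eta>) * ennreal (E \<omega>) + ennreal \<eta> * ennreal ((walk x \<omega> q)\<^sup>2)"
      using E w \<eta> by (simp add: ennreal_mult[symmetric] ennreal_plus[symmetric] del: ennreal_plus)
  qed
  also have "\<dots> = ennreal (w + 1 / \<eta>) * (\<integral>\<^sup>+\<omega>. ennreal (E \<omega>) \<partial>\<Omega>)
      + ennreal \<eta> * (\<integral>\<^sup>+\<omega>. ennreal ((walk x \<omega> q)\<^sup>2) \<partial>\<Omega>)"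
    by (subst nn_integral_add) (auto simp: nn_integral_cmult)
  also have "\<dots> \<le> ennreal (w + 1 / \<eta>) * (\<integral>\<^sup>+\<omega>. ennreal (E \<omega>) \<partial>\<Omega>)
      + ennreal \<eta> * ennreal (2 * M / a\<^sup>2 * q)"
    by (intro add_left_mono mult_left_mono second_moment) auto
  also have "ennreal \<eta> * ennreal (2 * M / a\<^sup>2 * q) = ennreal (\<eta> * (2 * M / a\<^sup>2) * q)"
    using \<eta> M_ge_1 by (simp add: ennreal_mult[symmetric] mult.assoc)
  finally show ?thesis .
qed

text \<open>After time \<open>q\<close> the walk is independent of a weight \<open>E\<close> that depends on the first \<open>q\<close> steps, so
  the bound on survival restarts from height \<open>t + \<bar>walk x \<omega> q\<bar> + h q\<close>. For \<open>2 q > n\<close> survival is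
  simply dropped, since then \<open>sqrt n\<close> is of order at most \<open>q + 1\<close>.\<close>
lemma survival_after:
  assumes C: "1 \<le> C" "\<And>x t n. 0 \<le> t \<Longrightarrow> 1 \<le> n \<Longrightarrow> u x t n \<le> C * (1 + t) / sqrt n"
    and [measurable]: "E \<in> borel_measurable \<Omega>"
    and adap: "2 * q \<le> n \<Longrightarrow> adapted q E"
    and t: "0 \<le> t" and n: "1 \<le> n"
  shows "(\<integral>\<^sup>+\<omega>. E \<omega> * indicator {\<omega>. surv x t n \<omega>} \<omega> \<partial>\<Omega>)
    \<le> ennreal (2 * C / sqrt n) * (\<integral>\<^sup>+\<omega>. E \<omega> * ennreal ((A + 2) * (1 + t) * (real q + 1) + \<bar>walk x \<omega> q\<bar>) \<partial>\<Omega>)"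
proof -
  \<comment> \<open>W dominates one plus the restart height, since \<open>h q \<le> A * q\<close>.
    It is also at least \<open>2 * (q + 1)\<close>, which makes the claimed bound exceed 1 when
    \<open>2 * q > n\<close>.\<close>
  define W where "W \<omega> = (A + 2) * (1 + t) * (real q + 1) + \<bar>walk x \<omega> q\<bar>" for \<omega>
  have [measurable]: "W \<in> borel_measurable \<Omega>" unfolding W_def by measurable
  have hq: "h q \<le> A * q"
    using ln_add_one_self_le_self[of "real q"] A_pos by (simp add: h_def)
  have W_ge: "1 + t + \<bar>walk x \<omega> q\<bar> + h q \<le> W \<omega>" "2 * (real q + 1) \<le> W \<omega>" "0 \<le> W \<omega>" for \<omega>
  proof -
    have "0 \<le> A * (1 + t) + A * t * q + 1 + t + 2 * q + 2 * t * q" using A_pos t by simp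
    then have "1 + t + A * q \<le> (A + 2) * (1 + t) * (real q + 1)" by (simp add: algebra_simps)
    then show "1 + t + \<bar>walk x \<omega> q\<bar> + h q \<le> W \<omega>" using hq unfolding W_def by linarith
    have "2 * 1 * (real q + 1) \<le> (A + 2) * (1 + t) * (real q + 1)"
      using A_pos t by (intro mult_mono) auto
    then show "2 * (real q + 1) \<le> W \<omega>" unfolding W_def by simp
    then show "0 \<le> W \<omega>" by (rule order_trans[rotated]) simp
  qed
  have "(\<integral>\<^sup>+\<omega>. E \<omega> * indicator {\<omega>. surv x t n \<omega>} \<omega> \<partial>\<Omega>) \<le> (\<integral>\<^sup>+\<omega>. E \<omega> * ennreal (2 * C / sqrt n * W \<omega>) \<partial>\<Omega>)"
  proof (cases "2 * q \<le> n")
    case True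
    show ?thesis
    proof (rule nn_integral_markov_le[OF _ adap[OF True]])
      fix \<omega>
      let ?t = "t + \<bar>walk x \<omega> q\<bar> + h q"
      have nq: "1 \<le> n - q" using True n by auto
      have t0: "0 \<le> ?t" using t h_nonneg[of q] by simp
      have "(\<integral>\<^sup>+\<omega>'. indicator {\<omega>. surv x t n \<omega>} (comb_seq q \<omega> \<omega>') \<partial>\<Omega>)
          \<le> (\<integral>\<^sup>+\<omega>'. indicator {\<zeta>. surv (pos x \<omega> q) ?t (n - q) \<zeta>} \<omega>' \<partial>\<Omega>)"
      proof (intro nn_integral_mono)
        fix \<omega>'
        have "surv (pos x \<omega> q) ?t (n - q) \<omega>'" if s: "surv x t n (comb_seq q \<omega> \<omega>')"
          unfolding surv_def
        proof
          fix i assume i: "i \<in> {1..n - q}"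
          have "0 \<le> t + walk x (comb_seq q \<omega> \<omega>') (q + i) + h (q + i)"
            using s i True unfolding surv_def by auto
          then show "0 \<le> ?t + walk (pos x \<omega> q) \<omega>' i + h i"
            unfolding walk_comb_add using h_add_le[of q i] by linarith
        qed
        then show "indicator {\<omega>. surv x t n \<omega>} (comb_seq q \<omega> \<omega>')
            \<le> (indicator {\<zeta>. surv (pos x \<omega> q) ?t (n - q) \<zeta>} \<omega>' :: ennreal)"
          by (auto simp: indicator_def)
      qed
      also have "\<dots> = ennreal (u (pos x \<omega> q) ?t (n - q))" by (rule nn_integral_surv)
      also have "\<dots> \<le> ennreal (2 * C / sqrt n * W \<omega>)"
      proof (rule ennreal_leI)
        have "sqrt n \<le> sqrt (4 * real (n - q))"
          using True by (intro real_sqrt_le_mono) (simp add: of_nat_diff)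
        also have "\<dots> = 2 * sqrt (n - q)" by (subst real_sqrt_mult) simp
        finally have sqrt_le: "sqrt n \<le> 2 * sqrt (n - q)" .
        have "1 / s \<le> 2 / r" if "r \<le> 2 * s" "0 < r" "0 < s" for r s :: real
          using that by (simp add: field_simps)
        from this[OF sqrt_le] have sq: "1 / sqrt (n - q) \<le> 2 / sqrt n"
          using nq n by simp
        have "u (pos x \<omega> q) ?t (n - q) \<le> C * (1 + ?t) * (1 / sqrt (n - q))"
          using C(2)[OF t0 nq, of "pos x \<omega> q"] by simp
        also have "\<dots> \<le> C * W \<omega> * (2 / sqrt n)"
          using sq W_ge(1)[of \<omega>] W_ge(3)[of \<omega>] t0 C(1) by (intro mult_mono) auto
        finally show "u (pos x \<omega> q) ?t (n - q) \<le> 2 * C / sqrt n * W \<omega>" by (simp add: mult_ac)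
      qed
      finally show "(\<integral>\<^sup>+\<omega>'. indicator {\<omega>. surv x t n \<omega>} (comb_seq q \<omega> \<omega>') \<partial>\<Omega>)
        \<le> ennreal (2 * C / sqrt n * W \<omega>)" .
    qed measurable
  next
    case False
    show ?thesis
    proof (intro nn_integral_mono mult_left_mono)
      fix \<omega>
      have "n \<le> 4 * (q + 1) ^ 2" using False by (simp add: power2_eq_square)
      then have "real n \<le> real (4 * (q + 1) ^ 2)" by (simp only: of_nat_le_iff)
      then have "real n \<le> (2 * (real q + 1))\<^sup>2"
        by (simp add: power2_eq_square algebra_simps)
      then have "sqrt n \<le> 2 * (real q + 1)" by (intro real_le_lsqrt) auto
      also have "\<dots> \<le> W \<omega>" by (rule W_ge)
      also have "\<dots> \<le> 2 * C * W \<omega>"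
        using mult_right_mono[OF _ W_ge(3), of 1 "2 * C" \<omega>] C(1) by simp
      finally have "1 \<le> 2 * C / sqrt n * W \<omega>" using n by (simp add: field_simps)
      then have "1 \<le> ennreal (2 * C / sqrt n * W \<omega>)" by (metis ennreal_1 ennreal_leI)
      moreover have "indicator {\<omega>. surv x t n \<omega>} \<omega> \<le> (1 :: ennreal)" by (simp add: indicator_def)
      ultimately show "indicator {\<omega>. surv x t n \<omega>} \<omega> \<le> ennreal (2 * C / sqrt n * W \<omega>)"
        by (rule order_trans[rotated])
    qed auto
  qed
  also have "\<dots> = (\<integral>\<^sup>+\<omega>. ennreal (2 * C / sqrt n) * (E \<omega> * ennreal (W \<omega>)) \<partial>\<Omega>)"
  proof (intro nn_integral_cong)
    fix \<omega>
    have "ennreal (2 * C / sqrt n * W \<omega>) = ennreal (2 * C / sqrt n) * ennreal (W \<omega>)"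
      using C(1) W_ge(3) by (intro ennreal_mult) auto
    then show "E \<omega> * ennreal (2 * C / sqrt n * W \<omega>) = ennreal (2 * C / sqrt n) * (E \<omega> * ennreal (W \<omega>))"
      by (simp only: mult.left_commute)
  qed
  also have "\<dots> = ennreal (2 * C / sqrt n) * (\<integral>\<^sup>+\<omega>. E \<omega> * ennreal (W \<omega>) \<partial>\<Omega>)"
    by (rule nn_integral_cmult) measurable
  finally show ?thesis unfolding W_def .
qed

text \<open>D is read off after k steps and is settled p steps later, so survival restarts at
  \<open>k + p\<close>. Taking the same \<eta> in the mean of D and in
  \<open>weighted_second_moment\<close> balances the two error terms at order \<eta>.\<close>

lemma weighted_survival:
  assumes C: "1 \<le> C" "\<And>x t n. 0 \<le> t \<Longrightarrow> 1 \<le> n \<Longrightarrow> u x t n \<le> C * (1 + t) / sqrt n"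
    and D_meas: "(\<lambda>(\<omega>, x). D \<omega> x) \<in> borel_measurable (\<Omega> \<Otimes>\<^sub>M \<nu>)"
    and D: "\<And>\<omega> x. 0 \<le> D \<omega> x" "\<And>\<omega> x. D \<omega> x \<le> 1"
    and adap: "\<And>x. 2 * (k + p) \<le> n \<Longrightarrow> adapted p (\<lambda>\<omega>. D \<omega> x)"
    and D_le: "(\<integral>\<^sup>+x. \<integral>\<^sup>+\<omega>. ennreal (D \<omega> x) \<partial>\<Omega> \<partial>\<nu>) \<le> ennreal (c * \<eta>\<^sup>2)"
    and c: "0 \<le> c" and \<eta>: "0 < \<eta>" "\<eta> \<le> 1" and t: "0 \<le> t" and n: "1 \<le> n"
  shows "(\<integral>\<^sup>+x. \<integral>\<^sup>+\<omega>. ennreal (D (shift k \<omega>) (pos x \<omega> k)) * indicator {\<omega>. surv x t n \<omega>} \<omega> \<partial>\<Omega> \<partial>\<nu>)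
    \<le> ennreal (2 * C * ((A + 3) * c + 2 * M / a\<^sup>2) * ((1 + t) * (real (k + p) + 1) * \<eta>) / sqrt n)"
proof -
  let ?q = "k + p"
  define w where "w = (A + 2) * (1 + t) * (real ?q + 1)"
  define E where "E x \<omega> = D (shift k \<omega>) (pos x \<omega> k)" for x \<omega>
  have w0: "0 \<le> w" using A_pos t by (simp add: w_def)
  have M2: "0 \<le> 2 * M / a\<^sup>2" using M_ge_1 by simp
  have meas[measurable]: "(\<lambda>z. D (f z) (g z)) \<in> borel_measurable N"
    if [measurable]: "f \<in> N \<rightarrow>\<^sub>M \<Omega>" "g \<in> N \<rightarrow>\<^sub>M borel" for f g N
  proof -
    have "(\<lambda>z. (f z, g z)) \<in> N \<rightarrow>\<^sub>M \<Omega> \<Otimes>\<^sub>M \<nu>" by measurable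
    from measurable_compose[OF this D_meas] show ?thesis by simp
  qed
  have [measurable]: "E x \<in> borel_measurable \<Omega>" for x unfolding E_def by measurable
  have [measurable]: "(\<lambda>x. \<integral>\<^sup>+\<omega>. ennreal (E x \<omega>) \<partial>\<Omega>) \<in> borel_measurable \<nu>"
    unfolding E_def by (rule P.borel_measurable_nn_integral) measurable
  have affine: "(\<integral>\<^sup>+x. b * (d * J x + e) \<partial>\<nu>) = b * (d * (\<integral>\<^sup>+x. J x \<partial>\<nu>) + e)"
    if "J \<in> borel_measurable \<nu>" for b d e :: ennreal and J
    using that nu.emeasure_space_1 by (simp add: nn_integral_cmult nn_integral_add)
  have E01: "0 \<le> E x \<omega>" "E x \<omega> \<le> 1" for x \<omega> using D by (auto simp: E_def)
  have adapE: "adapted ?q (\<lambda>\<omega>. ennreal (E x \<omega>))" if "2 * ?q \<le> n" for x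
    using adap[OF that] unfolding adapted_def E_def by (simp add: shift_comb_add pos_comb_less)
  have "(\<integral>\<^sup>+x. \<integral>\<^sup>+\<omega>. ennreal (E x \<omega>) * indicator {\<omega>. surv x t n \<omega>} \<omega> \<partial>\<Omega> \<partial>\<nu>)
    \<le> (\<integral>\<^sup>+x. ennreal (2 * C / sqrt n) * (ennreal (w + 1 / \<eta>) * (\<integral>\<^sup>+\<omega>. ennreal (E x \<omega>) \<partial>\<Omega>)
          + ennreal (\<eta> * (2 * M / a\<^sup>2) * ?q)) \<partial>\<nu>)"
  proof (intro nn_integral_mono)
    fix x
    have "(\<integral>\<^sup>+\<omega>. ennreal (E x \<omega>) * indicator {\<omega>. surv x t n \<omega>} \<omega> \<partial>\<Omega>)
      \<le> ennreal (2 * C / sqrt n) * (\<integral>\<^sup>+\<omega>. ennreal (E x \<omega>) * ennreal (w + \<bar>walk x \<omega> ?q\<bar>) \<partial>\<Omega>)"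
      unfolding w_def by (rule survival_after[OF C _ adapE t n]) measurable
    also have "\<dots> \<le> ennreal (2 * C / sqrt n) * (ennreal (w + 1 / \<eta>) * (\<integral>\<^sup>+\<omega>. ennreal (E x \<omega>) \<partial>\<Omega>)
          + ennreal (\<eta> * (2 * M / a\<^sup>2) * ?q))"
      by (intro mult_left_mono weighted_second_moment E01 w0 \<eta>) auto
    finally show "(\<integral>\<^sup>+\<omega>. ennreal (E x \<omega>) * indicator {\<omega>. surv x t n \<omega>} \<omega> \<partial>\<Omega>) \<le> \<dots>" .
  qed
  also have "\<dots> = ennreal (2 * C / sqrt n) * (ennreal (w + 1 / \<eta>) * (\<integral>\<^sup>+x. \<integral>\<^sup>+\<omega>. ennreal (E x \<omega>) \<partial>\<Omega> \<partial>\<nu>)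
          + ennreal (\<eta> * (2 * M / a\<^sup>2) * ?q))"
    by (rule affine) fact
  also have "(\<integral>\<^sup>+x. \<integral>\<^sup>+\<omega>. ennreal (E x \<omega>) \<partial>\<Omega> \<partial>\<nu>) = (\<integral>\<^sup>+x. \<integral>\<^sup>+\<omega>. ennreal (D \<omega> x) \<partial>\<Omega> \<partial>\<nu>)"
    unfolding E_def by (rule nn_integral_invariant) measurable
  also have "ennreal (2 * C / sqrt n) * (ennreal (w + 1 / \<eta>) * \<dots> + ennreal (\<eta> * (2 * M / a\<^sup>2) * ?q))
    \<le> ennreal (2 * C / sqrt n) * (ennreal (w + 1 / \<eta>) * ennreal (c * \<eta>\<^sup>2) + ennreal (\<eta> * (2 * M / a\<^sup>2) * ?q))"
    by (intro mult_left_mono add_right_mono D_le) auto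
  also have "\<dots> = ennreal (2 * C / sqrt n * ((w + 1 / \<eta>) * (c * \<eta>\<^sup>2) + \<eta> * (2 * M / a\<^sup>2) * ?q))"
    using C(1) w0 \<eta> c M_ge_1 by (simp add: ennreal_mult[symmetric] ennreal_plus[symmetric] del: ennreal_plus)
  also have "\<dots> \<le> ennreal (2 * C / sqrt n * (((A + 3) * c + 2 * M / a\<^sup>2) * ((1 + t) * (real ?q + 1) * \<eta>)))"
  proof (intro ennreal_leI mult_left_mono)
    let ?r = "(1 + t) * (real ?q + 1)"
    have r1: "1 \<le> ?r" "real ?q \<le> ?r"
    proof -
      have "1 * (real ?q + 1) \<le> ?r" using t by (intro mult_right_mono) auto
      note b = this[unfolded mult_1_left]
      show "1 \<le> ?r" by (rule order_trans[OF _ b]) simp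
      show "real ?q \<le> ?r" by (rule order_trans[OF _ b]) simp
    qed
    have "(w + 1 / \<eta>) * (c * \<eta>\<^sup>2) = w * c * \<eta>\<^sup>2 + c * \<eta>"
      using \<eta> by (simp add: field_simps power2_eq_square)
    \<comment> \<open>Here \<open>\<eta> \<le> 1\<close> absorbs the square. The level
      \<open>1 / \<eta>\<close> contributes one further \<open>c * \<eta>\<close>, which raises the
      \<open>A + 2\<close> inside w to \<open>A + 3\<close>.\<close>
    also have "\<dots> \<le> w * c * \<eta> + c * \<eta> * ?r"
    proof (intro add_mono)
      have "\<eta>\<^sup>2 \<le> \<eta>" using \<eta> by (simp add: power2_eq_square mult_left_le)
      then show "w * c * \<eta>\<^sup>2 \<le> w * c * \<eta>" using w0 c by (intro mult_left_mono) auto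
      show "c * \<eta> \<le> c * \<eta> * ?r"
        using mult_left_mono[OF r1(1), of "c * \<eta>"] c \<eta> by simp
    qed
    also have "\<dots> = (A + 3) * c * (?r * \<eta>)" by (simp add: w_def algebra_simps)
    finally have "(w + 1 / \<eta>) * (c * \<eta>\<^sup>2) \<le> (A + 3) * c * (?r * \<eta>)" .
    moreover have "\<eta> * (2 * M / a\<^sup>2) * ?q \<le> \<eta> * (2 * M / a\<^sup>2) * ?r"
      using r1 \<eta> M_ge_1 by (intro mult_left_mono) auto
    moreover have "((A + 3) * c + m) * (?r * \<eta>) = (A + 3) * c * (?r * \<eta>) + \<eta> * m * ?r" for m
      by (simp add: algebra_simps)
    ultimately show "(w + 1 / \<eta>) * (c * \<eta>\<^sup>2) + \<eta> * (2 * M / a\<^sup>2) * ?q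
        \<le> ((A + 3) * c + 2 * M / a\<^sup>2) * (?r * \<eta>)"
      by (metis add_mono)
  qed (use C(1) in auto)
  finally show ?thesis unfolding E_def by (simp only: mult.assoc times_divide_eq_left times_divide_eq_right)
qed

end

section \<open>Localisation of the perturbation to finitely many steps\<close>

context cocycle_walk
begin

text \<open>A Lipschitz substitute for the indicator of \<open>\<bar>r\<bar> > y\<close>: it
  vanishes up to y and equals 1 from \<open>y + 1\<close> on. Unlike an indicator it transfers
  closeness in mean of two functions to their cutoffs.\<close>

definition cutoff :: "real \<Rightarrow> real \<Rightarrow> real" where
  "cutoff y r = min 1 (max 0 (\<bar>r\<bar> - y))"

lemma cutoff_bounds: "0 \<le> cutoff y r" "cutoff y r \<le> 1"
  by (auto simp: cutoff_def)

lemma cutoff_lipschitz: "\<bar>cutoff y r - cutoff y s\<bar> \<le> \<bar>r - s\<bar>"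
  unfolding cutoff_def by (simp add: min_def max_def abs_if)

lemma measurable_cutoff[measurable]: "cutoff y \<in> borel_measurable borel"
  unfolding cutoff_def by measurable

text \<open>Conditional expectation on the first p coordinates, realised by integrating out the
  others. This version is adapted at every point and jointly measurable when \<phi> is.\<close>

definition trunc :: "nat \<Rightarrow> ((nat \<Rightarrow> 'g) \<Rightarrow> 'x \<Rightarrow> real) \<Rightarrow> (nat \<Rightarrow> 'g) \<Rightarrow> 'x \<Rightarrow> real" where
  "trunc p \<phi> \<omega> x = (\<integral>\<omega>'. \<phi> (comb_seq p \<omega> \<omega>') x \<partial>\<Omega>)"

lemma comb_seq_comb_seq: "comb_seq p (comb_seq p \<omega> \<omega>') \<omega>'' = comb_seq p \<omega> \<omega>''"
  by (auto simp: comb_seq_def)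

lemma adapted_trunc: "adapted p (\<lambda>\<omega>. trunc p \<phi> \<omega> x)"
  by (simp add: adapted_def trunc_def comb_seq_comb_seq)

lemma adapted_mono:
  assumes "adapted p E" "p \<le> q" shows "adapted q E"
  unfolding adapted_def
proof (intro allI)
  fix \<omega> \<omega>' :: "nat \<Rightarrow> 'g"
  have eq: "comb_seq p (comb_seq q \<omega> \<omega>') \<omega> = comb_seq p \<omega> \<omega>"
    using assms(2) by (auto simp: comb_seq_def)
  have "E (comb_seq q \<omega> \<omega>') = E (comb_seq p (comb_seq q \<omega> \<omega>') \<omega>)"
    using assms(1) by (simp add: adapted_def)
  also have "\<dots> = E \<omega>" unfolding eq using assms(1) by (simp add: adapted_def)
  finally show "E (comb_seq q \<omega> \<omega>') = E \<omega>" .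
qed

lemma trunc_bounds:
  assumes "\<And>\<omega>. 0 \<le> \<phi> \<omega> x" "\<And>\<omega>. \<phi> \<omega> x \<le> 1"
  shows "0 \<le> trunc p \<phi> \<omega> x" "trunc p \<phi> \<omega> x \<le> 1"
proof -
  show "0 \<le> trunc p \<phi> \<omega> x" unfolding trunc_def by (intro Bochner_Integration.integral_nonneg assms)
  show "trunc p \<phi> \<omega> x \<le> 1"
    unfolding trunc_def
    by (cases "integrable \<Omega> (\<lambda>\<omega>'. \<phi> (comb_seq p \<omega> \<omega>') x)")
      (auto intro!: P.integral_le_const assms simp: not_integrable_integral_eq)
qed

text \<open>Level sets of a function measurable for \<open>Alg \<mu> p\<close> are preimages under
  restriction to the first p coordinates, so the function is constant on the fibres of the
  restriction, everywhere and not only almost everywhere.\<close>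

lemma adapted_cond_exp: "adapted p (real_cond_exp \<Omega> (Alg \<mu> p) F)"
  unfolding adapted_def
proof (intro allI)
  fix \<omega> \<omega>'
  let ?H = "real_cond_exp \<Omega> (Alg \<mu> p) F"
  let ?r = "\<lambda>\<omega>. restrict \<omega> {..<p}"
  have r: "?r \<in> UNIV \<rightarrow> space (PiM {..<p} (\<lambda>_. \<mu>))"
    by (auto simp: space_PiM)
  have sp: "space (Alg \<mu> p) = UNIV" by (simp add: Alg_def PP_def)
  have "{\<zeta> \<in> space (Alg \<mu> p). ?H \<zeta> = ?H \<omega>} \<in> sets (Alg \<mu> p)" by measurable
  then obtain B where B: "{\<zeta>. ?H \<zeta> = ?H \<omega>} = ?r -` B"
    unfolding sp unfolding Alg_def using sets_vimage_algebra2[OF r]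
    by (auto simp: PP_def)
  have "\<omega> \<in> ?r -` B" unfolding B[symmetric] by simp
  moreover have "?r (comb_seq p \<omega> \<omega>') = ?r \<omega>"
    by (auto simp: comb_seq_def restrict_def)
  ultimately have "comb_seq p \<omega> \<omega>' \<in> ?r -` B" by simp
  then show "?H (comb_seq p \<omega> \<omega>') = ?H \<omega>" unfolding B[symmetric] by simp
qed

text \<open>H takes the same value at a sequence and at its spliced version, so it can be inserted
  between the two values of F. Splicing preserves the measure, so both errors have the same
  integral, whence the factor 2.\<close>

lemma nn_integral_trunc_diff:
  assumes [measurable]: "\<phi> \<in> borel_measurable \<Omega>" "H \<in> borel_measurable \<Omega>" "F \<in> borel_measurable \<Omega>"
    and bounds: "\<And>\<omega>. 0 \<le> \<phi> \<omega>" "\<And>\<omega>. \<phi> \<omega> \<le> 1"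
    and lip: "\<And>\<omega> \<omega>'. \<bar>\<phi> \<omega> - \<phi> \<omega>'\<bar> \<le> \<bar>F \<omega> - F \<omega>'\<bar>"
    and H: "adapted p H"
  shows "(\<integral>\<^sup>+\<omega>. ennreal \<bar>\<phi> \<omega> - (\<integral>\<omega>'. \<phi> (comb_seq p \<omega> \<omega>') \<partial>\<Omega>)\<bar> \<partial>\<Omega>)
    \<le> 2 * (\<integral>\<^sup>+\<omega>. ennreal \<bar>F \<omega> - H \<omega>\<bar> \<partial>\<Omega>)"
proof -
  have "(\<integral>\<^sup>+\<omega>. ennreal \<bar>\<phi> \<omega> - (\<integral>\<omega>'. \<phi> (comb_seq p \<omega> \<omega>') \<partial>\<Omega>)\<bar> \<partial>\<Omega>)
    \<le> (\<integral>\<^sup>+\<omega>. (\<integral>\<^sup>+\<omega>'. ennreal \<bar>F \<omega> - H \<omega>\<bar> + ennreal \<bar>F (comb_seq p \<omega> \<omega>') - H (comb_seq p \<omega> \<omega>')\<bar> \<partial>\<Omega>) \<partial>\<Omega>)"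
  proof (intro nn_integral_mono)
    fix \<omega>
    have int: "integrable \<Omega> (\<lambda>\<omega>'. \<phi> (comb_seq p \<omega> \<omega>'))"
      by (rule P.integrable_const_bound[where B = 1]) (use bounds in \<open>auto simp: abs_le_iff intro: order_trans[of _ 0]\<close>)
    have "\<phi> \<omega> - (\<integral>\<omega>'. \<phi> (comb_seq p \<omega> \<omega>') \<partial>\<Omega>) = (\<integral>\<omega>'. \<phi> \<omega> - \<phi> (comb_seq p \<omega> \<omega>') \<partial>\<Omega>)"
      using int by simp
    then have "ennreal \<bar>\<phi> \<omega> - (\<integral>\<omega>'. \<phi> (comb_seq p \<omega> \<omega>') \<partial>\<Omega>)\<bar>
        = ennreal (norm (\<integral>\<omega>'. \<phi> \<omega> - \<phi> (comb_seq p \<omega> \<omega>') \<partial>\<Omega>))"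
      by simp
    also have "\<dots> \<le> (\<integral>\<^sup>+\<omega>'. ennreal (norm (\<phi> \<omega> - \<phi> (comb_seq p \<omega> \<omega>'))) \<partial>\<Omega>)"
      using int by (intro integral_norm_bound_ennreal) simp
    also have "\<dots> \<le> (\<integral>\<^sup>+\<omega>'. ennreal \<bar>F \<omega> - H \<omega>\<bar> + ennreal \<bar>F (comb_seq p \<omega> \<omega>') - H (comb_seq p \<omega> \<omega>')\<bar> \<partial>\<Omega>)"
    proof (intro nn_integral_mono)
      fix \<omega>'
      have "norm (\<phi> \<omega> - \<phi> (comb_seq p \<omega> \<omega>')) \<le> \<bar>F \<omega> - H \<omega>\<bar> + \<bar>F (comb_seq p \<omega> \<omega>') - H (comb_seq p \<omega> \<omega>')\<bar>"
        using lip[of \<omega> "comb_seq p \<omega> \<omega>'"] H unfolding adapted_def real_norm_def by fastforce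
      then have "ennreal (norm (\<phi> \<omega> - \<phi> (comb_seq p \<omega> \<omega>')))
          \<le> ennreal (\<bar>F \<omega> - H \<omega>\<bar> + \<bar>F (comb_seq p \<omega> \<omega>') - H (comb_seq p \<omega> \<omega>')\<bar>)"
        by (rule ennreal_leI)
      then show "ennreal (norm (\<phi> \<omega> - \<phi> (comb_seq p \<omega> \<omega>')))
          \<le> ennreal \<bar>F \<omega> - H \<omega>\<bar> + ennreal \<bar>F (comb_seq p \<omega> \<omega>') - H (comb_seq p \<omega> \<omega>')\<bar>"
        by simp
    qed
    finally show "ennreal \<bar>\<phi> \<omega> - (\<integral>\<omega>'. \<phi> (comb_seq p \<omega> \<omega>') \<partial>\<Omega>)\<bar> \<le> \<dots>" .
  qed
  also have "\<dots> = (\<integral>\<^sup>+\<omega>. ennreal \<bar>F \<omega> - H \<omega>\<bar> + (\<integral>\<^sup>+\<omega>'. ennreal \<bar>F (comb_seq p \<omega> \<omega>') - H (comb_seq p \<omega> \<omega>')\<bar> \<partial>\<Omega>) \<partial>\<Omega>)"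
    by (intro nn_integral_cong, subst nn_integral_add) auto
  also have "\<dots> = (\<integral>\<^sup>+\<omega>. ennreal \<bar>F \<omega> - H \<omega>\<bar> \<partial>\<Omega>)
      + (\<integral>\<^sup>+\<omega>. \<integral>\<^sup>+\<omega>'. ennreal \<bar>F (comb_seq p \<omega> \<omega>') - H (comb_seq p \<omega> \<omega>')\<bar> \<partial>\<Omega> \<partial>\<Omega>)"
    by (rule nn_integral_add) measurable
  also have "(\<integral>\<^sup>+\<omega>. \<integral>\<^sup>+\<omega>'. ennreal \<bar>F (comb_seq p \<omega> \<omega>') - H (comb_seq p \<omega> \<omega>')\<bar> \<partial>\<Omega> \<partial>\<Omega>)
      = (\<integral>\<^sup>+\<omega>. ennreal \<bar>F \<omega> - H \<omega>\<bar> \<partial>\<Omega>)"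
    by (rule nn_integral_comb_seq[symmetric]) measurable
  finally show ?thesis by (simp add: mult_2)
qed

end

context stationary_walk
begin

lemma measurable_trunc:
  assumes [measurable]: "(\<lambda>(\<omega>, x). \<phi> \<omega> x) \<in> borel_measurable (\<Omega> \<Otimes>\<^sub>M \<nu>)"
  shows "(\<lambda>(\<omega>, x). trunc p \<phi> \<omega> x) \<in> borel_measurable (\<Omega> \<Otimes>\<^sub>M \<nu>)"
proof -
  have "(\<lambda>w. (comb_seq p (fst (fst w)) (snd w), snd (fst w))) \<in> (\<Omega> \<Otimes>\<^sub>M \<nu>) \<Otimes>\<^sub>M \<Omega> \<rightarrow>\<^sub>M \<Omega> \<Otimes>\<^sub>M \<nu>"
    by measurable
  from measurable_compose[OF this assms]
  have "(\<lambda>w. \<phi> (comb_seq p (fst (fst w)) (snd w)) (snd (fst w))) \<in> borel_measurable ((\<Omega> \<Otimes>\<^sub>M \<nu>) \<Otimes>\<^sub>M \<Omega>)"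
    by simp
  then have "(\<lambda>z. \<integral>\<omega>'. \<phi> (comb_seq p (fst z) \<omega>') (snd z) \<partial>\<Omega>) \<in> borel_measurable (\<Omega> \<Otimes>\<^sub>M \<nu>)"
    by (intro P.borel_measurable_lebesgue_integral) (simp add: split_beta')
  then show ?thesis by (simp add: trunc_def split_beta')
qed

lemma measurable_section:
  assumes "(\<lambda>(\<omega>, x). \<phi> \<omega> x) \<in> borel_measurable (\<Omega> \<Otimes>\<^sub>M \<nu>)"
  shows "(\<lambda>\<omega>. \<phi> \<omega> x) \<in> borel_measurable \<Omega>"
proof -
  have "(\<lambda>\<omega>. (\<omega>, x)) \<in> \<Omega> \<rightarrow>\<^sub>M \<Omega> \<Otimes>\<^sub>M \<nu>" by simp
  from measurable_compose[OF this assms] show ?thesis by simp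
qed

lemma measurable_inner:
  assumes "(\<lambda>(\<omega>, x). \<phi> \<omega> x) \<in> borel_measurable (\<Omega> \<Otimes>\<^sub>M \<nu>)"
  shows "(\<lambda>x. \<integral>\<^sup>+\<omega>. \<phi> \<omega> x \<partial>\<Omega>) \<in> borel_measurable \<nu>"
proof (rule P.borel_measurable_nn_integral)
  have "(\<lambda>(x, \<omega>). (\<omega>, x)) \<in> \<nu> \<Otimes>\<^sub>M \<Omega> \<rightarrow>\<^sub>M \<Omega> \<Otimes>\<^sub>M \<nu>" by measurable
  from measurable_compose[OF this assms]
  show "(\<lambda>(x, \<omega>). \<phi> \<omega> x) \<in> borel_measurable (\<nu> \<Otimes>\<^sub>M \<Omega>)" by (simp add: split_beta')
qed

lemma nn_integral_trunc:
  assumes \<phi>: "(\<lambda>(\<omega>, x). \<phi> \<omega> x) \<in> borel_measurable (\<Omega> \<Otimes>\<^sub>M \<nu>)"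
    and bounds: "\<And>\<omega> x. 0 \<le> \<phi> \<omega> x" "\<And>\<omega> x. \<phi> \<omega> x \<le> 1"
  shows "(\<integral>\<^sup>+\<omega>. ennreal (trunc p \<phi> \<omega> x) \<partial>\<Omega>) = (\<integral>\<^sup>+\<omega>. ennreal (\<phi> \<omega> x) \<partial>\<Omega>)"
proof -
  note [measurable] = measurable_section[OF \<phi>, of x]
  have "ennreal (trunc p \<phi> \<omega> x) = (\<integral>\<^sup>+\<omega>'. ennreal (\<phi> (comb_seq p \<omega> \<omega>') x) \<partial>\<Omega>)" for \<omega>
  proof -
    have "integrable \<Omega> (\<lambda>\<omega>'. \<phi> (comb_seq p \<omega> \<omega>') x)"
      by (rule P.integrable_const_bound[where B = 1]) (use bounds in \<open>auto simp: abs_le_iff intro: order_trans[of _ 0]\<close>)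
    then show ?thesis unfolding trunc_def using bounds by (intro nn_integral_eq_integral[symmetric]) auto
  qed
  then show ?thesis
    using nn_integral_comb_seq[of "\<lambda>\<omega>. ennreal (\<phi> \<omega> x)" p] by simp
qed

text \<open>Exponential Markov inequality, applied to a function that is at most 1 and vanishes for
  \<open>\<bar>r\<bar> \<le> y\<close>.\<close>

lemma nn_integral_cutoff_le:
  assumes \<alpha>: "0 < \<alpha>"
    and C: "(\<integral>\<^sup>+x. \<integral>\<^sup>+\<omega>. ennreal (exp (\<alpha> * \<bar>f \<omega> x\<bar>)) \<partial>\<Omega> \<partial>\<nu>) \<le> ennreal B"
    and f: "(\<lambda>(\<omega>, x). f \<omega> x) \<in> borel_measurable (\<Omega> \<Otimes>\<^sub>M \<nu>)" and B: "0 \<le> B"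
  shows "(\<integral>\<^sup>+x. \<integral>\<^sup>+\<omega>. ennreal (cutoff y (f \<omega> x)) \<partial>\<Omega> \<partial>\<nu>) \<le> ennreal (B * exp (- (\<alpha> * y)))"
proof -
  have pw: "cutoff y r \<le> exp (- (\<alpha> * y)) * exp (\<alpha> * \<bar>r\<bar>)" for r
  proof (cases "\<bar>r\<bar> \<le> y")
    case False
    have "cutoff y r \<le> 1" by (rule cutoff_bounds)
    also have "\<dots> \<le> exp (\<alpha> * (\<bar>r\<bar> - y))" using False \<alpha> by simp
    also have "\<dots> = exp (- (\<alpha> * y)) * exp (\<alpha> * \<bar>r\<bar>)" by (simp add: right_diff_distrib flip: exp_add)
    finally show ?thesis .
  qed (simp add: cutoff_def)
  note [measurable] = measurable_section[OF f]
  have J: "(\<lambda>x. \<integral>\<^sup>+\<omega>. ennreal (exp (\<alpha> * \<bar>f \<omega> x\<bar>)) \<partial>\<Omega>) \<in> borel_measurable \<nu>"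
    by (rule measurable_inner) (use f in measurable)
  have "(\<integral>\<^sup>+x. \<integral>\<^sup>+\<omega>. ennreal (cutoff y (f \<omega> x)) \<partial>\<Omega> \<partial>\<nu>)
    \<le> (\<integral>\<^sup>+x. \<integral>\<^sup>+\<omega>. ennreal (exp (- (\<alpha> * y))) * ennreal (exp (\<alpha> * \<bar>f \<omega> x\<bar>)) \<partial>\<Omega> \<partial>\<nu>)"
    using pw by (intro nn_integral_mono) (simp add: ennreal_leI flip: ennreal_mult)
  also have "\<dots> = ennreal (exp (- (\<alpha> * y))) * (\<integral>\<^sup>+x. \<integral>\<^sup>+\<omega>. ennreal (exp (\<alpha> * \<bar>f \<omega> x\<bar>)) \<partial>\<Omega> \<partial>\<nu>)"
    by (simp add: nn_integral_cmult J)
  also have "\<dots> \<le> ennreal (exp (- (\<alpha> * y))) * ennreal B"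
    by (intro mult_left_mono C) simp
  finally show ?thesis using B by (simp add: mult.commute flip: ennreal_mult)
qed

text \<open>The conditional expectation of \<open>f\<close> need not be jointly measurable in \<open>(\<omega>, x)\<close>. It is only used
  as a comparison function for fixed \<open>x\<close> that does not depend on the coordinates beyond \<open>p\<close>.\<close>
lemma nn_integral_cutoff_trunc_diff:
  assumes \<alpha>: "0 < \<alpha>" and B: "0 \<le> B"
    and f: "(\<lambda>(\<omega>, x). f \<omega> x) \<in> borel_measurable (\<Omega> \<Otimes>\<^sub>M \<nu>)"
    and D: "ennreal (exp (\<beta> * p)) * ((\<integral>\<^sup>+x. \<integral>\<^sup>+\<omega>. ennreal (exp (\<alpha> *
        \<bar>f \<omega> x - real_cond_exp \<Omega> (Alg \<mu> p) (\<lambda>\<omega>'. f \<omega>' x) \<omega>\<bar>)) \<partial>\<Omega> \<partial>\<nu>) - 1) \<le> ennreal B"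
  shows "(\<integral>\<^sup>+x. \<integral>\<^sup>+\<omega>. ennreal \<bar>cutoff y (f \<omega> x) - trunc p (\<lambda>\<omega> x. cutoff y (f \<omega> x)) \<omega> x\<bar> \<partial>\<Omega> \<partial>\<nu>)
    \<le> ennreal (2 * B / \<alpha> * exp (- (\<beta> * p)))"
proof -
  let ?\<phi> = "\<lambda>\<omega> x. cutoff y (f \<omega> x)"
  define m where "m x = (\<integral>\<^sup>+\<omega>. ennreal \<bar>?\<phi> \<omega> x - trunc p ?\<phi> \<omega> x\<bar> \<partial>\<Omega>)" for x
  define H where "H x = real_cond_exp \<Omega> (Alg \<mu> p) (\<lambda>\<omega>'. f \<omega>' x)" for x
  define I where "I = (\<integral>\<^sup>+x. m x \<partial>\<nu>)"
  have \<phi>: "(\<lambda>(\<omega>, x). ?\<phi> \<omega> x) \<in> borel_measurable (\<Omega> \<Otimes>\<^sub>M \<nu>)"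
    using measurable_compose[OF f measurable_cutoff[of y]] by (simp add: split_beta')
  have [measurable]: "m \<in> borel_measurable \<nu>"
    unfolding m_def
  proof (rule measurable_inner)
    show "(\<lambda>(\<omega>, x). ennreal \<bar>?\<phi> \<omega> x - trunc p ?\<phi> \<omega> x\<bar>) \<in> borel_measurable (\<Omega> \<Otimes>\<^sub>M \<nu>)"
      using \<phi> measurable_trunc[OF \<phi>, of p] by (simp add: split_beta')
  qed
  \<comment> \<open>The inequality \<open>1 + s \<le> exp s\<close> reduces the exponential to a
    distance in mean, and its constant 1 is what the subtraction in the hypothesis D
    removes.\<close>
  have inner: "1 + ennreal (\<alpha> / 2) * m x \<le> (\<integral>\<^sup>+\<omega>. ennreal (exp (\<alpha> * \<bar>f \<omega> x - H x \<omega>\<bar>)) \<partial>\<Omega>)" for x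
  proof -
    note [measurable] = measurable_section[OF f, of x] measurable_section[OF \<phi>, of x]
    have [measurable]: "H x \<in> borel_measurable \<Omega>" unfolding H_def by simp
    have "m x \<le> 2 * (\<integral>\<^sup>+\<omega>. ennreal \<bar>f \<omega> x - H x \<omega>\<bar> \<partial>\<Omega>)"
      unfolding m_def trunc_def
      by (rule nn_integral_trunc_diff[where F = "\<lambda>\<omega>. f \<omega> x"])
        (auto simp: cutoff_bounds cutoff_lipschitz H_def adapted_cond_exp)
    then have "1 + ennreal (\<alpha> / 2) * m x \<le> 1 + ennreal (\<alpha> / 2) * (2 * (\<integral>\<^sup>+\<omega>. ennreal \<bar>f \<omega> x - H x \<omega>\<bar> \<partial>\<Omega>))"
      by (intro add_left_mono mult_left_mono) auto
    also have "ennreal (\<alpha> / 2) * (2 * (\<integral>\<^sup>+\<omega>. ennreal \<bar>f \<omega> x - H x \<omega>\<bar> \<partial>\<Omega>))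
        = ennreal \<alpha> * (\<integral>\<^sup>+\<omega>. ennreal \<bar>f \<omega> x - H x \<omega>\<bar> \<partial>\<Omega>)"
    proof -
      have "ennreal (\<alpha> / 2) * 2 = ennreal (\<alpha> / 2 * 2)" using \<alpha> by (subst ennreal_mult) auto
      then show ?thesis by (simp flip: mult.assoc)
    qed
    also have "1 + \<dots> = (\<integral>\<^sup>+\<omega>. 1 + ennreal \<alpha> * ennreal \<bar>f \<omega> x - H x \<omega>\<bar> \<partial>\<Omega>)"
      by (subst nn_integral_add) (auto simp: nn_integral_cmult)
    also have "\<dots> \<le> (\<integral>\<^sup>+\<omega>. ennreal (exp (\<alpha> * \<bar>f \<omega> x - H x \<omega>\<bar>)) \<partial>\<Omega>)"
    proof (intro nn_integral_mono)
      fix \<omega>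
      have "ennreal (1 + \<alpha> * \<bar>f \<omega> x - H x \<omega>\<bar>) \<le> ennreal (exp (\<alpha> * \<bar>f \<omega> x - H x \<omega>\<bar>))"
        by (intro ennreal_leI exp_ge_add_one_self)
      then show "1 + ennreal \<alpha> * ennreal \<bar>f \<omega> x - H x \<omega>\<bar> \<le> ennreal (exp (\<alpha> * \<bar>f \<omega> x - H x \<omega>\<bar>))"
        using \<alpha> by (simp add: ennreal_mult)
    qed
    finally show ?thesis .
  qed
  have "1 + ennreal (\<alpha> / 2) * I = (\<integral>\<^sup>+x. 1 + ennreal (\<alpha> / 2) * m x \<partial>\<nu>)"
    unfolding I_def using nu.emeasure_space_1 by (subst nn_integral_add) (auto simp: nn_integral_cmult)
  also have "\<dots> \<le> (\<integral>\<^sup>+x. \<integral>\<^sup>+\<omega>. ennreal (exp (\<alpha> * \<bar>f \<omega> x - H x \<omega>\<bar>)) \<partial>\<Omega> \<partial>\<nu>)"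
    by (intro nn_integral_mono inner)
  finally have "1 + ennreal (\<alpha> / 2) * I - 1
      \<le> (\<integral>\<^sup>+x. \<integral>\<^sup>+\<omega>. ennreal (exp (\<alpha> * \<bar>f \<omega> x - H x \<omega>\<bar>)) \<partial>\<Omega> \<partial>\<nu>) - 1"
    by (rule ennreal_minus_mono) simp
  then have "ennreal (exp (\<beta> * p)) * (ennreal (\<alpha> / 2) * I)
      \<le> ennreal (exp (\<beta> * p)) * ((\<integral>\<^sup>+x. \<integral>\<^sup>+\<omega>. ennreal (exp (\<alpha> * \<bar>f \<omega> x - H x \<omega>\<bar>)) \<partial>\<Omega> \<partial>\<nu>) - 1)"
    by (intro mult_left_mono) simp_all
  also have "\<dots> \<le> ennreal B" using D by (simp add: H_def)
  finally have "ennreal (2 / \<alpha> * exp (- (\<beta> * p))) * (ennreal (exp (\<beta> * p)) * (ennreal (\<alpha> / 2) * I))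
      \<le> ennreal (2 / \<alpha> * exp (- (\<beta> * p))) * ennreal B"
    by (intro mult_left_mono) simp_all
  moreover have "ennreal (2 / \<alpha> * exp (- (\<beta> * p))) * (ennreal (exp (\<beta> * p)) * (ennreal (\<alpha> / 2) * I)) = I"
    using \<alpha> by (simp add: ennreal_mult[symmetric] mult.assoc[symmetric] exp_minus)
  moreover have "ennreal (2 / \<alpha> * exp (- (\<beta> * p))) * ennreal B = ennreal (2 * B / \<alpha> * exp (- (\<beta> * p)))"
    using \<alpha> B by (simp add: ennreal_mult[symmetric] mult_ac)
  ultimately show ?thesis unfolding I_def m_def by simp
qed

end

section \<open>Survival together with a large perturbation\<close>

lemma summable_linear_exp:
  fixes c :: real
  assumes c: "0 < c"
  shows "summable (\<lambda>n. (real n + 1) * exp (- (c * real n)))"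
proof (rule summable_comparison_test_ev)
  have "(real n + 1) * exp (- (c * real n)) \<le> (2 / c + 1) * exp (- (c / 2)) ^ n" for n
  proof -
    have "0 \<le> c / 2 * real n" using c by simp
    then have "c / 2 * real n \<le> exp (c / 2 * real n) \<and> 1 \<le> exp (c / 2 * real n)"
      using exp_ge_add_one_self[of "c / 2 * real n"] by linarith
    moreover have "real n = 2 / c * (c / 2 * real n)" using c by simp
    ultimately have "real n \<le> 2 / c * exp (c / 2 * real n)"
      using c by (metis divide_nonneg_pos mult_left_mono zero_le_numeral)
    with \<open>c / 2 * real n \<le> exp (c / 2 * real n) \<and> 1 \<le> exp (c / 2 * real n)\<close>
    have "real n + 1 \<le> (2 / c + 1) * exp (c / 2 * real n)"
      by (simp only: distrib_right mult_1_left) linarith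
    then have "(real n + 1) * exp (- (c * real n)) \<le> (2 / c + 1) * exp (c / 2 * real n) * exp (- (c * real n))"
      by (intro mult_right_mono) auto
    also have "\<dots> = (2 / c + 1) * exp (- (c / 2)) ^ n"
      by (simp add: mult.assoc algebra_simps flip: exp_add exp_of_nat_mult)
    finally show ?thesis .
  qed
  then show "\<forall>\<^sub>F n in sequentially. norm ((real n + 1) * exp (- (c * real n))) \<le> (2 / c + 1) * exp (- (c / 2)) ^ n"
    by simp
  show "summable (\<lambda>n. (2 / c + 1) * exp (- (c / 2)) ^ n)"
    using c by (intro summable_mult summable_geometric) auto
qed

context stationary_walk
begin

text \<open>The smaller of two exponentials is at most their geometric mean. It is written as a
  square because \<open>weighted_survival\<close> expects a mean of the form
  \<open>c * \<eta>\<^sup>2\<close>.\<close>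

lemma min_le_exp_mean:
  assumes "I \<le> ennreal (c * exp (- y))" "I \<le> ennreal (c * exp (- z))" "0 \<le> c"
  shows "I \<le> ennreal (c * (exp (- (y + z) / 4))\<^sup>2)"
proof -
  have "exp (- (y + z) / 4) ^ 2 = exp (- (y + z) / 2)"
    by (simp flip: exp_double)
  moreover have "exp (- y) \<le> exp (- (y + z) / 2) \<or> exp (- z) \<le> exp (- (y + z) / 2)"
    by auto
  then have "c * exp (- y) \<le> c * exp (- (y + z) / 2) \<or> c * exp (- z) \<le> c * exp (- (y + z) / 2)"
    using assms(3) by (auto intro: mult_left_mono)
  ultimately show ?thesis using assms(1,2) by (metis ennreal_leI order_trans)
qed

text \<open>The cutoff is at most \<open>T 0\<close> plus the absolute differences of successive
  truncations plus a remainder. Each such term is small in two ways, by the size y of the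
  perturbation and by the number p of steps that determine it, so \<open>weighted_survival\<close>
  gives bounds that can be summed over p.\<close>

lemma cutoff_survival:
  assumes C: "1 \<le> C" "\<And>x t n. 0 \<le> t \<Longrightarrow> 1 \<le> n \<Longrightarrow> u x t n \<le> C * (1 + t) / sqrt n"
    and \<alpha>: "0 < \<alpha>" and \<beta>: "0 < \<beta>" and B: "0 \<le> B"
    and f: "(\<lambda>(\<omega>, x). f \<omega> x) \<in> borel_measurable (\<Omega> \<Otimes>\<^sub>M \<nu>)"
    and Ca: "(\<integral>\<^sup>+x. \<integral>\<^sup>+\<omega>. ennreal (exp (\<alpha> * \<bar>f \<omega> x\<bar>)) \<partial>\<Omega> \<partial>\<nu>) \<le> ennreal B"
    and Dab: "\<And>p. ennreal (exp (\<beta> * real p)) * ((\<integral>\<^sup>+x. \<integral>\<^sup>+\<omega>. ennreal (exp (\<alpha> *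
        \<bar>f \<omega> x - real_cond_exp \<Omega> (Alg \<mu> p) (\<lambda>\<omega>'. f \<omega>' x) \<omega>\<bar>)) \<partial>\<Omega> \<partial>\<nu>) - 1) \<le> ennreal B"
    and y: "0 \<le> y" and t: "0 \<le> t" and n: "1 \<le> n"
  shows "(\<integral>\<^sup>+x. \<integral>\<^sup>+\<omega>. ennreal (cutoff y (f (shift k \<omega>) (pos x \<omega> k))) * indicator {\<omega>. surv x t n \<omega>} \<omega> \<partial>\<Omega> \<partial>\<nu>)
    \<le> ennreal (2 * C * ((A + 3) * ((2 * B + 4 * B / \<alpha> + 1) * exp \<beta>) + 2 * M / a\<^sup>2)
        * ((1 + t) * exp (- (\<alpha> / 4 * y)) * (real k + 1) * (\<Sum>p. (real p + 1) * exp (- (\<beta> / 4 * real p)))) / sqrt n)"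
proof -
  let ?\<phi> = "\<lambda>\<omega> x. cutoff y (f \<omega> x)"
  let ?K = "2 * C * ((A + 3) * ((2 * B + 4 * B / \<alpha> + 1) * exp \<beta>) + 2 * M / a\<^sup>2)"
  \<comment> \<open>It dominates \<open>2 * B\<close> (two terms bounded by the tail in y), 1 (the
    trivial bound at \<open>p = 0\<close>) and \<open>4 * B / \<alpha> * exp \<beta>\<close> (two
    approximation errors, where \<open>exp \<beta>\<close> comes from the index
    \<open>p - 1\<close>).\<close>
  define c where "c = (2 * B + 4 * B / \<alpha> + 1) * exp \<beta>"
  \<comment> \<open>The square root of the geometric mean of the two decay factors, hence the
    division by 4.\<close>
  define \<eta> where "\<eta> p = exp (- (\<alpha> * y + \<beta> * real p) / 4)" for p :: nat
  define T where "T p = trunc p ?\<phi>" for p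
  \<comment> \<open>The value at \<open>p = n + 1\<close> is the remainder, which may depend on all
    coordinates. Adaptedness is only demanded for \<open>2 * (k + p) \<le> n\<close>, which fails
    there.\<close>
  define D where "D p \<omega> x = (if p = 0 then T 0 \<omega> x else if p \<le> n then \<bar>T p \<omega> x - T (p - 1) \<omega> x\<bar>
    else \<bar>?\<phi> \<omega> x - T n \<omega> x\<bar>)" for p \<omega> x
  have e\<beta>: "1 \<le> exp \<beta>" using \<beta> by simp
  have c_ge: "2 * B \<le> c" "1 \<le> c" "4 * B / \<alpha> * exp \<beta> \<le> c"
  proof -
    have "0 \<le> 4 * B / \<alpha>" using B \<alpha> by simp
    then have "(2 * B + 4 * B / \<alpha> + 1) * 1 \<le> c" unfolding c_def using B e\<beta> by (intro mult_left_mono) auto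
    note le = this[unfolded mult_1_right]
    show "2 * B \<le> c" "1 \<le> c"
      by (rule order_trans[OF _ le], use B \<open>0 \<le> 4 * B / \<alpha>\<close> in simp)+
    show "4 * B / \<alpha> * exp \<beta> \<le> c" unfolding c_def using B by (intro mult_right_mono) auto
  qed
  have \<phi>01: "0 \<le> ?\<phi> \<omega> x" "?\<phi> \<omega> x \<le> 1" for \<omega> x by (rule cutoff_bounds)+
  have T01: "0 \<le> T p \<omega> x" "T p \<omega> x \<le> 1" for p \<omega> x
    unfolding T_def by (rule trunc_bounds; rule cutoff_bounds)+
  have \<phi>m: "(\<lambda>(\<omega>, x). ?\<phi> \<omega> x) \<in> borel_measurable (\<Omega> \<Otimes>\<^sub>M \<nu>)"
    using measurable_compose[OF f measurable_cutoff[of y]] by (simp add: split_beta')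
  have Tm: "(\<lambda>(\<omega>, x). T p \<omega> x) \<in> borel_measurable (\<Omega> \<Otimes>\<^sub>M \<nu>)" for p
    unfolding T_def by (rule measurable_trunc[OF \<phi>m])
  have Dm: "(\<lambda>(\<omega>, x). D p \<omega> x) \<in> borel_measurable (\<Omega> \<Otimes>\<^sub>M \<nu>)" for p
    using \<phi>m Tm[of 0] Tm[of p] Tm[of "p - 1"] Tm[of n] unfolding D_def split_beta'
    by (cases "p = 0"; cases "p \<le> n") simp_all
  have D01: "0 \<le> D p \<omega> x" "D p \<omega> x \<le> 1" for p \<omega> x
    using T01[of p \<omega> x] T01[of "p - 1" \<omega> x] T01[of 0 \<omega> x] T01[of n \<omega> x] \<phi>01[of \<omega> x]
    unfolding D_def by (auto simp: abs_le_iff)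
  have adapD: "adapted p (\<lambda>\<omega>. D p \<omega> x)" if "2 * (k + p) \<le> n" for p x
  proof -
    have "adapted p (\<lambda>\<omega>. T p \<omega> x)" "adapted p (\<lambda>\<omega>. T (p - 1) \<omega> x)"
      unfolding T_def by (auto intro: adapted_trunc adapted_mono[OF adapted_trunc])
    moreover have "p \<le> n" using that by simp
    ultimately show ?thesis unfolding D_def by (cases "p = 0") (auto simp: adapted_def)
  qed
  have dom: "?\<phi> \<omega> x \<le> (\<Sum>p\<le>Suc n. D p \<omega> x)" for \<omega> x
  proof -
    have "T j \<omega> x \<le> (\<Sum>p\<le>j. D p \<omega> x)" if "j \<le> n" for j
      using that
    proof (induction j)
      case (Suc j)
      then have "T (Suc j) \<omega> x \<le> (\<Sum>p\<le>j. D p \<omega> x) + \<bar>T (Suc j) \<omega> x - T j \<omega> x\<bar>"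
        by linarith
      then show ?case using Suc.prems by (simp add: D_def)
    qed (simp add: D_def)
    from this[of n] have "?\<phi> \<omega> x \<le> (\<Sum>p\<le>n. D p \<omega> x) + \<bar>?\<phi> \<omega> x - T n \<omega> x\<bar>"
      by linarith
    then show ?thesis by (simp add: D_def)
  qed
  have int_mono: "(\<integral>\<^sup>+x. \<integral>\<^sup>+\<omega>. ennreal (F \<omega> x) \<partial>\<Omega> \<partial>\<nu>) \<le> ennreal (b + b')"
    if G: "(\<lambda>(\<omega>, x). G \<omega> x) \<in> borel_measurable (\<Omega> \<Otimes>\<^sub>M \<nu>)" and G': "(\<lambda>(\<omega>, x). G' \<omega> x) \<in> borel_measurable (\<Omega> \<Otimes>\<^sub>M \<nu>)"
      and le: "\<And>\<omega> x. F \<omega> x \<le> G \<omega> x + G' \<omega> x" and nn: "\<And>\<omega> x. 0 \<le> G \<omega> x" "\<And>\<omega> x. 0 \<le> G' \<omega> x"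
      and b: "(\<integral>\<^sup>+x. \<integral>\<^sup>+\<omega>. ennreal (G \<omega> x) \<partial>\<Omega> \<partial>\<nu>) \<le> ennreal b" "(\<integral>\<^sup>+x. \<integral>\<^sup>+\<omega>. ennreal (G' \<omega> x) \<partial>\<Omega> \<partial>\<nu>) \<le> ennreal b'"
        "0 \<le> b" "0 \<le> b'"
    for F G G' :: "(nat \<Rightarrow> 'g) \<Rightarrow> 'x \<Rightarrow> real" and b b' :: real
  proof -
    have m: "(\<lambda>(\<omega>, x). ennreal (G \<omega> x)) \<in> borel_measurable (\<Omega> \<Otimes>\<^sub>M \<nu>)"
      "(\<lambda>(\<omega>, x). ennreal (G' \<omega> x)) \<in> borel_measurable (\<Omega> \<Otimes>\<^sub>M \<nu>)"
      using G G' by (simp_all add: split_beta')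
    have "(\<integral>\<^sup>+x. \<integral>\<^sup>+\<omega>. ennreal (F \<omega> x) \<partial>\<Omega> \<partial>\<nu>) \<le> (\<integral>\<^sup>+x. \<integral>\<^sup>+\<omega>. ennreal (G \<omega> x) + ennreal (G' \<omega> x) \<partial>\<Omega> \<partial>\<nu>)"
      using le nn by (intro nn_integral_mono) (simp add: ennreal_leI flip: ennreal_plus)
    also have "\<dots> = (\<integral>\<^sup>+x. \<integral>\<^sup>+\<omega>. ennreal (G \<omega> x) \<partial>\<Omega> \<partial>\<nu>) + (\<integral>\<^sup>+x. \<integral>\<^sup>+\<omega>. ennreal (G' \<omega> x) \<partial>\<Omega> \<partial>\<nu>)"
      using measurable_section[OF m(1)] measurable_section[OF m(2)] measurable_inner[OF m(1)] measurable_inner[OF m(2)]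
      by (simp add: nn_integral_add)
    also have "\<dots> \<le> ennreal (b + b')" using b by (simp add: add_mono)
    finally show ?thesis .
  qed
  have I\<phi>: "(\<integral>\<^sup>+x. \<integral>\<^sup>+\<omega>. ennreal (?\<phi> \<omega> x) \<partial>\<Omega> \<partial>\<nu>) \<le> ennreal (B * exp (- (\<alpha> * y)))"
    by (rule nn_integral_cutoff_le[OF \<alpha> Ca f B])
  have IT: "(\<integral>\<^sup>+x. \<integral>\<^sup>+\<omega>. ennreal (T p \<omega> x) \<partial>\<Omega> \<partial>\<nu>) \<le> ennreal (B * exp (- (\<alpha> * y)))" for p
    using I\<phi> unfolding T_def by (simp add: nn_integral_trunc[OF \<phi>m \<phi>01])
  have Idiff: "(\<integral>\<^sup>+x. \<integral>\<^sup>+\<omega>. ennreal \<bar>?\<phi> \<omega> x - T p \<omega> x\<bar> \<partial>\<Omega> \<partial>\<nu>) \<le> ennreal (2 * B / \<alpha> * exp (- (\<beta> * p)))" for p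
    unfolding T_def by (rule nn_integral_cutoff_trunc_diff[OF \<alpha> B f Dab])
  have diffm: "(\<lambda>(\<omega>, x). \<bar>?\<phi> \<omega> x - T p \<omega> x\<bar>) \<in> borel_measurable (\<Omega> \<Otimes>\<^sub>M \<nu>)" for p
    using \<phi>m Tm[of p] by (simp add: split_beta')
  have D_y: "(\<integral>\<^sup>+x. \<integral>\<^sup>+\<omega>. ennreal (D p \<omega> x) \<partial>\<Omega> \<partial>\<nu>) \<le> ennreal (c * exp (- (\<alpha> * y)))" for p
  proof -
    have "(\<integral>\<^sup>+x. \<integral>\<^sup>+\<omega>. ennreal (D p \<omega> x) \<partial>\<Omega> \<partial>\<nu>) \<le> ennreal (B * exp (- (\<alpha> * y)) + B * exp (- (\<alpha> * y)))"
    proof (cases "p \<le> n")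
      case True
      show ?thesis
        by (rule int_mono[OF Tm Tm _ T01(1) T01(1) IT[of p] IT[of "p - 1"]])
          (use True T01 B in \<open>auto simp: D_def abs_le_iff intro: add_increasing add_increasing2\<close>)
    next
      case False
      show ?thesis
        by (rule int_mono[OF \<phi>m Tm _ \<phi>01(1) T01(1) I\<phi> IT[of n]])
          (use False T01 \<phi>01 B in \<open>auto simp: D_def abs_le_iff intro: add_increasing add_increasing2\<close>)
    qed
    also have "\<dots> \<le> ennreal (c * exp (- (\<alpha> * y)))"
      using mult_right_mono[OF c_ge(1), of "exp (- (\<alpha> * y))"] by (intro ennreal_leI) simp
    finally show ?thesis .
  qed
  have D_p: "(\<integral>\<^sup>+x. \<integral>\<^sup>+\<omega>. ennreal (D p \<omega> x) \<partial>\<Omega> \<partial>\<nu>) \<le> ennreal (c * exp (- (\<beta> * real p)))"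
    if p: "p \<le> Suc n" for p
  proof (cases "p = 0")
    case True
    have "(\<integral>\<^sup>+x. \<integral>\<^sup>+\<omega>. ennreal (D p \<omega> x) \<partial>\<Omega> \<partial>\<nu>) \<le> (\<integral>\<^sup>+x. \<integral>\<^sup>+\<omega>. 1 \<partial>\<Omega> \<partial>\<nu>)"
      using D01(2) by (intro nn_integral_mono) (simp flip: ennreal_1 add: ennreal_leI del: ennreal_1)
    also have "\<dots> = ennreal 1" using nu.emeasure_space_1 by simp
    also have "\<dots> \<le> ennreal (c * exp (- (\<beta> * real p)))" using True c_ge by (intro ennreal_leI) simp
    finally show ?thesis .
  next
    case False
    let ?e = "2 * B / \<alpha> * exp (- (\<beta> * real (p - 1)))"
    have e0: "0 \<le> ?e" using B \<alpha> by simp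
    have mono_e: "ennreal (2 * B / \<alpha> * exp (- (\<beta> * real j))) \<le> ennreal ?e" if "p - 1 \<le> j" for j
      using that B \<alpha> \<beta> by (intro ennreal_leI mult_left_mono) auto
    have "(\<integral>\<^sup>+x. \<integral>\<^sup>+\<omega>. ennreal (D p \<omega> x) \<partial>\<Omega> \<partial>\<nu>) \<le> ennreal (?e + ?e)"
    proof (cases "p \<le> n")
      case True
      show ?thesis
        by (rule int_mono[OF diffm diffm _ _ _ order_trans[OF Idiff[of p] mono_e] Idiff[of "p - 1"]])
          (use True False e0 in \<open>auto simp: D_def\<close>)
    next
      case pn: False
      then have "p - 1 = n" using p by simp
      then show ?thesis
        by (intro int_mono[OF diffm diffm _ _ _ Idiff[of n, folded \<open>p - 1 = n\<close>] Idiff[of "p - 1"]])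
          (use pn e0 in \<open>auto simp: D_def\<close>)
    qed
    also have "?e + ?e = 4 * B / \<alpha> * exp \<beta> * exp (- (\<beta> * real p))"
      using False by (simp add: of_nat_diff algebra_simps flip: exp_add)
    also have "ennreal \<dots> \<le> ennreal (c * exp (- (\<beta> * real p)))"
      by (intro ennreal_leI mult_right_mono c_ge) simp
    finally show ?thesis .
  qed
  have D_le: "(\<integral>\<^sup>+x. \<integral>\<^sup>+\<omega>. ennreal (D p \<omega> x) \<partial>\<Omega> \<partial>\<nu>) \<le> ennreal (c * (\<eta> p)\<^sup>2)" if "p \<le> Suc n" for p
    unfolding \<eta>_def using c_ge by (intro min_le_exp_mean D_y D_p that) auto
  have \<eta>01: "0 < \<eta> p" "\<eta> p \<le> 1" for p
  proof -
    have "0 \<le> \<alpha> * y + \<beta> * real p"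
      using \<alpha> \<beta> y by (intro add_nonneg_nonneg mult_nonneg_nonneg) auto
    then show "0 < \<eta> p" "\<eta> p \<le> 1" by (simp_all add: \<eta>_def)
  qed
  have term_le: "(\<integral>\<^sup>+x. \<integral>\<^sup>+\<omega>. ennreal (D p (shift k \<omega>) (pos x \<omega> k)) * indicator {\<omega>. surv x t n \<omega>} \<omega> \<partial>\<Omega> \<partial>\<nu>)
      \<le> ennreal (?K * ((1 + t) * (real (k + p) + 1) * \<eta> p) / sqrt n)" if "p \<le> Suc n" for p
    unfolding c_def[symmetric]
    by (rule weighted_survival[OF C Dm D01 adapD D_le[OF that]]) (use c_ge \<eta>01 t n in auto)
  have Emeas: "(\<lambda>(\<omega>, x). ennreal (D p (shift k \<omega>) (pos x \<omega> k)) * indicator {\<omega>. surv x t n \<omega>} \<omega>)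
      \<in> borel_measurable (\<Omega> \<Otimes>\<^sub>M \<nu>)" for p
  proof -
    have "(\<lambda>z. (shift k (fst z), pos (snd z) (fst z) k)) \<in> \<Omega> \<Otimes>\<^sub>M \<nu> \<rightarrow>\<^sub>M \<Omega> \<Otimes>\<^sub>M \<nu>" by measurable
    from measurable_compose[OF this Dm[of p]]
    have [measurable]: "(\<lambda>z. D p (shift k (fst z)) (pos (snd z) (fst z) k)) \<in> borel_measurable (\<Omega> \<Otimes>\<^sub>M \<nu>)"
      by simp
    have "(\<lambda>z. ennreal (D p (shift k (fst z)) (pos (snd z) (fst z) k)) * (if surv (snd z) t n (fst z) then 1 else 0))
      \<in> borel_measurable (\<Omega> \<Otimes>\<^sub>M \<nu>)" by measurable
    then show ?thesis by (simp add: split_beta' indicator_def)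
  qed
  have "(\<integral>\<^sup>+x. \<integral>\<^sup>+\<omega>. ennreal (?\<phi> (shift k \<omega>) (pos x \<omega> k)) * indicator {\<omega>. surv x t n \<omega>} \<omega> \<partial>\<Omega> \<partial>\<nu>)
    \<le> (\<integral>\<^sup>+x. \<integral>\<^sup>+\<omega>. (\<Sum>p\<le>Suc n. ennreal (D p (shift k \<omega>) (pos x \<omega> k)) * indicator {\<omega>. surv x t n \<omega>} \<omega>) \<partial>\<Omega> \<partial>\<nu>)"
  proof (intro nn_integral_mono)
    fix x \<omega>
    show "ennreal (?\<phi> (shift k \<omega>) (pos x \<omega> k)) * indicator {\<omega>. surv x t n \<omega>} \<omega>
      \<le> (\<Sum>p\<le>Suc n. ennreal (D p (shift k \<omega>) (pos x \<omega> k)) * indicator {\<omega>. surv x t n \<omega>} \<omega>)"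
      unfolding sum_distrib_right[symmetric]
      using dom[of "shift k \<omega>" "pos x \<omega> k"] D01(1)
      by (intro mult_right_mono) (simp_all only: sum_ennreal ennreal_leI zero_le)
  qed
  also have "\<dots> = (\<Sum>p\<le>Suc n. \<integral>\<^sup>+x. \<integral>\<^sup>+\<omega>. ennreal (D p (shift k \<omega>) (pos x \<omega> k)) * indicator {\<omega>. surv x t n \<omega>} \<omega> \<partial>\<Omega> \<partial>\<nu>)"
    by (simp only: nn_integral_sum[OF measurable_section[OF Emeas]] nn_integral_sum[OF measurable_inner[OF Emeas]])
  also have "\<dots> \<le> (\<Sum>p\<le>Suc n. ennreal (?K * ((1 + t) * (real (k + p) + 1) * \<eta> p) / sqrt n))"
    by (intro sum_mono term_le) simp
  also have "\<dots> = ennreal (\<Sum>p\<le>Suc n. ?K * ((1 + t) * (real (k + p) + 1) * \<eta> p) / sqrt n)"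
  proof (rule sum_ennreal)
    fix p
    show "0 \<le> ?K * ((1 + t) * (real (k + p) + 1) * \<eta> p) / sqrt n"
      unfolding c_def[symmetric] using C(1) A_pos c_ge M_ge_1 t \<eta>01(1)[of p] by simp
  qed
  also have "\<dots> \<le> ennreal (?K * ((1 + t) * exp (- (\<alpha> / 4 * y)) * (real k + 1) * (\<Sum>p. (real p + 1) * exp (- (\<beta> / 4 * real p)))) / sqrt n)"
  proof (rule ennreal_leI)
    let ?b = "\<lambda>p. (real p + 1) * exp (- (\<beta> / 4 * real p))"
    have K0: "0 \<le> ?K" unfolding c_def[symmetric] using C(1) A_pos c_ge M_ge_1 by simp
    have "(\<Sum>p\<le>Suc n. ?K * ((1 + t) * (real (k + p) + 1) * \<eta> p) / sqrt n)
        \<le> (\<Sum>p\<le>Suc n. ?K * ((1 + t) * exp (- (\<alpha> / 4 * y)) * (real k + 1) * ?b p) / sqrt n)"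
    proof (intro sum_mono divide_right_mono mult_left_mono K0)
      fix p
      have "\<eta> p = exp (- (\<alpha> / 4 * y)) * exp (- (\<beta> / 4 * real p))"
        by (simp add: \<eta>_def add_divide_distrib flip: exp_add)
      \<comment> \<open>This product bound separates k from p, so that the sum over p becomes a
        constant.\<close>
      moreover have "real (k + p) + 1 \<le> (real k + 1) * (real p + 1)" by (simp add: algebra_simps)
      then have "(real (k + p) + 1) * ((1 + t) * \<eta> p) \<le> (real k + 1) * (real p + 1) * ((1 + t) * \<eta> p)"
        using t \<eta>01(1)[of p] by (intro mult_right_mono) auto
      ultimately show "(1 + t) * (real (k + p) + 1) * \<eta> p \<le> (1 + t) * exp (- (\<alpha> / 4 * y)) * (real k + 1) * ?b p"
        by (simp add: mult_ac)
    qed simp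
    also have "\<dots> = ?K * ((1 + t) * exp (- (\<alpha> / 4 * y)) * (real k + 1) * (\<Sum>p\<le>Suc n. ?b p)) / sqrt n"
      by (simp only: sum_distrib_left sum_divide_distrib)
    also have "\<dots> \<le> ?K * ((1 + t) * exp (- (\<alpha> / 4 * y)) * (real k + 1) * (\<Sum>p. ?b p)) / sqrt n"
      using K0 t \<beta> by (intro divide_right_mono mult_left_mono sum_le_suminf summable_linear_exp) auto
    finally show "(\<Sum>p\<le>Suc n. ?K * ((1 + t) * (real (k + p) + 1) * \<eta> p) / sqrt n) \<le> \<dots>" .
  qed
  finally show ?thesis .
qed

end

text \<open>Measurability of S can be left open because \<open>emeasure\<close> is 0 on
  non-measurable sets.\<close>

lemma emeasure_le_nn_integral:
  assumes "\<And>\<omega>. \<omega> \<in> S \<Longrightarrow> 1 \<le> g \<omega>"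
  shows "emeasure N S \<le> (\<integral>\<^sup>+\<omega>. g \<omega> \<partial>N)"
proof (cases "S \<in> sets N")
  case True
  then have "emeasure N S = (\<integral>\<^sup>+\<omega>. indicator S \<omega> \<partial>N)" by simp
  also have "\<dots> \<le> (\<integral>\<^sup>+\<omega>. g \<omega> \<partial>N)"
    using assms by (intro nn_integral_mono) (simp add: indicator_def)
  finally show ?thesis .
qed (simp add: emeasure_notin_sets)

section \<open>Summation over levels and times\<close>

context stationary_walk
begin

text \<open>Large values of the perturbation are recorded through the least level \<open>L\<close> with
  \<open>\<bar>f k\<bar> \<le> L + 1 + h k\<close> at all times \<open>k \<le> n\<close>. The allowance \<open>h k\<close> makes the exceptional
  probabilities summable in \<open>k\<close>.\<close>
lemma perturbed_survival_cover:
  assumes ev: "\<forall>j\<in>{1..n}. 0 \<le> t + walk x \<omega> j + F j - F 0"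
  shows "(1 :: ennreal) \<le> indicator {\<omega>. surv x (max t 0 + 2) n \<omega>} \<omega>
    + (\<Sum>L. \<Sum>k\<le>n. ennreal (cutoff (real L + h k) (F k)) * indicator {\<omega>. surv x (max t 0 + 2 * real L + 4) n \<omega>} \<omega>)"
proof -
  define P where "P L \<longleftrightarrow> (\<forall>k\<le>n. \<bar>F k\<bar> \<le> real L + 1 + h k)" for L
  let ?G = "\<lambda>L k. ennreal (cutoff (real L + h k) (F k)) * indicator {\<omega>. surv x (max t 0 + 2 * real L + 4) n \<omega>} \<omega>"
  have "\<exists>L. P L"
  proof -
    obtain L :: nat where L: "Max ((\<lambda>k. \<bar>F k\<bar>) ` {..n}) \<le> real L"
      using real_arch_simple by blast
    have "\<bar>F k\<bar> \<le> real L + 1 + h k" if "k \<le> n" for k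
    proof -
      have "\<bar>F k\<bar> \<le> Max ((\<lambda>k. \<bar>F k\<bar>) ` {..n})" using that by (intro Max_ge) auto
      then show ?thesis using L h_nonneg[of k] by linarith
    qed
    then show ?thesis by (auto simp: P_def)
  qed
  then have least: "P (LEAST L. P L)" by (rule LeastI_ex)
  \<comment> \<open>\<open>F j\<close> and \<open>F 0\<close> each cost \<open>L + 1\<close> in
    height; the extra \<open>h j\<close> of \<open>F j\<close> is provided by the barrier.\<close>
  have surv: "surv x (max t 0 + 2 * (real L + 1)) n \<omega>" if "P L" for L
    unfolding surv_def
  proof
    fix j assume j: "j \<in> {1..n}"
    have "\<bar>F j\<bar> \<le> real L + 1 + h j" "\<bar>F 0\<bar> \<le> real L + 1 + h 0"
      using that j unfolding P_def by auto
    moreover have "t \<le> max t 0" by simp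
    ultimately show "0 \<le> max t 0 + 2 * (real L + 1) + walk x \<omega> j + h j"
      using bspec[OF ev j] h_0 unfolding distrib_left by linarith
  qed
  show ?thesis
  proof (cases "LEAST L. P L")
    case 0
    then show ?thesis using surv[of 0] least by (simp add: add_increasing2)
  next
    case (Suc L)
    \<comment> \<open>By minimality level L fails at some k, and the margin 1 in P places
      \<open>F k\<close> where the cutoff already equals 1. Survival is known at level
      \<open>L + 1\<close>, which gives the height \<open>2 * L + 4\<close>.\<close>
    have "\<not> P L" using Suc by (metis lessI not_less_Least)
    then obtain k where k: "k \<le> n" "real L + 1 + h k < \<bar>F k\<bar>"
      by (auto simp: P_def not_le)
    have "max t 0 + 2 * (real (Suc L) + 1) = max t 0 + 2 * real L + 4" by simp
    with surv[OF least, unfolded Suc] have "surv x (max t 0 + 2 * real L + 4) n \<omega>" by metis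
    moreover have "cutoff (real L + h k) (F k) = 1" using k by (simp add: cutoff_def)
    ultimately have "1 = ?G L k" by simp
    also have "\<dots> \<le> (\<Sum>k\<le>n. ?G L k)" using k by (intro member_le_sum) auto
    also have "\<dots> \<le> (\<Sum>L. \<Sum>k\<le>n. ?G L k)"
      using sum_le_suminf[of "\<lambda>L. \<Sum>k\<le>n. ?G L k" "{L}"] by simp
    finally show ?thesis by (simp add: add_increasing)
  qed
qed

text \<open>The cover by levels L and times k is summed. The height grows linearly in L against
  exponential decay; in k, \<open>12 / \<alpha> \<le> A\<close> gives the decay
  \<open>(k + 1)^-3\<close>, of which one power pays for restarting after time k.\<close>

lemma perturbed_survival_bound:
  assumes \<alpha>: "0 < \<alpha>" and \<beta>: "0 < \<beta>" and B: "0 \<le> B" and A: "12 / \<alpha> \<le> A"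
  obtains c where "0 < c"
    "\<And>t n (f :: nat \<Rightarrow> (nat \<Rightarrow> 'g) \<Rightarrow> 'x \<Rightarrow> real). \<lbrakk>1 \<le> n;
       \<And>k. (\<lambda>(\<omega>, x). f k \<omega> x) \<in> borel_measurable (\<Omega> \<Otimes>\<^sub>M \<nu>);
       \<And>k. (\<integral>\<^sup>+x. \<integral>\<^sup>+\<omega>. ennreal (exp (\<alpha> * \<bar>f k \<omega> x\<bar>)) \<partial>\<Omega> \<partial>\<nu>) \<le> ennreal B;
       \<And>k p. ennreal (exp (\<beta> * real p)) * ((\<integral>\<^sup>+x. \<integral>\<^sup>+\<omega>. ennreal (exp (\<alpha> *
          \<bar>f k \<omega> x - real_cond_exp \<Omega> (Alg \<mu> p) (\<lambda>\<omega>'. f k \<omega>' x) \<omega>\<bar>)) \<partial>\<Omega> \<partial>\<nu>) - 1) \<le> ennreal B\<rbrakk>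
     \<Longrightarrow> (\<integral>\<^sup>+x. emeasure \<Omega> {\<omega>. \<forall>j\<in>{1..n}. 0 \<le> t + walk x \<omega> j + f j (shift j \<omega>) (pos x \<omega> j) - f 0 \<omega> x} \<partial>\<nu>)
          \<le> ennreal (c * (1 + max t 0) / sqrt n)"
proof -
  obtain C where C: "1 \<le> C" "\<And>x t n. 0 \<le> t \<Longrightarrow> 1 \<le> n \<Longrightarrow> u x t n \<le> C * (1 + t) / sqrt n"
    by (rule survival_bound) blast
  define K where "K = 2 * C * ((A + 3) * ((2 * B + 4 * B / \<alpha> + 1) * exp \<beta>) + 2 * M / a\<^sup>2)"
  define Z where "Z = (\<Sum>p. (real p + 1) * exp (- (\<beta> / 4 * real p)))"
  let ?l = "\<lambda>L. (real L + 1) * exp (- (\<alpha> / 4 * real L))"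
  let ?s = "\<lambda>k. 1 / (real k + 1)\<^sup>2"
  define ZL where "ZL = suminf ?l"
  define Zk where "Zk = suminf ?s"
  have sum_l: "summable ?l" using summable_linear_exp[of "\<alpha> / 4"] \<alpha> by simp
  have sum_s: "summable ?s"
    using summable_Suc_iff[of "\<lambda>n. 1 / real n ^ 2"] inverse_power_summable[of 2, where 'a = real]
    by (simp add: inverse_eq_divide add.commute)
  have K0: "0 \<le> K"
    unfolding K_def using C(1) A_pos M_ge_1 B \<alpha>
    by (intro mult_nonneg_nonneg add_nonneg_nonneg) auto
  have Z0: "0 \<le> Z" unfolding Z_def
    using \<beta> summable_linear_exp[of "\<beta> / 4"] by (intro suminf_nonneg) auto
  have Zk0: "0 \<le> Zk" unfolding Zk_def by (intro suminf_nonneg sum_s) auto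
  have ZL0: "0 \<le> ZL" unfolding ZL_def by (intro suminf_nonneg sum_l) auto
  \<comment> \<open>The 3 comes from \<open>1 + (t0 + 2) \<le> 3 * (1 + t0)\<close>, the 5 from
    \<open>1 + (t0 + 2 * L + 4) \<le> 5 * (1 + t0) * (L + 1)\<close>.\<close>
  define c where "c = 3 * C + 5 * (K * Z * Zk * ZL)"
  have c0: "0 < c" using C(1) K0 Z0 Zk0 ZL0 by (simp add: c_def add_pos_nonneg)
  have main: "(\<integral>\<^sup>+x. emeasure \<Omega> {\<omega>. \<forall>j\<in>{1..n}. 0 \<le> t + walk x \<omega> j + f j (shift j \<omega>) (pos x \<omega> j) - f 0 \<omega> x} \<partial>\<nu>)
        \<le> ennreal (c * (1 + max t 0) / sqrt n)"
    if n: "1 \<le> n" and f: "\<And>k. (\<lambda>(\<omega>, x). f k \<omega> x) \<in> borel_measurable (\<Omega> \<Otimes>\<^sub>M \<nu>)"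
      and Ca: "\<And>k. (\<integral>\<^sup>+x. \<integral>\<^sup>+\<omega>. ennreal (exp (\<alpha> * \<bar>f k \<omega> x\<bar>)) \<partial>\<Omega> \<partial>\<nu>) \<le> ennreal B"
      and Dab: "\<And>k p. ennreal (exp (\<beta> * real p)) * ((\<integral>\<^sup>+x. \<integral>\<^sup>+\<omega>. ennreal (exp (\<alpha> *
          \<bar>f k \<omega> x - real_cond_exp \<Omega> (Alg \<mu> p) (\<lambda>\<omega>'. f k \<omega>' x) \<omega>\<bar>)) \<partial>\<Omega> \<partial>\<nu>) - 1) \<le> ennreal B"
    for t :: real and n :: nat and f :: "nat \<Rightarrow> (nat \<Rightarrow> 'g) \<Rightarrow> 'x \<Rightarrow> real"
  proof -
    define t0 where "t0 = max t 0"
    have t0: "0 \<le> t0" by (simp add: t0_def)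
    define G where "G L k \<omega> x = ennreal (cutoff (real L + h k) (f k (shift k \<omega>) (pos x \<omega> k)))
      * indicator {\<omega>. surv x (t0 + 2 * real L + 4) n \<omega>} \<omega>" for L k \<omega> x
    let ?I = "\<lambda>\<omega> x. indicator {\<omega>. surv x (t0 + 2) n \<omega>} \<omega> :: ennreal"
    define g where "g = (1 + t0) * (K * Z) / sqrt n"
    have g0: "0 \<le> g" unfolding g_def using t0 K0 Z0 by simp
    have Gm: "(\<lambda>(\<omega>, x). G L k \<omega> x) \<in> borel_measurable (\<Omega> \<Otimes>\<^sub>M \<nu>)" for L k
    proof -
      have "(\<lambda>z. (shift k (fst z), pos (snd z) (fst z) k)) \<in> \<Omega> \<Otimes>\<^sub>M \<nu> \<rightarrow>\<^sub>M \<Omega> \<Otimes>\<^sub>M \<nu>" by measurable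
      from measurable_compose[OF this f[of k]]
      have [measurable]: "(\<lambda>z. f k (shift k (fst z)) (pos (snd z) (fst z) k)) \<in> borel_measurable (\<Omega> \<Otimes>\<^sub>M \<nu>)"
        by simp
      have "(\<lambda>z. ennreal (cutoff (real L + h k) (f k (shift k (fst z)) (pos (snd z) (fst z) k)))
          * (if surv (snd z) (t0 + 2 * real L + 4) n (fst z) then 1 else 0))
        \<in> borel_measurable (\<Omega> \<Otimes>\<^sub>M \<nu>)" by measurable
      then show ?thesis by (simp add: G_def split_beta' indicator_def)
    qed
    have Im: "(\<lambda>(\<omega>, x). ?I \<omega> x) \<in> borel_measurable (\<Omega> \<Otimes>\<^sub>M \<nu>)"
    proof -
      have "(\<lambda>z. (if surv (snd z) (t0 + 2) n (fst z) then 1 else 0) :: ennreal) \<in> borel_measurable (\<Omega> \<Otimes>\<^sub>M \<nu>)"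
        by measurable
      then show ?thesis by (simp add: split_beta' indicator_def)
    qed
    note [measurable] = measurable_section[OF Gm] measurable_section[OF Im]
      measurable_inner[OF Gm] measurable_inner[OF Im]
    have I_le: "(\<integral>\<^sup>+x. \<integral>\<^sup>+\<omega>. ?I \<omega> x \<partial>\<Omega> \<partial>\<nu>) \<le> ennreal (3 * C * (1 + t0) / sqrt n)"
    proof -
      have "(\<integral>\<^sup>+x. \<integral>\<^sup>+\<omega>. ?I \<omega> x \<partial>\<Omega> \<partial>\<nu>) \<le> (\<integral>\<^sup>+x. ennreal (3 * C * (1 + t0) / sqrt n) \<partial>\<nu>)"
        unfolding nn_integral_surv
      proof (intro nn_integral_mono ennreal_leI)
        fix x
        have "u x (t0 + 2) n \<le> C * (1 + (t0 + 2)) / sqrt n" using C(2)[of "t0 + 2" n x] t0 n by simp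
        also have "\<dots> \<le> C * (3 * (1 + t0)) / sqrt n"
          using C(1) t0 by (intro divide_right_mono mult_left_mono) auto
        finally show "u x (t0 + 2) n \<le> 3 * C * (1 + t0) / sqrt n" by (simp add: mult_ac)
      qed
      then show ?thesis using nu.emeasure_space_1 by simp
    qed
    have G_le: "(\<integral>\<^sup>+x. \<integral>\<^sup>+\<omega>. G L k \<omega> x \<partial>\<Omega> \<partial>\<nu>) \<le> ennreal (5 * g * ?l L * ?s k)" for L k
    proof -
      have y: "0 \<le> real L + h k" using h_nonneg[of k] by simp
      have tL: "0 \<le> t0 + 2 * real L + 4" using t0 by simp
      have "(\<integral>\<^sup>+x. \<integral>\<^sup>+\<omega>. G L k \<omega> x \<partial>\<Omega> \<partial>\<nu>)
        \<le> ennreal (K * ((1 + (t0 + 2 * real L + 4)) * exp (- (\<alpha> / 4 * (real L + h k))) * (real k + 1) * Z) / sqrt n)"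
        unfolding G_def K_def Z_def by (rule cutoff_survival[OF C \<alpha> \<beta> B f Ca Dab y tL n])
      also have "\<dots> \<le> ennreal (5 * g * ?l L * ?s k)"
      proof (rule ennreal_leI)
        have "exp (- (\<alpha> / 4 * h k)) \<le> exp (- (3 * ln (real k + 1)))"
        proof -
          have "3 \<le> \<alpha> / 4 * A" using A \<alpha> by (simp add: field_simps)
          then have "3 * ln (real k + 1) \<le> \<alpha> / 4 * A * ln (real k + 1)" by (intro mult_right_mono) auto
          then show ?thesis by (simp add: h_def mult_ac add.commute)
        qed
        also have "\<dots> = 1 / (real k + 1) ^ 3"
        proof -
          have "exp (3 * ln (real k + 1)) = exp (ln (real k + 1)) ^ 3"
            by (subst exp_of_nat_mult[symmetric]) simp
          then show ?thesis by (simp add: exp_minus inverse_eq_divide)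
        qed
        finally have "exp (- (\<alpha> / 4 * h k)) * (real k + 1) \<le> 1 / (real k + 1) ^ 3 * (real k + 1)"
          by (intro mult_right_mono) auto
        also have "\<dots> = ?s k" by (simp add: power3_eq_cube power2_eq_square)
        finally have ek: "exp (- (\<alpha> / 4 * h k)) * (real k + 1) \<le> ?s k" .
        have "0 \<le> 5 * t0 * real L + 3 * real L + 4 * t0" using t0 by simp
        then have tl: "1 + (t0 + 2 * real L + 4) \<le> 5 * (1 + t0) * (real L + 1)"
          by (simp add: algebra_simps)
        have "(1 + (t0 + 2 * real L + 4)) * exp (- (\<alpha> / 4 * real L)) * (exp (- (\<alpha> / 4 * h k)) * (real k + 1))
            \<le> 5 * (1 + t0) * (real L + 1) * exp (- (\<alpha> / 4 * real L)) * ?s k"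
          using ek tl t0 by (intro mult_mono) auto
        then have "K * Z / sqrt n * ((1 + (t0 + 2 * real L + 4)) * exp (- (\<alpha> / 4 * real L)) * (exp (- (\<alpha> / 4 * h k)) * (real k + 1)))
            \<le> K * Z / sqrt n * (5 * (1 + t0) * (real L + 1) * exp (- (\<alpha> / 4 * real L)) * ?s k)"
          using K0 Z0 by (intro mult_left_mono) auto
        moreover have "exp (- (\<alpha> / 4 * (real L + h k))) = exp (- (\<alpha> / 4 * real L)) * exp (- (\<alpha> / 4 * h k))"
          by (simp add: algebra_simps flip: exp_add)
        ultimately show "K * ((1 + (t0 + 2 * real L + 4)) * exp (- (\<alpha> / 4 * (real L + h k))) * (real k + 1) * Z) / sqrt n
            \<le> 5 * g * ?l L * ?s k"
          unfolding g_def by (simp only: mult_ac times_divide_eq_left times_divide_eq_right divide_divide_eq_left)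
      qed
      finally show ?thesis .
    qed
    have "(\<integral>\<^sup>+x. emeasure \<Omega> {\<omega>. \<forall>j\<in>{1..n}. 0 \<le> t + walk x \<omega> j + f j (shift j \<omega>) (pos x \<omega> j) - f 0 \<omega> x} \<partial>\<nu>)
      \<le> (\<integral>\<^sup>+x. \<integral>\<^sup>+\<omega>. ?I \<omega> x + (\<Sum>L. \<Sum>k\<le>n. G L k \<omega> x) \<partial>\<Omega> \<partial>\<nu>)"
    proof (intro nn_integral_mono emeasure_le_nn_integral)
      fix x \<omega>
      assume "\<omega> \<in> {\<omega>. \<forall>j\<in>{1..n}. 0 \<le> t + walk x \<omega> j + f j (shift j \<omega>) (pos x \<omega> j) - f 0 \<omega> x}"
      then have "\<forall>j\<in>{1..n}. 0 \<le> t + walk x \<omega> j + f j (shift j \<omega>) (pos x \<omega> j) - f 0 (shift 0 \<omega>) (pos x \<omega> 0)"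
        by (simp add: shift_def)
      from perturbed_survival_cover[of n t x \<omega> "\<lambda>j. f j (shift j \<omega>) (pos x \<omega> j)", OF this]
      show "1 \<le> ?I \<omega> x + (\<Sum>L. \<Sum>k\<le>n. G L k \<omega> x)"
        unfolding G_def t0_def .
    qed
    also have "\<dots> = (\<integral>\<^sup>+x. (\<integral>\<^sup>+\<omega>. ?I \<omega> x \<partial>\<Omega>) + (\<Sum>L. \<Sum>k\<le>n. \<integral>\<^sup>+\<omega>. G L k \<omega> x \<partial>\<Omega>) \<partial>\<nu>)"
      by (intro nn_integral_cong) (simp add: nn_integral_add nn_integral_suminf nn_integral_sum del: nn_integral_indicator)
    also have "\<dots> = (\<integral>\<^sup>+x. \<integral>\<^sup>+\<omega>. ?I \<omega> x \<partial>\<Omega> \<partial>\<nu>) + (\<Sum>L. \<Sum>k\<le>n. \<integral>\<^sup>+x. \<integral>\<^sup>+\<omega>. G L k \<omega> x \<partial>\<Omega> \<partial>\<nu>)"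
      by (simp add: nn_integral_add nn_integral_suminf nn_integral_sum del: nn_integral_indicator)
    also have "\<dots> \<le> ennreal (3 * C * (1 + t0) / sqrt n) + (\<Sum>L. \<Sum>k\<le>n. ennreal (5 * g * ?l L * ?s k))"
      by (intro add_mono I_le suminf_le sum_mono G_le) auto
    also have "(\<Sum>L. \<Sum>k\<le>n. ennreal (5 * g * ?l L * ?s k)) \<le> (\<Sum>L. ennreal (5 * g * Zk * ?l L))"
    proof (intro suminf_le)
      fix L
      have l0: "0 \<le> 5 * g * ?l L" using g0 by simp
      have "(\<Sum>k\<le>n. ennreal (5 * g * ?l L * ?s k)) = ennreal (\<Sum>k\<le>n. 5 * g * ?l L * ?s k)"
        using l0 by (intro sum_ennreal) simp
      also have "\<dots> \<le> ennreal (5 * g * Zk * ?l L)"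
      proof (rule ennreal_leI)
        have "(\<Sum>k\<le>n. 5 * g * ?l L * ?s k) = 5 * g * ?l L * (\<Sum>k\<le>n. ?s k)"
          by (simp only: sum_distrib_left)
        also have "\<dots> \<le> 5 * g * ?l L * Zk"
          unfolding Zk_def by (intro mult_left_mono l0 sum_le_suminf sum_s) auto
        finally show "(\<Sum>k\<le>n. 5 * g * ?l L * ?s k) \<le> 5 * g * Zk * ?l L" by (simp only: mult_ac)
      qed
      finally show "(\<Sum>k\<le>n. ennreal (5 * g * ?l L * ?s k)) \<le> ennreal (5 * g * Zk * ?l L)" .
    qed auto
    also have "(\<Sum>L. ennreal (5 * g * Zk * ?l L)) = ennreal (5 * g * Zk * ZL)"
    proof -
      have "(\<Sum>L. ennreal (5 * g * Zk * ?l L)) = ennreal (\<Sum>L. 5 * g * Zk * ?l L)"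
        using g0 Zk0 by (intro suminf_ennreal2 summable_mult sum_l) auto
      also have "(\<Sum>L. 5 * g * Zk * ?l L) = 5 * g * Zk * ZL"
        unfolding ZL_def by (rule suminf_mult[OF sum_l])
      finally show ?thesis .
    qed
    also have "ennreal (3 * C * (1 + t0) / sqrt n) + ennreal (5 * g * Zk * ZL)
        = ennreal (3 * C * (1 + t0) / sqrt n + 5 * g * Zk * ZL)"
      using C(1) t0 g0 Zk0 ZL0 by (intro ennreal_plus[symmetric]) auto
    also have "3 * C * (1 + t0) / sqrt n + 5 * g * Zk * ZL = c * (1 + t0) / sqrt n"
    proof -
      have "3 * C * T / q + 5 * (T * (K * Z) / q) * Zk * ZL = (3 * C + 5 * (K * Z * Zk * ZL)) * T / q" for T q :: real
        by (cases "q = 0") (simp_all add: field_simps)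
      then show ?thesis unfolding c_def g_def .
    qed
    finally show ?thesis unfolding t0_def by (simp add: add_left_mono)
  qed
  show thesis
  proof (rule that[OF c0], goal_cases)
    case (1 n f t)
    show ?case by (rule main[OF 1])
  qed
qed

end

section \<open>The strong approximation property\<close>

text \<open>To the right of any time the floor stays constant for a while and W is continuous, so a
  strict exceedance persists at a nearby rational time and a countable union suffices. Without
  measurability the bound in \<open>strong_approx\<close> would carry no information, because
  \<open>measure\<close> vanishes on non-measurable sets.\<close>

lemma sets_sup_deviation:
  fixes W :: "real \<Rightarrow> 'q \<Rightarrow> real" and S :: "nat \<Rightarrow> 'q \<Rightarrow> real"
  assumes W[measurable]: "\<And>t. W t \<in> borel_measurable Q"
    and cont: "\<And>q. q \<in> space Q \<Longrightarrow> continuous_on {0..} (\<lambda>t. W t q)"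
    and S[measurable]: "\<And>k. S k \<in> borel_measurable Q" and n: "1 \<le> n"
  shows "{q \<in> space Q. \<exists>s\<in>{0..1}. \<bar>S (nat \<lfloor>real n * s\<rfloor>) q - v * W (real n * s) q\<bar> > r} \<in> sets Q"
    (is "{q \<in> space Q. \<exists>s\<in>{0..1}. ?P s q} \<in> _")
proof -
  have "(\<exists>s\<in>{0..1}. ?P s q) \<longleftrightarrow> (\<exists>s\<in>{0..1} \<inter> \<rat>. ?P s q)" if q: "q \<in> space Q" for q
  proof
    assume "\<exists>s\<in>{0..1}. ?P s q"
    then obtain s where s: "s \<in> {0..1}" "?P s q" by blast
    show "\<exists>s\<in>{0..1} \<inter> \<rat>. ?P s q"
    \<comment> \<open>The endpoint has no admissible times to its right, but it is itself
      rational.\<close>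
    proof (cases "s = 1")
      case True
      then show ?thesis using s by (intro bexI[of _ 1]) auto
    next
      case False
      define k where "k = \<lfloor>real n * s\<rfloor>"
      let ?g = "\<lambda>s'. \<bar>S (nat k) q - v * W (real n * s') q\<bar>"
      have "continuous_on {0..} (\<lambda>s'. W (real n * s') q)"
        by (rule continuous_on_compose2[OF cont[OF q]]) (auto intro!: continuous_intros)
      then have "continuous_on {0..} ?g" by (intro continuous_intros)
      then have "(?g \<longlongrightarrow> ?g s) (at s within {0..})"
        using s by (auto simp: continuous_on_def)
      then have "(?g \<longlongrightarrow> ?g s) (at_right s)"
        by (rule tendsto_within_subset) (use s in auto)
      then have "\<forall>\<^sub>F s' in at_right s. r < ?g s'"
        using s(2) by (intro order_tendstoD(1)) (auto simp: k_def)
      then obtain e where e: "s < e" "\<And>s'. s < s' \<Longrightarrow> s' < e \<Longrightarrow> r < ?g s'"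
        unfolding eventually_at_right_field by blast
      have "real n * s < real_of_int k + 1" unfolding k_def by linarith
      then have "s < (real_of_int k + 1) / real n" using n by (simp add: field_simps)
      then have "s < min (min e 1) ((real_of_int k + 1) / real n)" using e(1) s False by auto
      then obtain s' where s': "s' \<in> \<rat>" "s < s'" "s' < min (min e 1) ((real_of_int k + 1) / real n)"
        using Rats_dense_in_real by blast
      have "\<lfloor>real n * s'\<rfloor> = k"
      proof (rule floor_unique)
        have "real n * s \<le> real n * s'" using s' by (intro mult_left_mono) auto
        then show "real_of_int k \<le> real n * s'" unfolding k_def by linarith
        show "real n * s' < real_of_int k + 1" using s'(3) n by (simp add: field_simps)
      qed
      then show ?thesis using s' s e(2)[of s'] by (intro bexI[of _ s']) auto
    qed
  qed blast
  then have "{q \<in> space Q. \<exists>s\<in>{0..1}. ?P s q} = (\<Union>s\<in>{0..1} \<inter> \<rat>. {q \<in> space Q. ?P s q})"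
    by blast
  also have "\<dots> \<in> sets Q"
    by (rule sets.countable_UN'') (auto intro: countable_rat countable_Int2)
  finally show ?thesis .
qed

text \<open>On the interval from \<open>b * s\<close> to \<open>(b + 1) * s\<close> the density is
  at least its value at the right end. The length s cancels the normalisation, so the bound does not
  depend on s.\<close>

lemma (in prob_space) normal_upper_tail_lower_bound:
  assumes X: "distributed M lborel X (\<lambda>y. ennreal (normal_density 0 s y))" and s: "0 < s" and b: "0 \<le> b"
  shows "exp (- (b + 1)\<^sup>2 / 2) / sqrt (2 * pi) \<le> prob {\<omega> \<in> space M. b * s < X \<omega>}"
proof -
  let ?c = "exp (- (b + 1)\<^sup>2 / 2) / sqrt (2 * pi)"
  have [measurable]: "X \<in> borel_measurable M" using distributed_measurable[OF X] by simp
  have dens: "?c / s \<le> normal_density 0 s y" if y: "y \<in> {b * s<..(b + 1) * s}" for y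
  proof -
    have "0 \<le> b * s" using b s by simp
    then have "y\<^sup>2 \<le> ((b + 1) * s)\<^sup>2" using y by (intro power_mono) auto
    then have "y\<^sup>2 \<le> (b + 1)\<^sup>2 * s\<^sup>2" by (simp only: power_mult_distrib)
    then have "y\<^sup>2 / (2 * s\<^sup>2) \<le> (b + 1)\<^sup>2 / 2" using s by (simp add: divide_le_eq)
    then have "exp (- (b + 1)\<^sup>2 / 2) \<le> exp (- y\<^sup>2 / (2 * s\<^sup>2))" by simp
    then have "1 / sqrt (2 * pi * s\<^sup>2) * exp (- (b + 1)\<^sup>2 / 2) \<le> 1 / sqrt (2 * pi * s\<^sup>2) * exp (- y\<^sup>2 / (2 * s\<^sup>2))"
      by (intro mult_left_mono) auto
    then show ?thesis using s by (simp add: normal_density_def real_sqrt_mult)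
  qed
  have "ennreal ?c = ennreal (?c / s) * ennreal s"
    using s by (subst ennreal_mult[symmetric]) auto
  also have "ennreal s = emeasure lborel {b * s<..(b + 1) * s}"
    using s by (simp add: distrib_right)
  also have "ennreal (?c / s) * \<dots> = (\<integral>\<^sup>+y. ennreal (?c / s) * indicator {b * s<..(b + 1) * s} y \<partial>lborel)"
    by (rule nn_integral_cmult_indicator[symmetric]) simp
  also have "\<dots> \<le> (\<integral>\<^sup>+y. ennreal (normal_density 0 s y) * indicator {b * s<..} y \<partial>lborel)"
    using dens by (intro nn_integral_mono) (auto simp: indicator_def ennreal_leI)
  also have "\<dots> = emeasure M (X -` {b * s<..} \<inter> space M)"
    by (rule distributed_emeasure[OF X, symmetric]) simp
  also have "X -` {b * s<..} \<inter> space M = {\<omega> \<in> space M. b * s < X \<omega>}" by auto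
  finally show ?thesis by (simp add: emeasure_eq_measure)
qed

text \<open>At time N the Wiener process exceeds \<open>2 / v * sqrt N\<close> with a probability
  bounded below, by scaling. Outside an event of small probability the approximation loses at most
  \<open>sqrt N\<close> of the resulting \<open>2 * sqrt N\<close>. The error bound is uniform in x,
  hence so are \<delta> and N0.\<close>

lemma strong_approx_upward:
  assumes SAP: "strong_approx gm ge \<sigma> \<mu> Q \<pi>"
    and S: "\<And>x n. Swalk gm ge \<sigma> x n \<in> borel_measurable (PP \<mu>)"
  obtains \<delta> N0 where "0 < \<delta>"
    "\<And>x N. N0 \<le> N \<Longrightarrow> \<delta> \<le> measure (PP \<mu>) {\<omega> \<in> space (PP \<mu>). Swalk gm ge \<sigma> x N \<omega> > sqrt N}"
proof -
  from SAP have Q: "prob_space Q" and \<pi>[measurable]: "\<pi> \<in> measurable Q (PP \<mu>)"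
    and dist: "distr Q (PP \<mu>) \<pi> = PP \<mu>"
    by (auto simp: strong_approx_def)
  interpret Q: prob_space Q by fact
  from SAP obtain W v where W: "std_wiener Q W" and v: "0 < v"
    and approx: "\<And>\<epsilon>. 0 < \<epsilon> \<Longrightarrow> \<epsilon> < 1/4 \<Longrightarrow> \<exists>c. \<forall>x. \<forall>n::nat. 1 \<le> n \<longrightarrow>
           measure Q {q \<in> space Q. \<exists>s\<in>{0..1}.
              \<bar>Swalk gm ge \<sigma> x (nat \<lfloor>real n * s\<rfloor>) (\<pi> q) - v * W (real n * s) q\<bar> > real n powr (1/2 - \<epsilon>)}
           \<le> c * real n powr (- \<epsilon>)"
    unfolding strong_approx_def by blast
  obtain c where c: "\<And>x n. 1 \<le> n \<Longrightarrow> measure Q {q \<in> space Q. \<exists>s\<in>{0..1}.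
              \<bar>Swalk gm ge \<sigma> x (nat \<lfloor>real n * s\<rfloor>) (\<pi> q) - v * W (real n * s) q\<bar> > real n powr (1/2 - 1/8)}
           \<le> c * real n powr (- (1/8))"
    using approx[of "1/8"] by auto
  have Wm[measurable]: "\<And>t. W t \<in> borel_measurable Q" and W0: "\<And>q. q \<in> space Q \<Longrightarrow> W 0 q = 0"
    and Wcont: "\<And>q. q \<in> space Q \<Longrightarrow> continuous_on {0..} (\<lambda>t. W t q)"
    and Wd: "\<And>t. 0 < t \<Longrightarrow> distributed Q lborel (\<lambda>q. W t q - W 0 q) (\<lambda>y. ennreal (normal_density 0 (sqrt (t - 0)) y))"
    using W unfolding std_wiener_def by auto
  have Sm[measurable]: "(\<lambda>q. Swalk gm ge \<sigma> x k (\<pi> q)) \<in> borel_measurable Q" for x k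
    by (rule measurable_compose[OF \<pi> S])
  \<comment> \<open>Half of the Gaussian lower bound; the other half covers the event where the
    approximation fails.\<close>
  define \<delta> where "\<delta> = exp (- (2 / v + 1)\<^sup>2 / 2) / sqrt (2 * pi) / 2"
  have \<delta>: "0 < \<delta>" by (simp add: \<delta>_def)
  have "(\<lambda>n. c * real n powr (- (1/8))) \<longlonglongrightarrow> 0"
    by (intro tendsto_mult_right_zero tendsto_neg_powr filterlim_real_sequentially) simp
  then have "\<forall>\<^sub>F n in sequentially. c * real n powr (- (1/8)) < \<delta>"
    using \<delta> by (rule order_tendstoD(2))
  then obtain N1 where N1: "\<And>n. N1 \<le> n \<Longrightarrow> c * real n powr (- (1/8)) < \<delta>"
    by (auto simp: eventually_sequentially)
  have "\<delta> \<le> measure (PP \<mu>) {\<omega> \<in> space (PP \<mu>). Swalk gm ge \<sigma> x N \<omega> > sqrt N}" if N: "max 1 N1 \<le> N" for x N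
  proof -
    let ?bad = "{q \<in> space Q. \<exists>s\<in>{0..1}.
        \<bar>Swalk gm ge \<sigma> x (nat \<lfloor>real N * s\<rfloor>) (\<pi> q) - v * W (real N * s) q\<bar> > real N powr (1/2 - 1/8)}"
    let ?up = "{q \<in> space Q. 2 / v * sqrt N < W N q - W 0 q}"
    let ?good = "{q \<in> space Q. Swalk gm ge \<sigma> x N (\<pi> q) > sqrt N}"
    have N0: "0 < real N" using N by simp
    have bad[measurable]: "?bad \<in> sets Q"
      by (rule sets_sup_deviation) (use Wcont N in auto)
    have "2 * \<delta> \<le> measure Q ?up"
      unfolding \<delta>_def using Q.normal_upper_tail_lower_bound[OF Wd[OF N0], of "2 / v"] N0 v by simp
    moreover have "measure Q ?bad < \<delta>"
      using c[of N x] N1[of N] N by auto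
    moreover have "measure Q ?up \<le> measure Q (?good \<union> ?bad)"
    proof (rule Q.finite_measure_mono)
      show "?up \<subseteq> ?good \<union> ?bad"
      proof
        fix q assume q: "q \<in> ?up"
        show "q \<in> ?good \<union> ?bad"
        proof (cases "q \<in> ?bad")
          case False
          then have "\<not> (\<exists>s\<in>{0..1}. \<bar>Swalk gm ge \<sigma> x (nat \<lfloor>real N * s\<rfloor>) (\<pi> q) - v * W (real N * s) q\<bar> > real N powr (1/2 - 1/8))"
            using q by blast
          then have "\<not> \<bar>Swalk gm ge \<sigma> x (nat \<lfloor>real N * 1\<rfloor>) (\<pi> q) - v * W (real N * 1) q\<bar> > real N powr (1/2 - 1/8)"
            by (meson atLeastAtMost_iff order_refl zero_le_one)
          then have "\<bar>Swalk gm ge \<sigma> x (nat \<lfloor>real N * 1\<rfloor>) (\<pi> q) - v * W (real N * 1) q\<bar> \<le> real N powr (1/2 - 1/8)"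
            by (rule leI)
          moreover have "real N powr (1/2 - 1/8) \<le> real N powr (1/2)"
            using N by (intro powr_mono) auto
          moreover have "real N powr (1/2) = sqrt N" by (simp add: powr_half_sqrt)
          moreover have "2 * sqrt N < v * W N q"
            using q v W0[of q] by (auto simp: field_simps)
          ultimately have "sqrt N < Swalk gm ge \<sigma> x N (\<pi> q)" by (simp add: abs_le_iff)
          then show ?thesis using q by auto
        qed simp
      qed
    qed measurable
    moreover have "measure Q (?good \<union> ?bad) \<le> measure Q ?good + measure Q ?bad"
      by (rule measure_Un_le) measurable
    ultimately have "\<delta> \<le> measure Q ?good" by linarith
    also have "\<dots> = measure (distr Q (PP \<mu>) \<pi>) {\<omega> \<in> space (PP \<mu>). Swalk gm ge \<sigma> x N \<omega> > sqrt N}"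
    proof (subst measure_distr)
      show "{\<omega> \<in> space (PP \<mu>). Swalk gm ge \<sigma> x N \<omega> > sqrt N} \<in> sets (PP \<mu>)"
        using S[of x N] by measurable
      show "measure Q ?good = measure Q (\<pi> -` {\<omega> \<in> space (PP \<mu>). Swalk gm ge \<sigma> x N \<omega> > sqrt N} \<inter> space Q)"
        using measurable_space[OF \<pi>] by (intro arg_cong[where f = "measure Q"]) auto
    qed measurable
    finally show ?thesis unfolding dist .
  qed
  then show thesis using \<delta> that by blast
qed

section \<open>Passage to the stopping time\<close>

lemma less_tauD:
  assumes "enat n < tau gm ge act \<sigma> f x t \<omega>" "j \<in> {1..n}"
  shows "0 \<le> t + Swalk gm ge \<sigma> x j \<omega> + case_prod (f j) ((Tmap act ^^ j) (\<omega>, x)) - f 0 \<omega> x"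
proof (rule ccontr)
  let ?P = "\<lambda>k. 1 \<le> k \<and> t + Swalk gm ge \<sigma> x k \<omega> + case_prod (f k) ((Tmap act ^^ k) (\<omega>, x)) - f 0 \<omega> x < 0"
  assume "\<not> ?thesis"
  then have P: "?P j" using assms(2) by auto
  then have "tau gm ge act \<sigma> f x t \<omega> = enat (LEAST k. ?P k)"
    unfolding tau_def Let_def by (subst if_P) blast+
  moreover have "(LEAST k. ?P k) \<le> j" using P by (rule Least_le)
  ultimately show False using assms by simp
qed

theorem theoremA2:
  fixes gm :: "'g::{second_countable_topology,t2_space} \<Rightarrow> 'g \<Rightarrow> 'g" and ge :: 'g and gi :: "'g \<Rightarrow> 'g"
    and act :: "'g \<Rightarrow> 'x::{second_countable_topology,t2_space} \<Rightarrow> 'x"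
    and \<mu> :: "'g measure" and \<nu> :: "'x measure" and \<sigma> :: "'g \<Rightarrow> 'x \<Rightarrow> real"
    and Q :: "'q measure" and \<pi> :: "'q \<Rightarrow> nat \<Rightarrow> 'g"
    and \<alpha> \<beta> B :: real
  assumes grp: "lc_group gm ge gi"
    and lcX: "locally_compact_space (euclidean :: 'x topology)"
    and actn: "cont_action gm ge act"
    and mu: "prob_space \<mu>" "sets \<mu> = sets borel"
    and nu: "prob_space \<nu>" "sets \<nu> = sets borel"
    and stationary: "\<And>A. A \<in> sets borel \<Longrightarrow>
           emeasure \<nu> A = (\<integral>\<^sup>+ g. emeasure \<nu> (act g -` A) \<partial>\<mu>)"
    and cocycle: "\<And>g1 g2 x. \<sigma> (gm g2 g1) x = \<sigma> g2 (act g1 x) + \<sigma> g1 x"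
    and cont_sigma: "continuous_on UNIV (\<lambda>(g, x). \<sigma> g x)"
    and exp_moment: "\<exists>\<alpha>'>0. (\<integral>\<^sup>+ g. (SUP x. ennreal (exp (\<alpha>' * \<bar>\<sigma> g x\<bar>))) \<partial>\<mu>) < \<infinity>"
    and centered: "\<And>x. (\<integral> g. \<sigma> g x \<partial>\<mu>) = 0"
    and SAP: "strong_approx gm ge \<sigma> \<mu> Q \<pi>"
    and \<alpha>: "\<alpha> > 0" and \<beta>: "\<beta> > 0" and B: "B \<ge> 1"
  shows "\<exists>c>0. \<forall>(t::real) (n::nat) (f :: nat \<Rightarrow> (nat \<Rightarrow> 'g) \<Rightarrow> 'x \<Rightarrow> real).
           1 \<le> n \<longrightarrow>
           (\<forall>k. (\<lambda>(\<omega>, x). f k \<omega> x) \<in> borel_measurable (PP \<mu> \<Otimes>\<^sub>M \<nu>)) \<longrightarrow>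
           Calpha \<mu> \<nu> \<alpha> f \<le> ennreal B \<longrightarrow>
           Dalphabeta \<mu> \<nu> \<alpha> \<beta> f \<le> ennreal B \<longrightarrow>
           (\<integral>\<^sup>+ x. emeasure (PP \<mu>) {\<omega> \<in> space (PP \<mu>). tau gm ge act \<sigma> f x t \<omega> > enat n} \<partial>\<nu>)
             \<le> ennreal (c * (1 + max t 0) / sqrt (real n))"
proof -
  interpret w: cocycle_walk \<mu> act \<sigma>
  proof (intro cocycle_walk.intro cocycle_walk_axioms.intro mu)
    \<comment> \<open>Second countability identifies the product of the Borel sigma-algebras with
      the Borel sigma-algebra of the product, so joint continuity gives measurability.\<close>
    show "(\<lambda>(g, x). act g x) \<in> borel \<Otimes>\<^sub>M borel \<rightarrow>\<^sub>M borel"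
      using actn unfolding borel_prod cont_action_def by (intro borel_measurable_continuous_onI) auto
    show "(\<lambda>(g, x). \<sigma> g x) \<in> borel \<Otimes>\<^sub>M borel \<rightarrow>\<^sub>M borel"
      using cont_sigma unfolding borel_prod by (intro borel_measurable_continuous_onI)
  qed
  have PP: "PP \<mu> = w.\<Omega>" by (simp add: PP_def)
  have act_e: "act ge x = x" and act_m: "act (gm g1 g2) x = act g1 (act g2 x)" for x g1 g2
    using actn by (auto simp: cont_action_def)
  have pos_eq: "act (gprod gm ge \<omega> k) x = w.pos x \<omega> k" for \<omega> k x
    by (induction k) (simp_all add: act_e act_m)
  have Swalk_eq: "Swalk gm ge \<sigma> x k \<omega> = w.walk x \<omega> k" for x k \<omega>
  proof (induction k)
    case 0
    have "gm ge ge = ge" using grp by (simp add: lc_group_def)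
    then show ?case using cocycle[of ge ge x] by (simp add: Swalk_def act_e)
  next
    case (Suc k)
    then show ?case by (simp add: Swalk_def cocycle pos_eq)
  qed
  obtain a where a: "0 < a" and fin: "(\<integral>\<^sup>+g. (SUP x. ennreal (exp (a * \<bar>\<sigma> g x\<bar>))) \<partial>\<mu>) < \<infinity>"
    using exp_moment by blast
  obtain M where M: "(\<integral>\<^sup>+g. (SUP x. ennreal (exp (a * \<bar>\<sigma> g x\<bar>))) \<partial>\<mu>) = ennreal M"
    using fin by (cases "\<integral>\<^sup>+g. (SUP x. ennreal (exp (a * \<bar>\<sigma> g x\<bar>))) \<partial>\<mu>") auto
  have "Swalk gm ge \<sigma> x n \<in> borel_measurable (PP \<mu>)" for x n
    unfolding PP Swalk_eq[abs_def] by (rule w.measurable_walk) simp_all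
  from strong_approx_upward[OF SAP this] obtain \<delta> N0 where \<delta>: "0 < \<delta>"
    and up: "\<And>x N. N0 \<le> N \<Longrightarrow> \<delta> \<le> measure (PP \<mu>) {\<omega> \<in> space (PP \<mu>). Swalk gm ge \<sigma> x N \<omega> > sqrt N}"
    by blast
  \<comment> \<open>The first bound makes the overshoot errors summable over time, the second the
    exceptional events of the perturbation.\<close>
  define A where "A = max (4 / a) (12 / \<alpha>)"
  interpret s: stationary_walk \<mu> act \<sigma> a M \<delta> N0 A \<nu>
  proof (intro stationary_walk.intro log_boundary.intro centered_walk.intro)
    show "cocycle_walk \<mu> act \<sigma>" by (rule w.cocycle_walk_axioms)
    show "centered_walk_axioms \<mu> act \<sigma> a M \<delta> N0"
    proof
      show "(\<integral>\<^sup>+g. ennreal (exp (a * \<bar>\<sigma> g x\<bar>)) \<partial>\<mu>) \<le> ennreal M" for x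
        unfolding M[symmetric] by (intro nn_integral_mono SUP_upper) simp
      show "\<delta> \<le> measure w.\<Omega> {\<omega>. w.walk x \<omega> N > sqrt N}" if "N0 \<le> N" for x N
        using up[OF that, of x] by (simp add: PP Swalk_eq)
    qed (use a \<delta> centered in auto)
    show "log_boundary_axioms a A" by standard (simp add: A_def)
    show "prob_space \<nu>" by fact
    show "stationary_walk_axioms \<mu> act \<nu>" by standard (use nu stationary in auto)
  qed
  obtain c where c: "0 < c"
    "\<And>t n (f :: nat \<Rightarrow> (nat \<Rightarrow> 'g) \<Rightarrow> 'x \<Rightarrow> real). \<lbrakk>1 \<le> n;
       \<And>k. (\<lambda>(\<omega>, x). f k \<omega> x) \<in> borel_measurable (w.\<Omega> \<Otimes>\<^sub>M \<nu>);
       \<And>k. (\<integral>\<^sup>+x. \<integral>\<^sup>+\<omega>. ennreal (exp (\<alpha> * \<bar>f k \<omega> x\<bar>)) \<partial>w.\<Omega> \<partial>\<nu>) \<le> ennreal B;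
       \<And>k p. ennreal (exp (\<beta> * real p)) * ((\<integral>\<^sup>+x. \<integral>\<^sup>+\<omega>. ennreal (exp (\<alpha> *
          \<bar>f k \<omega> x - real_cond_exp w.\<Omega> (Alg \<mu> p) (\<lambda>\<omega>'. f k \<omega>' x) \<omega>\<bar>)) \<partial>w.\<Omega> \<partial>\<nu>) - 1) \<le> ennreal B\<rbrakk>
     \<Longrightarrow> (\<integral>\<^sup>+x. emeasure w.\<Omega> {\<omega>. \<forall>j\<in>{1..n}. 0 \<le> t + w.walk x \<omega> j + f j (w.shift j \<omega>) (w.pos x \<omega> j) - f 0 \<omega> x} \<partial>\<nu>)
          \<le> ennreal (c * (1 + max t 0) / sqrt n)"
    by (rule s.perturbed_survival_bound[OF \<alpha> \<beta>, of B]) (use B in \<open>auto simp: A_def\<close>)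
  show ?thesis
  proof (intro exI[of _ c] conjI c(1) allI impI)
    fix t :: real and n :: nat and f :: "nat \<Rightarrow> (nat \<Rightarrow> 'g) \<Rightarrow> 'x \<Rightarrow> real"
    assume n: "1 \<le> n" and f: "\<forall>k. (\<lambda>(\<omega>, x). f k \<omega> x) \<in> borel_measurable (PP \<mu> \<Otimes>\<^sub>M \<nu>)"
      and C: "Calpha \<mu> \<nu> \<alpha> f \<le> ennreal B" and D: "Dalphabeta \<mu> \<nu> \<alpha> \<beta> f \<le> ennreal B"
    let ?E = "\<lambda>x. {\<omega>. \<forall>j\<in>{1..n}. 0 \<le> t + w.walk x \<omega> j + f j (w.shift j \<omega>) (w.pos x \<omega> j) - f 0 \<omega> x}"
    \<comment> \<open>Monotonicity of \<open>emeasure\<close> asks for measurability of the larger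
      set only, so the event in terms of \<open>tau\<close> can be treated as a mere subset.\<close>
    have Em: "?E x \<in> sets w.\<Omega>" for x
    proof -
      have m: "(\<lambda>\<omega>. f j (w.shift j \<omega>) (w.pos x \<omega> j)) \<in> borel_measurable w.\<Omega>" for j
      proof -
        have "(\<lambda>\<omega>. (w.shift j \<omega>, w.pos x \<omega> j)) \<in> w.\<Omega> \<rightarrow>\<^sub>M w.\<Omega> \<Otimes>\<^sub>M \<nu>" by measurable
        from measurable_compose[OF this f[rule_format, unfolded PP, of j]] show ?thesis by simp
      qed
      have [measurable]: "(\<lambda>\<omega>. f 0 \<omega> x) \<in> borel_measurable w.\<Omega>"
        using m[of 0] by (simp add: w.shift_def)
      note [measurable] = m
      have "{\<omega> \<in> space w.\<Omega>. \<forall>j\<in>{1..n}. 0 \<le> t + w.walk x \<omega> j + f j (w.shift j \<omega>) (w.pos x \<omega> j) - f 0 \<omega> x} \<in> sets w.\<Omega>"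
        by measurable
      then show ?thesis by simp
    qed
    have "(\<integral>\<^sup>+x. emeasure (PP \<mu>) {\<omega> \<in> space (PP \<mu>). tau gm ge act \<sigma> f x t \<omega> > enat n} \<partial>\<nu>)
        \<le> (\<integral>\<^sup>+x. emeasure w.\<Omega> (?E x) \<partial>\<nu>)"
      unfolding PP
    proof (intro nn_integral_mono emeasure_mono Em subsetI)
      fix x \<omega> assume "\<omega> \<in> {\<omega> \<in> space w.\<Omega>. tau gm ge act \<sigma> f x t \<omega> > enat n}"
      then show "\<omega> \<in> ?E x"
        using less_tauD[of n gm ge act \<sigma> f x t \<omega>] by (simp add: w.funpow_Tmap Swalk_eq)
    qed
    also have "\<dots> \<le> ennreal (c * (1 + max t 0) / sqrt n)"
    proof (rule c(2)[OF n])
      show "(\<lambda>(\<omega>, x). f k \<omega> x) \<in> borel_measurable (w.\<Omega> \<Otimes>\<^sub>M \<nu>)" for k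
        using f by (simp add: PP)
      show "(\<integral>\<^sup>+x. \<integral>\<^sup>+\<omega>. ennreal (exp (\<alpha> * \<bar>f k \<omega> x\<bar>)) \<partial>w.\<Omega> \<partial>\<nu>) \<le> ennreal B" for k
        by (rule order_trans[OF _ C[unfolded Calpha_def PP]]) (rule SUP_upper, simp)
      show "ennreal (exp (\<beta> * real p)) * ((\<integral>\<^sup>+x. \<integral>\<^sup>+\<omega>. ennreal (exp (\<alpha> *
          \<bar>f k \<omega> x - real_cond_exp w.\<Omega> (Alg \<mu> p) (\<lambda>\<omega>'. f k \<omega>' x) \<omega>\<bar>)) \<partial>w.\<Omega> \<partial>\<nu>) - 1) \<le> ennreal B" for k p
        by (rule order_trans[OF _ D[unfolded Dalphabeta_def PP]]) (rule SUP_upper2[of k], simp, rule SUP_upper, simp)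
    qed
    finally show "(\<integral>\<^sup>+x. emeasure (PP \<mu>) {\<omega> \<in> space (PP \<mu>). tau gm ge act \<sigma> f x t \<omega> > enat n} \<partial>\<nu>)
        \<le> ennreal (c * (1 + max t 0) / sqrt n)" .
  qed
qed

end
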